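(* Let $G\subset SU(2)$ be a binary polyhedral group (a nontrivial finite subgroup of $SU(2)$, i.e. of type $\tilde A_n,\tilde D_n,\tilde E_6,\tilde E_7$ or $\tilde E_8$), let $R$ be its defining $2$-dimensional representation, and let $d=2$. Let $\alpha_1,\dots,\alpha_n$ be the simple roots of the simple Lie algebra whose Cartan matrix is the Euclidean Cartan matrix $\widetilde M[R](1)$, with $\alpha_i$ corresponding to $R_i$, and let $\sum_{i=1}^nr_i\alpha_i$ be the sum of all positive roots. Then for $i=1,\dots,n$ $$r_i=\frac{(-1)^d}{|G|}\sum_{j=1}^nd_id_j\left(\eta^0_0-\frac{\eta^i_0}{d_i}-\frac{\eta^0_j}{d_j}+\frac{\eta^i_j}{d_id_j}\right)$$ $$=\frac{2}{\mu_0|G|}\sum_{j=1}^nd_id_j\left.\left(D[R]^0_0-\frac{D[R]^i_0}{d_i}-\frac{D[R]^0_j}{d_j}+\frac{D[R]^i_j}{d_id_j}\right)^{(d)}\right|_{q=1}$$ $$=\frac{2}{|G|}\sum_{j=1}^nd_id_j\,\mathrm{Res}_{q=1}\frac{M[R_S(q)]^0_0-\frac{M[R_S(q)]^i_0}{d_i}-\frac{M[R_S(q)]^0_j}{d_j}+\frac{M[R_S(q)]^i_j}{d_id_j}}{1-q}$$ $$=\frac{2}{|G|^2}\sum_{j=1}^n\sum_{k=1}^n\frac{|C_k|(\chi_i(g_k)-d_i)(\overline{\chi_j(g_k)}-d_j)}{\det (E-R(g_k))},$$ where $(\cdot)^{(d)}$ denotes the $d$-th (here second) derivative with respect to $q$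.
   Context: $\mathrm{Res}_{q=1}f$ denotes the coefficient of $(1-q)^{-1}$ in the Laurent expansion of the rational function $f(q)$ in powers of $1-q$. $R_0$ (trivial), $R_1,\dots,R_n$ are the irreducible complex representations of $G$ up to isomorphism, with characters $\chi_0,\dots,\chi_n$, $d_i=\dim R_i$; $C_0,\dots,C_n$ are the conjugacy classes of $G$, $g_k\in C_k$ is a representative, $g_0$ is the identity. $E$ is the identity matrix. With $(R,Q)=\frac1{|G|}\sum_{g\in G}\chi^R(g)\overline{\chi^Q(g)}$ ($\chi^R$ the character of $R$), the Clebsch–Gordan matrix $M[Q]$ of a representation $Q$ is the matrix with entries $M[Q]^i_j=(Q\otimes R_i,R_j)$ (row $i$, column $j$), $0\le i,j\le n$; it is extended linearly to formal power series in $q$ with coefficients in the representation ring. $R_S(q)=\sum_{m\ge0}R_S^mq^m$ and $R_A(q)=\sum_{m\ge0}R_A^mq^m$, where $R_S^m$, $R_A^m$ are the $m$-th symmetric and exterior powers of $R$; the entries $M[R_S(q)]^i_j$ are expansions of rational functions of $q$. By the McKay correspondence $M[R_A(-q)]|_{q=1}=2E-M[R]$ is the affine Cartan matrix of a simple (simply laced) Lie algebra, and deleting the row and column with index $0$ (trivial representation) gives the Euclidean Cartan matrix $\widetilde M[R](1)$ of the same Lie algebra; thus $R_1,\dots,R_n$ correspond to the vertices of the Dynkin diagram, i.e. to the simple roots. Let $V$ be the space of $R$ and $S=\mathrm{Sym}(V)$. Fix a homogeneous system of parameters $\theta_1,\theta_2$ of the invariant algebra $S^G$, $n_k=\deg\theta_k$.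 For each $j$ the graded module of covariants $\mathrm{Hom}_G(R_j,S)$ is a free $\mathbb C[\theta_1,\theta_2]$-module of finite rank $\mu_j$; let $m_{1j},\dots,m_{\mu_jj}$ be the degrees of a homogeneous basis. Put $D[R]^0_j=\sum_{k=1}^{\mu_j}q^{m_{kj}}$, so that $M[R_S(q)]^0_j=\frac{D[R]^0_j}{(1-q^{n_1})(1-q^{n_2})}$ and $\mu_0|G|=n_1n_2$. Put $D[R]^i_j=\sum_{k=0}^n(R_i\otimes R_k,R_j)\,D[R]^0_k$ for $0\le i,j\le n$. $\eta^0_j$ denotes the Atiyah–Patodi–Singer $\eta$-invariant (of $S^3/G$, associated with $R_j$), given by the known formula $\eta^0_j=\frac{(-1)^d2}{|G|}\sum_{k:\ \det (E-R(g_k))\neq 0}\frac{|C_k|\overline{\chi_j(g_k)}}{\det (E-R(g_k))}$ with $d=2$, which may be taken as the definition here; the generalized $\eta$-invariants are $\eta^i_j=\sum_{k=0}^n(R_i\otimes R_k,R_j)\,\eta^0_k$.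
   Formalization: As printed the formulas fail (for G={1,-1}, r_1=1, but they give 1/2, 2, 1/2, 1/2): one factor 1/|G| is dropped from the eta, residue and character expressions, and the d-th derivative in the D[R] expression is divided by d!. *)

theory Defs
  imports
    "HOL-Analysis.Euclidean_Space"
    "HOL-Algebra.Group_Action"
    "HOL-Computational_Algebra.Formal_Laurent_Series"
    "Jordan_Normal_Form.Schur_Decomposition"
begin

hide_const (open) Multiset.mult

section \<open>Matrix representations of a group\<close>

definition SU2 :: "complex mat monoid" where
  "SU2 = \<lparr>carrier = {A \<in> carrier_mat 2 2. A * mat_adjoint A = 1\<^sub>m 2 \<and> det A = 1},
          mult = (*), one = 1\<^sub>m 2\<rparr>"

definition rep_dim :: "'g monoid \<Rightarrow> ('g \<Rightarrow> complex mat) \<Rightarrow> nat" where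
  "rep_dim \<Gamma> \<rho> = dim_row (\<rho> \<one>\<^bsub>\<Gamma>\<^esub>)"

definition matrix_rep :: "'g monoid \<Rightarrow> ('g \<Rightarrow> complex mat) \<Rightarrow> bool" where
  "matrix_rep \<Gamma> \<rho> \<longleftrightarrow>
     (\<forall>g\<in>carrier \<Gamma>. \<rho> g \<in> carrier_mat (rep_dim \<Gamma> \<rho>) (rep_dim \<Gamma> \<rho>)) \<and>
     \<rho> \<one>\<^bsub>\<Gamma>\<^esub> = 1\<^sub>m (rep_dim \<Gamma> \<rho>) \<and>
     (\<forall>g\<in>carrier \<Gamma>. \<forall>h\<in>carrier \<Gamma>. \<rho> (g \<otimes>\<^bsub>\<Gamma>\<^esub> h) = \<rho> g * \<rho> h)"

definition irreducible_rep :: "'g monoid \<Rightarrow> ('g \<Rightarrow> complex mat) \<Rightarrow> bool" where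
  "irreducible_rep \<Gamma> \<rho> \<longleftrightarrow> matrix_rep \<Gamma> \<rho> \<and> rep_dim \<Gamma> \<rho> > 0 \<and>
     (\<forall>W. VectorSpace.subspace class_ring W (module_vec TYPE(complex) (rep_dim \<Gamma> \<rho>)) \<and>
          (\<forall>g\<in>carrier \<Gamma>. \<forall>w\<in>W. \<rho> g *\<^sub>v w \<in> W) \<longrightarrow>
          W = {0\<^sub>v (rep_dim \<Gamma> \<rho>)} \<or> W = carrier_vec (rep_dim \<Gamma> \<rho>))"

definition rep_iso :: "'g monoid \<Rightarrow> ('g \<Rightarrow> complex mat) \<Rightarrow> ('g \<Rightarrow> complex mat) \<Rightarrow> bool" where
  "rep_iso \<Gamma> \<rho> \<sigma> \<longleftrightarrow> rep_dim \<Gamma> \<rho> = rep_dim \<Gamma> \<sigma> \<and>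
     (\<exists>P \<in> carrier_mat (rep_dim \<Gamma> \<rho>) (rep_dim \<Gamma> \<rho>).
        invertible_mat P \<and> (\<forall>g\<in>carrier \<Gamma>. P * \<rho> g = \<sigma> g * P))"

definition complete_irreps :: "'g monoid \<Rightarrow> nat \<Rightarrow> (nat \<Rightarrow> 'g \<Rightarrow> complex mat) \<Rightarrow> bool" where
  "complete_irreps \<Gamma> n \<rho> \<longleftrightarrow>
     (\<forall>i\<le>n. irreducible_rep \<Gamma> (\<rho> i)) \<and>
     (\<forall>i\<le>n. \<forall>j\<le>n. rep_iso \<Gamma> (\<rho> i) (\<rho> j) \<longrightarrow> i = j) \<and>
     (\<forall>\<sigma>. irreducible_rep \<Gamma> \<sigma> \<longrightarrow> (\<exists>i\<le>n. rep_iso \<Gamma> \<sigma> (\<rho> i))) \<and>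
     (\<forall>g\<in>carrier \<Gamma>. \<rho> 0 g = 1\<^sub>m 1)"

definition rep_char :: "('g \<Rightarrow> complex mat) \<Rightarrow> 'g \<Rightarrow> complex" where
  "rep_char \<rho> g = (\<Sum>a<dim_row (\<rho> g). \<rho> g $$ (a, a))"

definition rep_inner :: "'g monoid \<Rightarrow> ('g \<Rightarrow> complex mat) \<Rightarrow> ('g \<Rightarrow> complex mat) \<Rightarrow> complex" where
  "rep_inner \<Gamma> \<rho> \<sigma> =
     (\<Sum>g\<in>carrier \<Gamma>. rep_char \<rho> g * cnj (rep_char \<sigma> g)) / of_nat (card (carrier \<Gamma>))"

definition kronecker :: "'a::semiring_0 mat \<Rightarrow> 'a mat \<Rightarrow> 'a mat" where
  "kronecker A B = mat (dim_row A * dim_row B) (dim_col A * dim_col B)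
     (\<lambda>(i, j). A $$ (i div dim_row B, j div dim_col B) * B $$ (i mod dim_row B, j mod dim_col B))"

definition tensor_rep ::
  "('g \<Rightarrow> complex mat) \<Rightarrow> ('g \<Rightarrow> complex mat) \<Rightarrow> 'g \<Rightarrow> complex mat" where
  "tensor_rep \<rho> \<sigma> g = kronecker (\<rho> g) (\<sigma> g)"

text \<open>The Clebsch--Gordan entry \<open>M[Q]\<close> in row \<open>i\<close> (upper index) and column \<open>j\<close> (lower index).\<close>
definition clebsch_gordan ::
  "'g monoid \<Rightarrow> (nat \<Rightarrow> 'g \<Rightarrow> complex mat) \<Rightarrow> ('g \<Rightarrow> complex mat) \<Rightarrow> nat \<Rightarrow> nat \<Rightarrow> complex" where
  "clebsch_gordan \<Gamma> \<rho> Q i j = rep_inner \<Gamma> (tensor_rep Q (\<rho> i)) (\<rho> j)"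

definition conj_classes :: "('g, 'b) monoid_scheme \<Rightarrow> 'g set set" where
  "conj_classes \<Gamma> = orbits \<Gamma> (carrier \<Gamma>)
     (\<lambda>g. \<lambda>h\<in>carrier \<Gamma>. g \<otimes>\<^bsub>\<Gamma>\<^esub> h \<otimes>\<^bsub>\<Gamma>\<^esub> inv\<^bsub>\<Gamma>\<^esub> g)"

section \<open>The symmetric algebra of a two-dimensional representation\<close>

text \<open>
  \<open>S = Sym(V)\<close> for \<open>V = \<complex>\<^sup>2\<close> is the polynomial ring in the two basis vectors \<open>e\<^sub>0\<close>, \<open>e\<^sub>1\<close> of \<open>V\<close>
  (not in the dual coordinates), encoded as \<^typ>\<open>complex poly poly\<close>: the coefficient of
  \<open>e\<^sub>0\<^sup>a e\<^sub>1\<^sup>b\<close> in \<open>p\<close> is \<open>coeff (coeff p b) a\<close>.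
\<close>
type_synonym sym_alg = "complex poly poly"

definition scalar :: "complex \<Rightarrow> sym_alg" where
  "scalar c = [:[:c:]:]"

definition sym_subst :: "sym_alg \<Rightarrow> sym_alg \<Rightarrow> sym_alg \<Rightarrow> sym_alg" where
  "sym_subst p u v =
     (\<Sum>b\<le>degree p. \<Sum>a\<le>degree (coeff p b). scalar (coeff (coeff p b) a) * u ^ a * v ^ b)"

text \<open>The element \<open>g e\<^sub>j = g\<^sub>0\<^sub>j e\<^sub>0 + g\<^sub>1\<^sub>j e\<^sub>1\<close> of \<open>V\<close>.\<close>
definition sym_lin :: "complex mat \<Rightarrow> nat \<Rightarrow> sym_alg" where
  "sym_lin g j = [:[:0, g $$ (0, j):], [:g $$ (1, j):]:]"

definition sym_act :: "complex mat \<Rightarrow> sym_alg \<Rightarrow> sym_alg" where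
  "sym_act g p = sym_subst p (sym_lin g 0) (sym_lin g 1)"

definition sym_homogeneous :: "nat \<Rightarrow> sym_alg \<Rightarrow> bool" where
  "sym_homogeneous m p \<longleftrightarrow> (\<forall>a b. coeff (coeff p b) a \<noteq> 0 \<longrightarrow> a + b = m)"

definition sym_monom :: "nat \<Rightarrow> nat \<Rightarrow> sym_alg" where
  "sym_monom a b = monom (monom 1 a) b"

text \<open>The matrix of \<open>g\<close> on \<open>Sym\<^sup>m(V)\<close> in the basis \<open>e\<^sub>0\<^sup>m\<^sup>-\<^sup>b e\<^sub>1\<^sup>b\<close>, \<open>b = 0, \<dots>, m\<close>.\<close>
definition sym_power :: "nat \<Rightarrow> complex mat \<Rightarrow> complex mat" where
  "sym_power m g = mat (m + 1) (m + 1)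
     (\<lambda>(i, j). coeff (coeff (sym_act g (sym_monom (m - j) j)) i) (m - i))"

definition cg_sym_series ::
  "complex mat monoid \<Rightarrow> (nat \<Rightarrow> complex mat \<Rightarrow> complex mat) \<Rightarrow> nat \<Rightarrow> nat \<Rightarrow> complex fps" where
  "cg_sym_series \<Gamma> \<rho> i j = Abs_fps (\<lambda>m. clebsch_gordan \<Gamma> \<rho> (sym_power m) i j)"

section \<open>Invariants and covariants\<close>

definition sym_invariants :: "complex mat set \<Rightarrow> sym_alg set" where
  "sym_invariants G = {p. \<forall>g\<in>G. sym_act g p = p}"

text \<open>The subalgebra \<open>\<complex>[\<theta>\<^sub>1, \<theta>\<^sub>2]\<close> of \<open>S\<close>.\<close>
definition param_alg :: "sym_alg \<Rightarrow> sym_alg \<Rightarrow> sym_alg set" where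
  "param_alg \<theta>1 \<theta>2 = range (\<lambda>f. sym_subst f \<theta>1 \<theta>2)"

definition hsop :: "complex mat set \<Rightarrow> sym_alg \<Rightarrow> nat \<Rightarrow> sym_alg \<Rightarrow> nat \<Rightarrow> bool" where
  "hsop G \<theta>1 n1 \<theta>2 n2 \<longleftrightarrow>
     \<theta>1 \<in> sym_invariants G \<and> sym_homogeneous n1 \<theta>1 \<and> n1 > 0 \<and>
     \<theta>2 \<in> sym_invariants G \<and> sym_homogeneous n2 \<theta>2 \<and> n2 > 0 \<and>
     (\<forall>f. sym_subst f \<theta>1 \<theta>2 = 0 \<longrightarrow> f = 0) \<and>
     (\<exists>F \<subseteq> sym_invariants G. finite F \<and>
        (\<forall>p\<in>sym_invariants G. \<exists>c\<in>F \<rightarrow> param_alg \<theta>1 \<theta>2. p = (\<Sum>f\<in>F. c f * f)))"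

text \<open>
  A linear map from \<open>\<complex>\<^sup>d\<close> to \<open>S\<close> is recorded by the vector \<open>b\<close> of the images of the \<open>d\<close> standard
  basis vectors; \<open>covariants\<close> is \<open>Hom\<^sub>G(\<rho>, S)\<close> in this form.
\<close>
definition covariants ::
  "complex mat monoid \<Rightarrow> (complex mat \<Rightarrow> complex mat) \<Rightarrow> sym_alg vec set" where
  "covariants \<Gamma> \<rho> = {b \<in> carrier_vec (rep_dim \<Gamma> \<rho>).
     \<forall>g\<in>carrier \<Gamma>. \<forall>a<rep_dim \<Gamma> \<rho>.
       sym_act g (b $ a) = (\<Sum>c<rep_dim \<Gamma> \<rho>. scalar (\<rho> g $$ (c, a)) * b $ c)}"

definition covariant_basis ::
  "complex mat monoid \<Rightarrow> (complex mat \<Rightarrow> complex mat) \<Rightarrow> sym_alg \<Rightarrow> sym_alg \<Rightarrow>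
   nat \<Rightarrow> (nat \<Rightarrow> nat) \<Rightarrow> (nat \<Rightarrow> sym_alg vec) \<Rightarrow> bool" where
  "covariant_basis \<Gamma> \<rho> \<theta>1 \<theta>2 \<mu> m B \<longleftrightarrow>
     (\<forall>k\<in>{1..\<mu>}. B k \<in> covariants \<Gamma> \<rho> \<and>
        (\<forall>a<rep_dim \<Gamma> \<rho>. sym_homogeneous (m k) (B k $ a))) \<and>
     (\<forall>b\<in>covariants \<Gamma> \<rho>. \<exists>!c. c \<in> {1..\<mu>} \<rightarrow>\<^sub>E param_alg \<theta>1 \<theta>2 \<and>
        (\<forall>a<rep_dim \<Gamma> \<rho>. b $ a = (\<Sum>k=1..\<mu>. c k * B k $ a)))"

text \<open>The arguments \<open>\<mu> j\<close> and \<open>m k j\<close> are the rank and the degrees \<open>m\<^sub>k\<^sub>j\<close> of a homogeneous basis.\<close>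
definition covariant_poly ::
  "complex mat monoid \<Rightarrow> nat \<Rightarrow> (nat \<Rightarrow> complex mat \<Rightarrow> complex mat) \<Rightarrow>
   (nat \<Rightarrow> nat) \<Rightarrow> (nat \<Rightarrow> nat \<Rightarrow> nat) \<Rightarrow> nat \<Rightarrow> nat \<Rightarrow> complex poly" where
  "covariant_poly \<Gamma> n \<rho> \<mu> m i j =
     (\<Sum>k=0..n. Polynomial.smult (rep_inner \<Gamma> (tensor_rep (\<rho> i) (\<rho> k)) (\<rho> j))
        (\<Sum>l=1..\<mu> k. monom 1 (m l k)))"

section \<open>The eta invariants\<close>

definition eta0 ::
  "nat \<Rightarrow> complex mat monoid \<Rightarrow> nat \<Rightarrow> (nat \<Rightarrow> complex mat \<Rightarrow> complex mat) \<Rightarrow>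
   (nat \<Rightarrow> complex mat set) \<Rightarrow> (nat \<Rightarrow> complex mat) \<Rightarrow> nat \<Rightarrow> complex" where
  "eta0 d \<Gamma> n \<rho> C g j = (-1) ^ d * 2 / of_nat (card (carrier \<Gamma>)) *
     (\<Sum>k | k \<le> n \<and> det (1\<^sub>m 2 - g k) \<noteq> 0.
        of_nat (card (C k)) * cnj (rep_char (\<rho> j) (g k)) / det (1\<^sub>m 2 - g k))"

definition eta ::
  "nat \<Rightarrow> complex mat monoid \<Rightarrow> nat \<Rightarrow> (nat \<Rightarrow> complex mat \<Rightarrow> complex mat) \<Rightarrow>
   (nat \<Rightarrow> complex mat set) \<Rightarrow> (nat \<Rightarrow> complex mat) \<Rightarrow> nat \<Rightarrow> nat \<Rightarrow> complex" where
  "eta d \<Gamma> n \<rho> C g i j =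
     (\<Sum>k=0..n. rep_inner \<Gamma> (tensor_rep (\<rho> i) (\<rho> k)) (\<rho> j) * eta0 d \<Gamma> n \<rho> C g k)"

section \<open>Laurent expansion at \<open>q = 1\<close>\<close>

text \<open>
  For a power series \<open>F\<close> that is the expansion at \<open>q = 0\<close> of a rational function \<open>P / Q\<close>,
  this is the Laurent series of \<open>P / Q\<close> in the variable \<open>t = 1 - q\<close>, i.e. of
  \<open>P(1 - t) / Q(1 - t)\<close> at \<open>t = 0\<close>. It is independent of the choice of \<open>P\<close> and \<open>Q\<close>.
\<close>
definition laurent_at_one :: "complex fps \<Rightarrow> complex fls" where
  "laurent_at_one F = (THE L. \<exists>P Q. Q \<noteq> 0 \<and> F * fps_of_poly Q = fps_of_poly P \<and>
     L = fps_to_fls (fps_of_poly (P \<circ>\<^sub>p [:1, -1:])) / fps_to_fls (fps_of_poly (Q \<circ>\<^sub>p [:1, -1:])))"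

text \<open>The coefficient of \<open>(1 - q)\<^sup>-\<^sup>1\<close>; it is minus the usual residue at \<open>q = 1\<close>.\<close>
definition res_one :: "complex fps \<Rightarrow> complex" where
  "res_one F = fls_nth (laurent_at_one F) (-1)"

section \<open>Root systems\<close>

definition root_system :: "'v::euclidean_space set \<Rightarrow> bool" where
  "root_system \<Phi> \<longleftrightarrow> finite \<Phi> \<and> 0 \<notin> \<Phi> \<and> Real_Vector_Spaces.span \<Phi> = UNIV \<and>
     (\<forall>a\<in>\<Phi>. \<forall>b\<in>\<Phi>. b - (2 * inner b a / inner a a) *\<^sub>R a \<in> \<Phi>) \<and>
     (\<forall>a\<in>\<Phi>. \<forall>b\<in>\<Phi>. 2 * inner b a / inner a a \<in> \<int>) \<and>
     (\<forall>a\<in>\<Phi>. \<forall>c. c *\<^sub>R a \<in> \<Phi> \<longrightarrow> c = 1 \<or> c = -1)"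

definition irreducible_root_system :: "'v::euclidean_space set \<Rightarrow> bool" where
  "irreducible_root_system \<Phi> \<longleftrightarrow> root_system \<Phi> \<and> \<Phi> \<noteq> {} \<and>
     (\<forall>A B. A \<union> B = \<Phi> \<and> A \<noteq> {} \<and> B \<noteq> {} \<longrightarrow> (\<exists>a\<in>A. \<exists>b\<in>B. inner a b \<noteq> 0))"

definition positive_roots :: "'v::euclidean_space set \<Rightarrow> nat \<Rightarrow> (nat \<Rightarrow> 'v) \<Rightarrow> 'v set" where
  "positive_roots \<Phi> n \<alpha> = {b \<in> \<Phi>. \<exists>k :: nat \<Rightarrow> nat. b = (\<Sum>i=1..n. of_nat (k i) *\<^sub>R \<alpha> i)}"

definition simple_roots :: "'v::euclidean_space set \<Rightarrow> nat \<Rightarrow> (nat \<Rightarrow> 'v) \<Rightarrow> bool" where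
  "simple_roots \<Phi> n \<alpha> \<longleftrightarrow> inj_on \<alpha> {1..n} \<and> \<alpha> ` {1..n} \<subseteq> \<Phi> \<and>
     Real_Vector_Spaces.independent (\<alpha> ` {1..n}) \<and>
     (\<forall>b\<in>\<Phi>. b \<in> positive_roots \<Phi> n \<alpha> \<or> - b \<in> positive_roots \<Phi> n \<alpha>)"

definition cartan_entry :: "(nat \<Rightarrow> 'v::euclidean_space) \<Rightarrow> nat \<Rightarrow> nat \<Rightarrow> real" where
  "cartan_entry \<alpha> i j = 2 * inner (\<alpha> i) (\<alpha> j) / inner (\<alpha> j) (\<alpha> j)"

text \<open>
  On the normalisation of the formulas for the sum of the positive roots. The entry in row \<open>i\<close>,
  column \<open>j\<close> of the inverse Cartan matrix is \<open>|G|\<^sup>-\<^sup>1\<close> times the sum over \<open>g \<noteq> 1\<close> of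
  \<open>(\<chi>\<^sub>i(g) - d\<^sub>i) (cnj \<chi>\<^sub>j(g) - d\<^sub>j) / det(E - g)\<close>, and \<open>r\<^sub>i\<close> is twice the \<open>i\<close>-th row sum. The printed
  source has a superfluous factor \<open>|G|\<^sup>-\<^sup>1\<close> in the eta, residue and character sums and lacks
  \<open>1/d!\<close> (with \<open>d = 2\<close>) at the \<open>d\<close>-th derivative: for \<open>G = {1, -1}\<close>, where \<open>r\<^sub>1 = 1\<close>, its four
  expressions are 1/2, 2, 1/2, 1/2. The constants here are the correct ones.
\<close>

end

theory Submission
  imports Defs "Jordan_Normal_Form.Spectral_Radius"
begin

text \<open>
  Write \<open>A\<^sub>i\<^sub>j\<close> for \<open>|G|\<^sup>-\<^sup>1\<close> times the sum over \<open>g \<noteq> 1\<close> of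
  \<open>(\<chi>\<^sub>i(g) - d\<^sub>i) (cnj \<chi>\<^sub>j(g) - d\<^sub>j) / det(E - g)\<close>. The matrix \<open>A\<close> is inverse to the Cartan matrix,
  \<open>r\<^sub>i\<close> is twice its \<open>i\<close>-th row sum, and each of the four expressions is a way of writing
  \<open>2 \<Sum>\<^sub>j A\<^sub>i\<^sub>j\<close>. In the formal text \<open>A\<close> is called \<open>inv_cartan\<close>.

  The inverse (\<open>inv_cartan_inverse\<close>). Row \<open>l\<close> of the affine Cartan matrix applied to the vector
  \<open>(cnj \<chi>\<^sub>j(g) - d\<^sub>j)\<^sub>j\<close> gives \<open>(2 - tr g) cnj \<chi>\<^sub>l(g)\<close>, because \<open>R \<otimes> R\<^sub>l\<close> decomposes with
  multiplicities \<open>M[R]\<^sup>l\<^sub>j\<close> and has dimension \<open>2 d\<^sub>l\<close>; the entry of the vector at \<open>j = 0\<close> is \<open>0\<close>, so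
  the row of the Euclidean matrix does the same. Since \<open>det g = 1\<close>, the factor \<open>2 - tr g\<close> is
  \<open>det(E - g)\<close> and cancels the denominator of \<open>A\<close>; what is left is row orthogonality of characters.
  On the root side, the reflection in a simple root permutes the other positive roots, so the sum of
  the positive roots has Cartan integer \<open>2\<close> with every simple root
  (\<open>sum_positive_roots_cartan\<close>), and \<open>r\<close> solves the linear system that \<open>A\<close> inverts.

  The four expressions. The character sum is \<open>A\<close> collected by conjugacy classes. Column
  orthogonality gives \<open>\<Sum>\<^sub>k (R\<^sub>i \<otimes> R\<^sub>k, R\<^sub>j) cnj \<chi>\<^sub>k = \<chi>\<^sub>i cnj \<chi>\<^sub>j\<close> (\<open>fusion_cnj\<close>), which turns the
  generalized eta invariants into sums over the group. By Molien's formula (\<open>molien_series\<close>)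
  \<open>M[R\<^sub>S(q)]\<^sup>i\<^sub>j\<close> is the average of \<open>\<chi>\<^sub>i(g) cnj \<chi>\<^sub>j(g) / det(E - q g)\<close>; in the combination that occurs
  in the theorem the double pole of the term \<open>g = 1\<close> cancels, and the value at \<open>q = 1\<close> is
  \<open>A\<^sub>i\<^sub>j / (d\<^sub>i d\<^sub>j)\<close> (\<open>value_M_reduced\<close>), which is the residue after division by \<open>1 - q\<close>. Finally
  \<open>D[R]\<^sup>i\<^sub>j = (1 - q^n1) (1 - q^n2) M[R\<^sub>S(q)]\<^sup>i\<^sub>j\<close> (\<open>covariant_poly_series\<close>), where the first two factors
  have a double zero with leading coefficient \<open>n1 n2 = \<mu>\<^sub>0 |G|\<close>; so half of the second derivative is
  \<open>\<mu>\<^sub>0 |G|\<close> times the same value.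

  The character theory is derived from Schur's lemma. The relation between \<open>D\<close> and \<open>M\<close> is a dimension
  count: the trace of the projection of \<open>Hom(R\<^sub>j, Sym\<^sup>m V)\<close> onto the equivariant maps is a multiplicity
  on the one hand and the number of basis elements of degree \<open>m\<close> on the other
  (\<open>trace_eq_card_basis\<close>, \<open>covariant_dimension\<close>).
\<close>

(* the dollar sign is used for vector entries only *)
no_notation fps_nth (infixl "$" 75)

section \<open>Matrices and traces\<close>

definition mat_trace :: "'a::semiring_0 mat \<Rightarrow> 'a" where
  "mat_trace A = (\<Sum>a<dim_row A. A $$ (a, a))"

lemma mat_mult_entry:
  assumes "A \<in> carrier_mat p q" "B \<in> carrier_mat q r" "a < p" "b < r"
  shows "(A * B) $$ (a, b) = (\<Sum>c<q. A $$ (a, c) * B $$ (c, b))"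
  using assms by (auto simp: scalar_prod_def lessThan_atLeast0 intro!: sum.cong)

lemma mat_trace_comm:
  fixes A B :: "'a::comm_semiring_0 mat"
  assumes "A \<in> carrier_mat p q" "B \<in> carrier_mat q p"
  shows "mat_trace (A * B) = mat_trace (B * A)"
proof -
  have "mat_trace (A * B) = (\<Sum>a<p. \<Sum>c<q. A $$ (a, c) * B $$ (c, a))"
    using assms by (simp add: mat_trace_def mat_mult_entry[OF assms] del: index_mult_mat(1))
  also have "\<dots> = (\<Sum>c<q. \<Sum>a<p. B $$ (c, a) * A $$ (a, c))"
    by (subst sum.swap) (simp add: mult.commute)
  also have "\<dots> = mat_trace (B * A)"
    using assms by (simp add: mat_trace_def mat_mult_entry[OF assms(2,1)] del: index_mult_mat(1))
  finally show ?thesis .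
qed

lemma det_2:
  assumes A: "A \<in> carrier_mat 2 2"
  shows "det A = A $$ (0, 0) * A $$ (1, 1) - A $$ (0, 1) * A $$ (1, 0)"
proof -
  have "det (mat_delete A i 0) = A $$ (1 - i, 1)" if i: "i < 2" for i
  proof -
    have M: "mat_delete A i 0 \<in> carrier_mat 1 1" using A mat_delete_carrier[of A 2 2 i 0] by simp
    have "dim_row A = 2" "dim_col A = 2" using A by auto
    then show ?thesis unfolding det_single[OF M] using i by (cases "i = 0") (simp_all add: mat_delete_def)
  qed
  then show ?thesis
    using laplace_expansion_column[OF A, of 0] by (simp add: numeral_2_eq_2 cofactor_def mult.commute)
qed

lemma rep_char_trace: "rep_char \<rho> g = mat_trace (\<rho> g)"
  by (simp add: rep_char_def mat_trace_def)

lemma eq_mat_by_vec: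
  fixes A B :: "'a::comm_semiring_1 mat"
  assumes A: "A \<in> carrier_mat p q" and B: "B \<in> carrier_mat p q"
    and eq: "\<And>v. v \<in> carrier_vec q \<Longrightarrow> A *\<^sub>v v = B *\<^sub>v v"
  shows "A = B"
proof (rule mat_col_eqI)
  fix j assume "j < dim_col B"
  then have j: "j < q" using B by simp
  have "A *\<^sub>v unit_vec q j = col A j" "B *\<^sub>v unit_vec q j = col B j"
    using A B j by (auto simp: intro!: eq_vecI)
  then show "col A j = col B j" using eq[of "unit_vec q j"] by simp
qed (use A B in auto)

section \<open>Schur's lemma\<close>

lemma subspace_kernel:
  assumes T: "(T :: complex mat) \<in> carrier_mat p q"
  shows "VectorSpace.subspace class_ring {w \<in> carrier_vec q. T *\<^sub>v w = 0\<^sub>v p}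
           (module_vec TYPE(complex) q)"
  unfolding VectorSpace.subspace_def submodule_def module_vec_simps
  using T by (auto simp: vec_vs vec_module mult_add_distrib_mat_vec mult_mat_vec)

lemma subspace_image:
  assumes T: "(T :: complex mat) \<in> carrier_mat p q"
  shows "VectorSpace.subspace class_ring ((\<lambda>w. T *\<^sub>v w) ` carrier_vec q)
           (module_vec TYPE(complex) p)"
proof -
  have 1: "T *\<^sub>v v + T *\<^sub>v w \<in> (\<lambda>w. T *\<^sub>v w) ` carrier_vec q"
    if "v \<in> carrier_vec q" "w \<in> carrier_vec q" for v w
    using that T by (intro image_eqI[of _ _ "v + w"]) (auto simp: mult_add_distrib_mat_vec)
  have 2: "c \<cdot>\<^sub>v (T *\<^sub>v v) \<in> (\<lambda>w. T *\<^sub>v w) ` carrier_vec q"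
    if "v \<in> carrier_vec q" for v c
    using that T by (intro image_eqI[of _ _ "c \<cdot>\<^sub>v v"]) (auto simp: mult_mat_vec)
  have 3: "0\<^sub>v p \<in> (\<lambda>w. T *\<^sub>v w) ` carrier_vec q"
    using T by (intro image_eqI[of _ _ "0\<^sub>v q"]) auto
  show ?thesis
    unfolding VectorSpace.subspace_def submodule_def module_vec_simps
    using T 1 2 3 by (auto simp: vec_vs vec_module)
qed

text \<open>
  Traces replace dimension theory: \<open>tr (A B) = tr (B A)\<close> reads \<open>p = q\<close>, and characteristic \<open>0\<close>
  makes this an equality of numbers.
\<close>
lemma two_sided_inverse_square:
  fixes A B :: "'a::{comm_ring_1,ring_char_0} mat"
  assumes A: "A \<in> carrier_mat p q" and B: "B \<in> carrier_mat q p"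
    and AB: "A * B = 1\<^sub>m p" and BA: "B * A = 1\<^sub>m q"
  shows "p = q"
proof -
  have "(of_nat p :: 'a) = of_nat q"
    using mat_trace_comm[OF A B] unfolding AB BA by (simp add: mat_trace_def)
  then show ?thesis by simp
qed

locale fin_group = group \<Gamma> for \<Gamma> :: "'g monoid" (structure) +
  assumes fin: "finite (carrier \<Gamma>)"
begin

lemma sum_left_translate:
  assumes "h \<in> carrier \<Gamma>"
  shows "(\<Sum>g\<in>carrier \<Gamma>. f (h \<otimes> g)) = (\<Sum>g\<in>carrier \<Gamma>. f g)"
  by (rule sum.reindex_bij_witness[of _ "\<lambda>g. inv h \<otimes> g" "\<lambda>g. h \<otimes> g"])
     (use assms in \<open>auto simp: m_assoc[symmetric]\<close>)

lemma sum_right_translate: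
  assumes "h \<in> carrier \<Gamma>"
  shows "(\<Sum>g\<in>carrier \<Gamma>. f (g \<otimes> h)) = (\<Sum>g\<in>carrier \<Gamma>. f g)"
  by (rule sum.reindex_bij_witness[of _ "\<lambda>g. g \<otimes> inv h" "\<lambda>g. g \<otimes> h"])
     (use assms in \<open>auto simp: m_assoc\<close>)

lemma card_pos: "card (carrier \<Gamma>) > 0"
  using fin one_closed by (auto simp: card_gt_0_iff)

lemma rep_carrier:
  "matrix_rep \<Gamma> \<rho> \<Longrightarrow> g \<in> carrier \<Gamma> \<Longrightarrow> \<rho> g \<in> carrier_mat (rep_dim \<Gamma> \<rho>) (rep_dim \<Gamma> \<rho>)"
  by (simp add: matrix_rep_def)

lemma rep_mult:
  "matrix_rep \<Gamma> \<rho> \<Longrightarrow> g \<in> carrier \<Gamma> \<Longrightarrow> h \<in> carrier \<Gamma> \<Longrightarrow> \<rho> (g \<otimes> h) = \<rho> g * \<rho> h"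
  by (simp add: matrix_rep_def)

lemma rep_one: "matrix_rep \<Gamma> \<rho> \<Longrightarrow> \<rho> \<one> = 1\<^sub>m (rep_dim \<Gamma> \<rho>)"
  by (simp add: matrix_rep_def)

lemma rep_mult_entry:
  assumes "matrix_rep \<Gamma> \<rho>" "g \<in> carrier \<Gamma>" "h \<in> carrier \<Gamma>"
    "a < rep_dim \<Gamma> \<rho>" "b < rep_dim \<Gamma> \<rho>"
  shows "\<rho> (g \<otimes> h) $$ (a, b) = (\<Sum>c<rep_dim \<Gamma> \<rho>. \<rho> g $$ (a, c) * \<rho> h $$ (c, b))"
  unfolding rep_mult[OF assms(1-3)]
  by (rule mat_mult_entry) (use assms rep_carrier in auto)

lemma rep_inv_mult:
  assumes "matrix_rep \<Gamma> \<rho>" "g \<in> carrier \<Gamma>"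
  shows "\<rho> (inv g) * \<rho> g = 1\<^sub>m (rep_dim \<Gamma> \<rho>)" "\<rho> g * \<rho> (inv g) = 1\<^sub>m (rep_dim \<Gamma> \<rho>)"
  using rep_mult[OF assms(1), of "inv g" g] rep_mult[OF assms(1), of g "inv g"] rep_one[OF assms(1)] assms(2)
  by auto

text \<open>
  Kernel and image of an intertwiner are invariant subspaces, so a nonzero one is injective and
  surjective. Preimages of the unit vectors are the columns of an inverse.
\<close>
theorem schur_iso:
  assumes ir: "irreducible_rep \<Gamma> \<rho>" and irs: "irreducible_rep \<Gamma> \<sigma>"
    and T: "T \<in> carrier_mat (rep_dim \<Gamma> \<rho>) (rep_dim \<Gamma> \<sigma>)"
    and int: "\<And>g. g \<in> carrier \<Gamma> \<Longrightarrow> \<rho> g * T = T * \<sigma> g"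
    and nz: "T \<noteq> 0\<^sub>m (rep_dim \<Gamma> \<rho>) (rep_dim \<Gamma> \<sigma>)"
  shows "rep_iso \<Gamma> \<sigma> \<rho>"
proof -
  define p q where "p = rep_dim \<Gamma> \<rho>" and "q = rep_dim \<Gamma> \<sigma>"
  note T = T[folded p_def q_def] and nz = nz[folded p_def q_def]
  have mr: "matrix_rep \<Gamma> \<rho>" and ms: "matrix_rep \<Gamma> \<sigma>"
    using ir irs by (auto simp: irreducible_rep_def)
  have r: "\<rho> g \<in> carrier_mat p p" and s: "\<sigma> g \<in> carrier_mat q q" if "g \<in> carrier \<Gamma>" for g
    using rep_carrier[OF mr that] rep_carrier[OF ms that] by (auto simp: p_def q_def)
  define K where "K = {w \<in> carrier_vec q. T *\<^sub>v w = 0\<^sub>v p}"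
  define I where "I = (\<lambda>w. T *\<^sub>v w) ` carrier_vec q"
  have "\<sigma> g *\<^sub>v w \<in> K" if "g \<in> carrier \<Gamma>" "w \<in> K" for g w
  proof -
    have "T *\<^sub>v (\<sigma> g *\<^sub>v w) = (T * \<sigma> g) *\<^sub>v w" using T s[OF that(1)] that(2) by (simp add: K_def assoc_mult_mat_vec[OF T s[OF that(1)]])
    also have "\<dots> = \<rho> g *\<^sub>v (T *\<^sub>v w)"
      using int[OF that(1), symmetric] T r[OF that(1)] that by (auto simp: K_def)
    also have "\<dots> = 0\<^sub>v p" using r[OF that(1)] that(2) by (auto simp: K_def)
    finally show ?thesis using s[OF that(1)] that by (auto simp: K_def)
  qed
  then have K: "K = {0\<^sub>v q} \<or> K = carrier_vec q"
    using irs subspace_kernel[OF T] unfolding irreducible_rep_def K_def q_def by blast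
  have "\<rho> g *\<^sub>v w \<in> I" if g: "g \<in> carrier \<Gamma>" and wI: "w \<in> I" for g w
  proof -
    obtain v where v: "v \<in> carrier_vec q" "w = T *\<^sub>v v" using wI unfolding I_def by blast
    have "\<rho> g *\<^sub>v w = (\<rho> g * T) *\<^sub>v v" using T r[OF g] v by auto
    also have "\<dots> = T *\<^sub>v (\<sigma> g *\<^sub>v v)" using int[OF g] T s[OF g] v by auto
    finally show ?thesis using s[OF g] v by (auto simp: I_def)
  qed
  then have I: "I = {0\<^sub>v p} \<or> I = carrier_vec p"
    using ir subspace_image[OF T] unfolding irreducible_rep_def I_def p_def by blast
  have "\<exists>v\<in>carrier_vec q. T *\<^sub>v v \<noteq> 0\<^sub>v p"
  proof (rule ccontr)
    assume "\<not> ?thesis"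
    then have "T = 0\<^sub>m p q" by (intro eq_mat_by_vec[OF T]) auto
    with nz show False by simp
  qed
  then have K: "K = {0\<^sub>v q}" and I: "I = carrier_vec p"
    using K I by (auto simp: K_def I_def)
  have "\<forall>a. \<exists>w. a < p \<longrightarrow> w \<in> carrier_vec q \<and> T *\<^sub>v w = unit_vec p a"
    using I unfolding I_def image_def by (smt (verit) mem_Collect_eq unit_vec_carrier)
  then obtain w where w: "\<And>a. a < p \<Longrightarrow> w a \<in> carrier_vec q"
    "\<And>a. a < p \<Longrightarrow> T *\<^sub>v w a = unit_vec p a" by metis
  define S where "S = mat_of_cols q (map w [0..<p])"
  have S: "S \<in> carrier_mat q p" using mat_of_cols_carrier(1)[of q "map w [0..<p]"] by (simp add: S_def)
  have TS: "T * S = 1\<^sub>m p"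
  proof (rule mat_col_eqI)
    fix a assume "a < dim_col (1\<^sub>m p :: complex mat)"
    then have a: "a < p" by simp
    have "col S a = w a" using a w(1)[OF a] by (simp add: S_def)
    then show "col (T * S) a = col (1\<^sub>m p) a"
      using a w(2)[OF a] col_mult2[OF T S a] by simp
  qed (use T S in auto)
  have ST: "S * T = 1\<^sub>m q"
  proof (rule eq_mat_by_vec)
    fix v :: "complex vec" assume v: "v \<in> carrier_vec q"
    define u where "u = S * T *\<^sub>v v - v"
    have u: "u \<in> carrier_vec q" using S T v by (simp add: u_def)
    have "T *\<^sub>v (S * T *\<^sub>v v) = (T * S) *\<^sub>v (T *\<^sub>v v)"
      using S T v by (simp add: assoc_mult_mat_vec[of _ q p] assoc_mult_mat_vec[of _ p q])
    also have "\<dots> = T *\<^sub>v v" using TS T v by simp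
    finally have "T *\<^sub>v u = 0\<^sub>v p"
      using S T v by (simp add: u_def mult_minus_distrib_mat_vec[OF T])
    then have "u = 0\<^sub>v q" using K u by (auto simp: K_def)
    have "(S * T *\<^sub>v v) $ i = v $ i" if "i < q" for i
      using arg_cong[OF \<open>u = 0\<^sub>v q\<close>, of "\<lambda>u::complex vec. u $ i"] that S T v by (simp add: u_def del: index_mult_mat_vec)
    then have "S * T *\<^sub>v v = v" using S T v by (intro eq_vecI) (auto simp del: index_mult_mat_vec)
    then show "S * T *\<^sub>v v = 1\<^sub>m q *\<^sub>v v" using v by simp
  qed (use S T in auto)
  have pq: "p = q" by (rule two_sided_inverse_square[OF T S TS ST])
  have "invertible_mat T"
    using T S TS ST pq by (auto simp: invertible_mat_def inverts_mat_def)
  then show ?thesis using T pq int unfolding rep_iso_def p_def q_def by auto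
qed

lemma smult_mat_one_vec: "w \<in> carrier_vec p \<Longrightarrow> (c \<cdot>\<^sub>m 1\<^sub>m p) *\<^sub>v w = c \<cdot>\<^sub>v (w :: complex vec)"
  by (intro eq_vecI) (auto simp: scalar_prod_def if_distrib[of "\<lambda>x. c * x"] if_distrib[of "\<lambda>x. x * _"] cong: if_cong)

text \<open>
  If \<open>c\<close> is an eigenvalue of \<open>T\<close>, then \<open>T - c\<close> is an intertwiner with nonzero kernel, and this
  kernel can only be the whole space.
\<close>
theorem schur_scalar:
  assumes ir: "irreducible_rep \<Gamma> \<rho>"
    and T: "T \<in> carrier_mat (rep_dim \<Gamma> \<rho>) (rep_dim \<Gamma> \<rho>)"
    and int: "\<And>g. g \<in> carrier \<Gamma> \<Longrightarrow> \<rho> g * T = T * \<rho> g"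
  obtains c where "T = c \<cdot>\<^sub>m 1\<^sub>m (rep_dim \<Gamma> \<rho>)"
proof -
  define p where "p = rep_dim \<Gamma> \<rho>"
  note T = T[folded p_def]
  have mr: "matrix_rep \<Gamma> \<rho>" and "p > 0"
    using ir by (auto simp: irreducible_rep_def p_def)
  have r: "\<rho> g \<in> carrier_mat p p" if "g \<in> carrier \<Gamma>" for g
    using rep_carrier[OF mr that] by (auto simp: p_def)
  obtain c where "c \<in> spectrum T" using spectrum_non_empty[OF T] \<open>p > 0\<close> by auto
  then obtain v where v: "v \<in> carrier_vec p" "v \<noteq> 0\<^sub>v p" "T *\<^sub>v v = c \<cdot>\<^sub>v v"
    using T by (auto simp: spectrum_def eigenvalue_def eigenvector_def)
  define U where "U = T - c \<cdot>\<^sub>m 1\<^sub>m p"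
  have U: "U \<in> carrier_mat p p" unfolding U_def by (rule minus_carrier_mat) simp
  have Uv: "U *\<^sub>v w = T *\<^sub>v w - c \<cdot>\<^sub>v w" if "w \<in> carrier_vec p" for w
    using T that by (intro eq_vecI) (auto simp: U_def minus_mult_distrib_mat_vec[of _ p p] smult_mat_one_vec simp del: index_mult_mat_vec)
  define K where "K = {w \<in> carrier_vec p. U *\<^sub>v w = 0\<^sub>v p}"
  have "\<rho> g *\<^sub>v w \<in> K" if g: "g \<in> carrier \<Gamma>" and "w \<in> K" for g w
  proof -
    have w: "w \<in> carrier_vec p" "T *\<^sub>v w - c \<cdot>\<^sub>v w = 0\<^sub>v p" using that Uv by (auto simp: K_def)
    have "U *\<^sub>v (\<rho> g *\<^sub>v w) = (T * \<rho> g) *\<^sub>v w - c \<cdot>\<^sub>v (\<rho> g *\<^sub>v w)"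
      using T r[OF g] w by (simp add: Uv)
    also have "\<dots> = \<rho> g *\<^sub>v (T *\<^sub>v w) - \<rho> g *\<^sub>v (c \<cdot>\<^sub>v w)"
      using T r[OF g] w by (simp add: int[OF g, symmetric] mult_mat_vec[OF r[OF g]])
    also have "\<dots> = \<rho> g *\<^sub>v (T *\<^sub>v w - c \<cdot>\<^sub>v w)"
      using mult_minus_distrib_mat_vec[OF r[OF g], of "T *\<^sub>v w" "c \<cdot>\<^sub>v w"] T w(1) by simp
    also have "\<dots> = 0\<^sub>v p" using w r[OF g] by auto
    finally show ?thesis using r[OF g] w by (auto simp: K_def)
  qed
  then have "K = {0\<^sub>v p} \<or> K = carrier_vec p"
    using ir subspace_kernel[OF U] unfolding irreducible_rep_def K_def p_def by blast
  moreover have "v \<in> K" using v Uv[OF v(1)] by (auto simp: K_def)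
  ultimately have K: "K = carrier_vec p" using v by auto
  have "T = c \<cdot>\<^sub>m 1\<^sub>m p"
  proof (rule eq_mat_by_vec[OF T])
    fix w :: "complex vec" assume w: "w \<in> carrier_vec p"
    then have 0: "T *\<^sub>v w - c \<cdot>\<^sub>v w = 0\<^sub>v p" using K Uv[OF w] unfolding K_def by (metis (mono_tags, lifting) mem_Collect_eq)
    have "(T *\<^sub>v w) $ i = c * w $ i" if "i < p" for i
      using arg_cong[OF 0, of "\<lambda>u::complex vec. u $ i"] that T w by (simp del: index_mult_mat_vec)
    then show "T *\<^sub>v w = c \<cdot>\<^sub>m 1\<^sub>m p *\<^sub>v w"
      using T w by (intro eq_vecI) (auto simp: smult_mat_one_vec simp del: index_mult_mat_vec)
  qed auto
  then show thesis using that unfolding p_def by blast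
qed

section \<open>Orthogonality of characters\<close>

text \<open>
  The averages of the elementary matrices \<open>E\<^sub>b\<^sub>c\<close>. Schur's lemma applied to them yields the
  orthogonality relations for the matrix entries.
\<close>
lemma average_intertwines:
  assumes mr: "matrix_rep \<Gamma> \<rho>" and ms: "matrix_rep \<Gamma> \<sigma>"
    and b: "b < rep_dim \<Gamma> \<rho>" and c: "c < rep_dim \<Gamma> \<sigma>" and h: "h \<in> carrier \<Gamma>"
  defines "T \<equiv> mat (rep_dim \<Gamma> \<rho>) (rep_dim \<Gamma> \<sigma>)
      (\<lambda>(a, d). \<Sum>g\<in>carrier \<Gamma>. \<rho> g $$ (a, b) * \<sigma> (inv g) $$ (c, d))"
  shows "\<rho> h * T = T * \<sigma> h"
proof -
  define p q where "p = rep_dim \<Gamma> \<rho>" and "q = rep_dim \<Gamma> \<sigma>"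
  have T: "T \<in> carrier_mat p q" by (simp add: T_def p_def q_def)
  have r: "\<rho> h \<in> carrier_mat p p" and s: "\<sigma> h \<in> carrier_mat q q"
    using rep_carrier[OF mr h] rep_carrier[OF ms h] by (auto simp: p_def q_def)
  show ?thesis
  proof (rule eq_matI)
    fix a d assume "a < dim_row (T * \<sigma> h)" "d < dim_col (T * \<sigma> h)"
    then have a: "a < p" and d: "d < q" using T s by auto
    have "(\<rho> h * T) $$ (a, d) = (\<Sum>x<p. \<rho> h $$ (a, x) * T $$ (x, d))"
      by (rule mat_mult_entry[OF r T a d])
    also have "\<dots> = (\<Sum>x<p. \<Sum>g\<in>carrier \<Gamma>. \<rho> h $$ (a, x) * \<rho> g $$ (x, b) * \<sigma> (inv g) $$ (c, d))"
      using d by (simp add: T_def p_def q_def sum_distrib_left mult.assoc)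
    also have "\<dots> = (\<Sum>g\<in>carrier \<Gamma>. (\<Sum>x<p. \<rho> h $$ (a, x) * \<rho> g $$ (x, b)) * \<sigma> (inv g) $$ (c, d))"
      by (subst sum.swap) (simp add: sum_distrib_right)
    also have "\<dots> = (\<Sum>g\<in>carrier \<Gamma>. \<rho> (h \<otimes> g) $$ (a, b) * \<sigma> (inv (h \<otimes> g) \<otimes> h) $$ (c, d))"
      using h a b by (intro sum.cong refl)
        (simp add: rep_mult_entry[OF mr h] p_def inv_mult_group m_assoc)
    also have "\<dots> = (\<Sum>g\<in>carrier \<Gamma>. \<rho> g $$ (a, b) * \<sigma> (inv g \<otimes> h) $$ (c, d))"
      by (rule sum_left_translate[OF h, of "\<lambda>g. \<rho> g $$ (a, b) * \<sigma> (inv g \<otimes> h) $$ (c, d)"])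
    also have "\<dots> = (\<Sum>g\<in>carrier \<Gamma>. \<rho> g $$ (a, b) * (\<Sum>x<q. \<sigma> (inv g) $$ (c, x) * \<sigma> h $$ (x, d)))"
      using h c d by (intro sum.cong refl) (simp add: rep_mult_entry[OF ms _ h] q_def)
    also have "\<dots> = (\<Sum>x<q. \<Sum>g\<in>carrier \<Gamma>. \<rho> g $$ (a, b) * \<sigma> (inv g) $$ (c, x) * \<sigma> h $$ (x, d))"
      by (subst sum.swap) (simp add: sum_distrib_left mult.assoc)
    also have "\<dots> = (\<Sum>x<q. T $$ (a, x) * \<sigma> h $$ (x, d))"
      using a by (simp add: T_def p_def q_def sum_distrib_right)
    also have "\<dots> = (T * \<sigma> h) $$ (a, d)"
      by (rule mat_mult_entry[OF T s a d, symmetric])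
    finally show "(\<rho> h * T) $$ (a, d) = (T * \<sigma> h) $$ (a, d)" .
  qed (use T r s in auto)
qed

lemma schur_orthogonality_distinct:
  assumes ir: "irreducible_rep \<Gamma> \<rho>" and irs: "irreducible_rep \<Gamma> \<sigma>"
    and ni: "\<not> rep_iso \<Gamma> \<sigma> \<rho>"
    and "a < rep_dim \<Gamma> \<rho>" "b < rep_dim \<Gamma> \<rho>" "c < rep_dim \<Gamma> \<sigma>" "d < rep_dim \<Gamma> \<sigma>"
  shows "(\<Sum>g\<in>carrier \<Gamma>. \<rho> g $$ (a, b) * \<sigma> (inv g) $$ (c, d)) = 0"
proof -
  define T where "T = mat (rep_dim \<Gamma> \<rho>) (rep_dim \<Gamma> \<sigma>)
      (\<lambda>(a, d). \<Sum>g\<in>carrier \<Gamma>. \<rho> g $$ (a, b) * \<sigma> (inv g) $$ (c, d))"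
  have "T \<in> carrier_mat (rep_dim \<Gamma> \<rho>) (rep_dim \<Gamma> \<sigma>)" by (simp add: T_def)
  moreover have "\<rho> g * T = T * \<sigma> g" if "g \<in> carrier \<Gamma>" for g
    unfolding T_def using ir irs assms that
    by (intro average_intertwines) (auto simp: irreducible_rep_def)
  ultimately have "T = 0\<^sub>m (rep_dim \<Gamma> \<rho>) (rep_dim \<Gamma> \<sigma>)"
    using schur_iso[OF ir irs] ni by blast
  then have "T $$ (a, d) = 0" using assms by simp
  then show ?thesis using assms by (simp add: T_def)
qed

text \<open>
  Here the average is a scalar matrix, and its trace determines the scalar.
\<close>
lemma schur_orthogonality_same:
  assumes ir: "irreducible_rep \<Gamma> \<rho>"
    and abcd: "a < rep_dim \<Gamma> \<rho>" "b < rep_dim \<Gamma> \<rho>" "c < rep_dim \<Gamma> \<rho>" "d < rep_dim \<Gamma> \<rho>"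
  shows "(\<Sum>g\<in>carrier \<Gamma>. \<rho> g $$ (a, b) * \<rho> (inv g) $$ (c, d)) =
    (if a = d \<and> b = c then of_nat (card (carrier \<Gamma>)) / of_nat (rep_dim \<Gamma> \<rho>) else 0)"
proof -
  define p where "p = rep_dim \<Gamma> \<rho>"
  have mr: "matrix_rep \<Gamma> \<rho>" and p: "p > 0" using ir by (auto simp: irreducible_rep_def p_def)
  define T where "T = mat (rep_dim \<Gamma> \<rho>) (rep_dim \<Gamma> \<rho>)
      (\<lambda>(a, d). \<Sum>g\<in>carrier \<Gamma>. \<rho> g $$ (a, b) * \<rho> (inv g) $$ (c, d))"
  have "T \<in> carrier_mat (rep_dim \<Gamma> \<rho>) (rep_dim \<Gamma> \<rho>)" by (simp add: T_def)
  moreover have "\<rho> g * T = T * \<rho> g" if "g \<in> carrier \<Gamma>" for g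
    unfolding T_def using mr abcd that by (intro average_intertwines) auto
  ultimately obtain l where l: "T = l \<cdot>\<^sub>m 1\<^sub>m p"
    using schur_scalar[OF ir] unfolding p_def by blast
  have "of_nat p * l = mat_trace T" by (simp add: l mat_trace_def)
  also have "\<dots> = (\<Sum>a<p. \<Sum>g\<in>carrier \<Gamma>. \<rho> (inv g) $$ (c, a) * \<rho> g $$ (a, b))"
    by (simp add: mat_trace_def T_def p_def mult.commute)
  also have "\<dots> = (\<Sum>g\<in>carrier \<Gamma>. \<rho> (inv g \<otimes> g) $$ (c, b))"
    unfolding p_def by (subst sum.swap, rule sum.cong[OF refl], rule rep_mult_entry[symmetric]) (use mr abcd in auto)
  also have "\<dots> = (if b = c then of_nat (card (carrier \<Gamma>)) else 0)"
    using abcd by (auto simp: rep_one[OF mr])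
  finally have "l = (if b = c then of_nat (card (carrier \<Gamma>)) / of_nat p else 0)"
    using p by (auto simp: field_simps)
  moreover have "T $$ (a, d) = (if a = d then l else 0)"
    using abcd by (simp add: l p_def)
  moreover have "T $$ (a, d) = (\<Sum>g\<in>carrier \<Gamma>. \<rho> g $$ (a, b) * \<rho> (inv g) $$ (c, d))"
    using abcd by (simp add: T_def)
  ultimately show ?thesis by (auto simp: p_def)
qed

lemma rep_char_sum:
  "matrix_rep \<Gamma> \<rho> \<Longrightarrow> g \<in> carrier \<Gamma> \<Longrightarrow> rep_char \<rho> g = (\<Sum>a<rep_dim \<Gamma> \<rho>. \<rho> g $$ (a, a))"
  using rep_carrier[of \<rho> g] by (auto simp: rep_char_def)

lemma char_orthogonality_inv:
  assumes ir: "irreducible_rep \<Gamma> \<rho>" and irs: "irreducible_rep \<Gamma> \<sigma>"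
  shows "\<not> rep_iso \<Gamma> \<sigma> \<rho> \<Longrightarrow> (\<Sum>g\<in>carrier \<Gamma>. rep_char \<rho> g * rep_char \<sigma> (inv g)) = 0"
    and "(\<Sum>g\<in>carrier \<Gamma>. rep_char \<rho> g * rep_char \<rho> (inv g)) = of_nat (card (carrier \<Gamma>))"
proof -
  have mr: "matrix_rep \<Gamma> \<rho>" and ms: "matrix_rep \<Gamma> \<sigma>" and p: "rep_dim \<Gamma> \<rho> > 0"
    using ir irs by (auto simp: irreducible_rep_def)
  have *: "(\<Sum>g\<in>carrier \<Gamma>. rep_char \<rho> g * rep_char \<tau> (inv g)) =
      (\<Sum>a<rep_dim \<Gamma> \<rho>. \<Sum>c<rep_dim \<Gamma> \<tau>. \<Sum>g\<in>carrier \<Gamma>. \<rho> g $$ (a, a) * \<tau> (inv g) $$ (c, c))"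
    if mt: "matrix_rep \<Gamma> \<tau>" for \<tau>
  proof -
    have "(\<Sum>g\<in>carrier \<Gamma>. rep_char \<rho> g * rep_char \<tau> (inv g)) =
      (\<Sum>g\<in>carrier \<Gamma>. \<Sum>a<rep_dim \<Gamma> \<rho>. \<Sum>c<rep_dim \<Gamma> \<tau>. \<rho> g $$ (a, a) * \<tau> (inv g) $$ (c, c))"
      by (intro sum.cong refl) (simp add: rep_char_sum[OF mr] rep_char_sum[OF mt] sum_product)
    also have "\<dots> = (\<Sum>a<rep_dim \<Gamma> \<rho>. \<Sum>g\<in>carrier \<Gamma>. \<Sum>c<rep_dim \<Gamma> \<tau>. \<rho> g $$ (a, a) * \<tau> (inv g) $$ (c, c))"
      by (rule sum.swap)
    also have "\<dots> = (\<Sum>a<rep_dim \<Gamma> \<rho>. \<Sum>c<rep_dim \<Gamma> \<tau>. \<Sum>g\<in>carrier \<Gamma>. \<rho> g $$ (a, a) * \<tau> (inv g) $$ (c, c))"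
      by (rule sum.cong[OF refl], rule sum.swap)
    finally show ?thesis .
  qed
  show "(\<Sum>g\<in>carrier \<Gamma>. rep_char \<rho> g * rep_char \<sigma> (inv g)) = 0" if "\<not> rep_iso \<Gamma> \<sigma> \<rho>"
    unfolding *[OF ms] using schur_orthogonality_distinct[OF ir irs that] by simp
  show "(\<Sum>g\<in>carrier \<Gamma>. rep_char \<rho> g * rep_char \<rho> (inv g)) = of_nat (card (carrier \<Gamma>))"
    unfolding *[OF mr] using schur_orthogonality_same[OF ir] p by (simp add: sum.delta')
qed

text \<open>
  Weyl's unitary trick: \<open>H\<close> is the average of the forms \<open>\<rho>(g)\<^sup>* \<rho>(g)\<close>. It is invertible because
  \<open>v\<^sup>* H v\<close> contains the summand \<open>|v|\<^sup>2\<close> that comes from \<open>g = 1\<close>.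
\<close>
lemma invariant_form:
  assumes mr: "matrix_rep \<Gamma> \<rho>"
  defines "p \<equiv> rep_dim \<Gamma> \<rho>"
  obtains H B where "H \<in> carrier_mat p p" "B \<in> carrier_mat p p" "B * H = 1\<^sub>m p" "H * B = 1\<^sub>m p"
    "\<And>h. h \<in> carrier \<Gamma> \<Longrightarrow> mat p p (\<lambda>(a, b). cnj (\<rho> h $$ (b, a))) * (H * \<rho> h) = H"
proof -
  define F where "F g a b = (\<Sum>c<p. cnj (\<rho> g $$ (c, a)) * \<rho> g $$ (c, b))" for g a b
  define H where "H = mat p p (\<lambda>(a, b). \<Sum>g\<in>carrier \<Gamma>. F g a b)"
  have H: "H \<in> carrier_mat p p" by (simp add: H_def)
  have r: "\<rho> h \<in> carrier_mat p p" if "h \<in> carrier \<Gamma>" for h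
    using rep_carrier[OF mr that] by (simp add: p_def)
  have inv: "mat p p (\<lambda>(a, b). cnj (\<rho> h $$ (b, a))) * (H * \<rho> h) = H" (is "?A * _ = _")
    if h: "h \<in> carrier \<Gamma>" for h
  proof (rule eq_matI)
    fix a b assume "a < dim_row H" "b < dim_col H"
    then have a: "a < p" and b: "b < p" by (auto simp: H_def)
    have A: "?A \<in> carrier_mat p p" by simp
    have HR: "H * \<rho> h \<in> carrier_mat p p" using H r[OF h] by simp
    have F: "F (g \<otimes> h) a b = (\<Sum>e<p. \<Sum>f<p. cnj (\<rho> h $$ (e, a)) * F g e f * \<rho> h $$ (f, b))"
      if g: "g \<in> carrier \<Gamma>" for g
    proof -
      have "F (g \<otimes> h) a b = (\<Sum>c<p. (\<Sum>e<p. cnj (\<rho> g $$ (c, e)) * cnj (\<rho> h $$ (e, a))) *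
          (\<Sum>f<p. \<rho> g $$ (c, f) * \<rho> h $$ (f, b)))"
        using a b by (simp add: F_def rep_mult_entry[OF mr g h] p_def)
      also have "\<dots> = (\<Sum>c<p. \<Sum>e<p. \<Sum>f<p. cnj (\<rho> h $$ (e, a)) * (cnj (\<rho> g $$ (c, e)) * \<rho> g $$ (c, f)) * \<rho> h $$ (f, b))"
        by (simp only: sum_product, intro sum.cong refl) (simp add: mult_ac)
      also have "\<dots> = (\<Sum>e<p. \<Sum>c<p. \<Sum>f<p. cnj (\<rho> h $$ (e, a)) * (cnj (\<rho> g $$ (c, e)) * \<rho> g $$ (c, f)) * \<rho> h $$ (f, b))"
        by (rule sum.swap)
      also have "\<dots> = (\<Sum>e<p. \<Sum>f<p. \<Sum>c<p. cnj (\<rho> h $$ (e, a)) * (cnj (\<rho> g $$ (c, e)) * \<rho> g $$ (c, f)) * \<rho> h $$ (f, b))"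
        by (rule sum.cong[OF refl], rule sum.swap)
      also have "\<dots> = (\<Sum>e<p. \<Sum>f<p. cnj (\<rho> h $$ (e, a)) * F g e f * \<rho> h $$ (f, b))"
        by (simp add: F_def sum_distrib_left sum_distrib_right)
      finally show ?thesis .
    qed
    have "(?A * (H * \<rho> h)) $$ (a, b) = (\<Sum>e<p. cnj (\<rho> h $$ (e, a)) * (\<Sum>f<p. H $$ (e, f) * \<rho> h $$ (f, b)))"
      unfolding mat_mult_entry[OF A HR a b] using a b
      by (intro sum.cong refl) (simp add: mat_mult_entry[OF H r[OF h]] del: index_mult_mat(1))
    also have "\<dots> = (\<Sum>e<p. \<Sum>f<p. \<Sum>g\<in>carrier \<Gamma>. cnj (\<rho> h $$ (e, a)) * F g e f * \<rho> h $$ (f, b))"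
      by (simp add: H_def sum_distrib_left sum_distrib_right mult.assoc)
    also have "\<dots> = (\<Sum>e<p. \<Sum>g\<in>carrier \<Gamma>. \<Sum>f<p. cnj (\<rho> h $$ (e, a)) * F g e f * \<rho> h $$ (f, b))"
      by (rule sum.cong[OF refl], rule sum.swap)
    also have "\<dots> = (\<Sum>g\<in>carrier \<Gamma>. \<Sum>e<p. \<Sum>f<p. cnj (\<rho> h $$ (e, a)) * F g e f * \<rho> h $$ (f, b))"
      by (rule sum.swap)
    also have "\<dots> = (\<Sum>g\<in>carrier \<Gamma>. F (g \<otimes> h) a b)" by (simp add: F)
    also have "\<dots> = (\<Sum>g\<in>carrier \<Gamma>. F g a b)" by (rule sum_right_translate[OF h])
    also have "\<dots> = H $$ (a, b)" using a b by (simp add: H_def)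
    finally show "(?A * (H * \<rho> h)) $$ (a, b) = H $$ (a, b)" .
  qed (use H r[OF h] in auto)
  have "det H \<noteq> 0"
  proof
    assume "det H = 0"
    then obtain v where v: "v \<in> carrier_vec p" "v \<noteq> 0\<^sub>v p" "H *\<^sub>v v = 0\<^sub>v p"
      using det_0_iff_vec_prod_zero[OF H] by auto
    define w where "w g c = (\<Sum>a<p. \<rho> g $$ (c, a) * v $ a)" for g c
    have "0 = (\<Sum>a<p. cnj (v $ a) * (H *\<^sub>v v) $ a)" using v(3) by simp
    also have "\<dots> = (\<Sum>a<p. \<Sum>b<p. cnj (v $ a) * H $$ (a, b) * v $ b)"
      using H v(1) by (intro sum.cong refl)
        (auto simp: scalar_prod_def lessThan_atLeast0 sum_distrib_left mult.assoc intro!: sum.cong)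
    also have "\<dots> = (\<Sum>a<p. \<Sum>b<p. \<Sum>g\<in>carrier \<Gamma>. \<Sum>c<p. cnj (\<rho> g $$ (c, a) * v $ a) * (\<rho> g $$ (c, b) * v $ b))"
      by (simp add: H_def F_def sum_distrib_left sum_distrib_right mult_ac)
    also have "\<dots> = (\<Sum>a<p. \<Sum>g\<in>carrier \<Gamma>. \<Sum>b<p. \<Sum>c<p. cnj (\<rho> g $$ (c, a) * v $ a) * (\<rho> g $$ (c, b) * v $ b))"
      by (rule sum.cong[OF refl], rule sum.swap)
    also have "\<dots> = (\<Sum>g\<in>carrier \<Gamma>. \<Sum>a<p. \<Sum>b<p. \<Sum>c<p. cnj (\<rho> g $$ (c, a) * v $ a) * (\<rho> g $$ (c, b) * v $ b))"
      by (rule sum.swap)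
    also have "\<dots> = (\<Sum>g\<in>carrier \<Gamma>. \<Sum>a<p. \<Sum>c<p. \<Sum>b<p. cnj (\<rho> g $$ (c, a) * v $ a) * (\<rho> g $$ (c, b) * v $ b))"
      by (rule sum.cong[OF refl], rule sum.cong[OF refl], rule sum.swap)
    also have "\<dots> = (\<Sum>g\<in>carrier \<Gamma>. \<Sum>c<p. \<Sum>a<p. \<Sum>b<p. cnj (\<rho> g $$ (c, a) * v $ a) * (\<rho> g $$ (c, b) * v $ b))"
      by (rule sum.cong[OF refl], rule sum.swap)
    also have "\<dots> = (\<Sum>g\<in>carrier \<Gamma>. \<Sum>c<p. cnj (w g c) * w g c)"
      by (simp add: w_def sum_product)
    also have "\<dots> = of_real (\<Sum>g\<in>carrier \<Gamma>. \<Sum>c<p. (cmod (w g c))\<^sup>2)"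
      by (simp add: complex_norm_square mult.commute del: of_real_power)
    finally have "(\<Sum>g\<in>carrier \<Gamma>. \<Sum>c<p. (cmod (w g c))\<^sup>2) = 0"
      using of_real_eq_0_iff by metis
    then have "(\<Sum>c<p. (cmod (w \<one> c))\<^sup>2) = 0"
      using fin by (subst (asm) sum_nonneg_eq_0_iff) (auto intro: sum_nonneg)
    then have w: "\<forall>c<p. w \<one> c = 0"
      by (subst (asm) sum_nonneg_eq_0_iff) auto
    have "w \<one> c = v $ c" if "c < p" for c
    proof -
      have "w \<one> c = (\<Sum>a<p. if a = c then v $ a else 0)"
        unfolding w_def rep_one[OF mr] p_def[symmetric] using that by (intro sum.cong refl) auto
      then show ?thesis using that by simp
    qed
    then have "v = 0\<^sub>v p" using v(1) w by (intro eq_vecI) auto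
    with v(2) show False by simp
  qed
  from det_non_zero_imp_unit[OF H this, of "()"]
  obtain B where "B \<in> carrier_mat p p" "B * H = 1\<^sub>m p" "H * B = 1\<^sub>m p"
    unfolding Units_def ring_mat_def by auto
  from that[OF H this inv] show thesis by blast
qed

text \<open>
  The invariant form conjugates \<open>\<rho>(h\<^sup>-\<^sup>1)\<close> into the adjoint of \<open>\<rho>(h)\<close>. This passes from the bilinear
  orthogonality relations of Schur to the Hermitian ones in which multiplicities are defined.
\<close>
theorem rep_char_inv:
  assumes mr: "matrix_rep \<Gamma> \<rho>" and h: "h \<in> carrier \<Gamma>"
  shows "rep_char \<rho> (inv h) = cnj (rep_char \<rho> h)"
proof -
  define p where "p = rep_dim \<Gamma> \<rho>"
  define A where "A = mat p p (\<lambda>(a, b). cnj (\<rho> h $$ (b, a)))"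
  obtain H B where H: "H \<in> carrier_mat p p" and B: "B \<in> carrier_mat p p"
    and BH: "B * H = 1\<^sub>m p" and HB: "H * B = 1\<^sub>m p" and inv: "A * (H * \<rho> h) = H"
    using invariant_form[OF mr] h unfolding p_def A_def by metis
  have A: "A \<in> carrier_mat p p" by (simp add: A_def)
  have r: "\<rho> h \<in> carrier_mat p p" "\<rho> (inv h) \<in> carrier_mat p p"
    using rep_carrier[OF mr] h by (auto simp: p_def)
  have "A * H = A * (H * (\<rho> h * \<rho> (inv h)))"
    using rep_inv_mult(2)[OF mr h] H by (simp add: p_def)
  also have "\<dots> = A * (H * \<rho> h) * \<rho> (inv h)"
    using A H r by (simp add: assoc_mult_mat[of _ p p _ p _ p])
  finally have AH: "H * \<rho> (inv h) = A * H" by (simp add: inv)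
  have "\<rho> (inv h) = B * (H * \<rho> (inv h))"
    using BH B H r by (simp add: assoc_mult_mat[of _ p p _ p _ p, symmetric])
  also have "\<dots> = B * (A * H)" by (simp add: AH)
  finally have "mat_trace (\<rho> (inv h)) = mat_trace (B * (A * H))" by simp
  also have "\<dots> = mat_trace (A * H * B)"
    by (rule mat_trace_comm) (use A H B in auto)
  also have "A * H * B = A" using A H B HB by (simp add: assoc_mult_mat[of _ p p _ p _ p])
  also have "mat_trace A = cnj (mat_trace (\<rho> h))"
    using r by (auto simp: mat_trace_def A_def)
  finally show ?thesis by (simp add: rep_char_trace)
qed

lemma rep_char_one: "matrix_rep \<Gamma> \<rho> \<Longrightarrow> rep_char \<rho> \<one> = of_nat (rep_dim \<Gamma> \<rho>)"
  by (simp add: rep_char_def rep_one)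

lemma rep_char_conj:
  assumes mr: "matrix_rep \<Gamma> \<rho>" and g: "g \<in> carrier \<Gamma>" and h: "h \<in> carrier \<Gamma>"
  shows "rep_char \<rho> (g \<otimes> h \<otimes> inv g) = rep_char \<rho> h"
proof -
  note r = rep_carrier[OF mr]
  have "rep_char \<rho> (g \<otimes> h \<otimes> inv g) = mat_trace (\<rho> g * \<rho> h * \<rho> (inv g))"
    using g h by (simp add: rep_char_trace rep_mult[OF mr])
  also have "\<dots> = mat_trace (\<rho> (inv g) * (\<rho> g * \<rho> h))"
    by (rule mat_trace_comm[of _ "rep_dim \<Gamma> \<rho>" "rep_dim \<Gamma> \<rho>"]) (use r[OF g] r[OF h] r[OF inv_closed[OF g]] in auto)
  also have "\<rho> (inv g) * (\<rho> g * \<rho> h) = \<rho> (inv g \<otimes> (g \<otimes> h))"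
    using g h by (simp add: rep_mult[OF mr])
  also have "inv g \<otimes> (g \<otimes> h) = h" using g h by (simp add: m_assoc[symmetric])
  finally show ?thesis by (simp add: rep_char_trace)
qed

lemma complete_irrepsD:
  assumes "complete_irreps \<Gamma> n \<rho>" "i \<le> n"
  shows "irreducible_rep \<Gamma> (\<rho> i)" "matrix_rep \<Gamma> (\<rho> i)" "rep_dim \<Gamma> (\<rho> i) > 0"
  using assms by (auto simp: complete_irreps_def irreducible_rep_def)

theorem char_row_orthogonality:
  assumes ci: "complete_irreps \<Gamma> n \<rho>" and i: "i \<le> n" and j: "j \<le> n"
  shows "(\<Sum>g\<in>carrier \<Gamma>. rep_char (\<rho> i) g * cnj (rep_char (\<rho> j) g)) =
    (if i = j then of_nat (card (carrier \<Gamma>)) else 0)"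
proof -
  note I = complete_irrepsD[OF ci i] and J = complete_irrepsD[OF ci j]
  have "(\<Sum>g\<in>carrier \<Gamma>. rep_char (\<rho> i) g * cnj (rep_char (\<rho> j) g)) =
      (\<Sum>g\<in>carrier \<Gamma>. rep_char (\<rho> i) g * rep_char (\<rho> j) (inv g))"
    by (intro sum.cong refl) (simp add: rep_char_inv[OF J(2)])
  moreover have "i = j" if "rep_iso \<Gamma> (\<rho> j) (\<rho> i)"
    using that ci i j unfolding complete_irreps_def by blast
  ultimately show ?thesis
    using char_orthogonality_inv[OF I(1) J(1)] by auto
qed

section \<open>Completeness of characters\<close>

lemma conj_class_eq:
  "conj_classes \<Gamma> = {{g \<otimes> h \<otimes> inv g | g. g \<in> carrier \<Gamma>} | h. h \<in> carrier \<Gamma>}"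
  unfolding conj_classes_def orbits_def orbit_def by (rule Collect_cong) (auto; metis)

lemma sum_over_classes:
  fixes f :: "'g \<Rightarrow> complex" and n :: nat
  assumes C: "bij_betw C {0..n} (conj_classes \<Gamma>)" and g: "\<And>k. k \<le> n \<Longrightarrow> g k \<in> C k"
    and f: "\<And>x h. x \<in> carrier \<Gamma> \<Longrightarrow> h \<in> carrier \<Gamma> \<Longrightarrow> f (x \<otimes> h \<otimes> inv x) = f h"
  shows "(\<Sum>h\<in>carrier \<Gamma>. f h) = (\<Sum>k\<le>n. of_nat (card (C k)) * f (g k))"
proof -
  interpret A: group_action \<Gamma> "carrier \<Gamma>" "\<lambda>g. \<lambda>h\<in>carrier \<Gamma>. g \<otimes> h \<otimes> inv g"
    by (rule action_by_conjugation)
  have "(\<Sum>h\<in>carrier \<Gamma>. f h) = (\<Sum>X\<in>conj_classes \<Gamma>. \<Sum>h\<in>X. f h)"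
    unfolding conj_classes_def by (rule A.disjoint_sum[OF fin, symmetric])
  also have "\<dots> = (\<Sum>k\<in>{0..n}. \<Sum>h\<in>C k. f h)"
    by (rule sum.reindex_bij_betw[OF C, symmetric])
  also have "\<dots> = (\<Sum>k\<in>{0..n}. \<Sum>h\<in>C k. f (g k))"
  proof (intro sum.cong refl)
    fix k h assume k: "k \<in> {0..n}" and h: "h \<in> C k"
    have "C k \<in> conj_classes \<Gamma>" using bij_betwE[OF C] k by simp
    then obtain x where x: "x \<in> carrier \<Gamma>" "C k = {g \<otimes> x \<otimes> inv g | g. g \<in> carrier \<Gamma>}"
      unfolding conj_class_eq by blast
    then have "f y = f x" if "y \<in> C k" for y using that f by auto
    then show "f h = f (g k)" using h g k by auto
  qed
  finally show ?thesis by (simp add: atMost_atLeast0)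
qed

lemma class_rep_carrier:
  fixes n :: nat
  assumes C: "bij_betw C {0..n} (conj_classes \<Gamma>)" and g: "\<And>k. k \<le> n \<Longrightarrow> g k \<in> C k" and "k \<le> n"
  shows "g k \<in> carrier \<Gamma>" "C k \<subseteq> carrier \<Gamma>"
proof -
  have "C k \<in> conj_classes \<Gamma>" using bij_betwE[OF C] \<open>k \<le> n\<close> by simp
  then show "C k \<subseteq> carrier \<Gamma>" unfolding conj_class_eq by auto
  then show "g k \<in> carrier \<Gamma>" using g[OF \<open>k \<le> n\<close>] by blast
qed

lemma carrier_in_class:
  fixes n :: nat
  assumes C: "bij_betw C {0..n} (conj_classes \<Gamma>)" and g: "\<And>k. k \<le> n \<Longrightarrow> g k \<in> C k"
    and h: "h \<in> carrier \<Gamma>"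
  obtains k x where "k \<le> n" "x \<in> carrier \<Gamma>" "h = x \<otimes> g k \<otimes> inv x"
proof -
  interpret A: group_action \<Gamma> "carrier \<Gamma>" "\<lambda>g. \<lambda>h\<in>carrier \<Gamma>. g \<otimes> h \<otimes> inv g"
    by (rule action_by_conjugation)
  have "h \<in> \<Union> (conj_classes \<Gamma>)"
    unfolding conj_classes_def A.orbits_coverture using h .
  then obtain k where k: "k \<le> n" "h \<in> C k"
    using C unfolding bij_betw_def by (metis UnionE atLeastAtMost_iff imageE)
  have "C k \<in> conj_classes \<Gamma>" using bij_betwE[OF C] k by simp
  then obtain x where x: "x \<in> carrier \<Gamma>" "C k = {g \<otimes> x \<otimes> inv g | g. g \<in> carrier \<Gamma>}"
    unfolding conj_class_eq by blast
  obtain y z where y: "y \<in> carrier \<Gamma>" "h = y \<otimes> x \<otimes> inv y" and z: "z \<in> carrier \<Gamma>" "g k = z \<otimes> x \<otimes> inv z"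
    using k g[OF k(1)] x(2) by auto
  have "h = (y \<otimes> inv z) \<otimes> g k \<otimes> inv (y \<otimes> inv z)"
  proof -
    have c: "inv z \<otimes> (z \<otimes> u) = u" if "u \<in> carrier \<Gamma>" for u
      using that z m_assoc[of "inv z" z u] by simp
    have "(y \<otimes> inv z) \<otimes> g k \<otimes> inv (y \<otimes> inv z) = y \<otimes> (inv z \<otimes> z) \<otimes> x \<otimes> (inv z \<otimes> z) \<otimes> inv y"
      using x y z by (simp add: inv_mult_group m_assoc c)
    then show ?thesis using x y z by simp
  qed
  then show thesis using that[of k "y \<otimes> inv z"] k y z by simp
qed

text \<open>
  There are as many conjugacy classes as irreducible representations, so the character table,
  weighted by class sizes, is a square matrix. Row orthogonality gives it a right inverse; this is
  also a left inverse, which is column orthogonality.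
\<close>
theorem class_function_expansion:
  fixes f :: "'g \<Rightarrow> complex"
  assumes ci: "complete_irreps \<Gamma> n \<rho>"
    and C: "bij_betw C {0..n} (conj_classes \<Gamma>)" and g: "\<And>k. k \<le> n \<Longrightarrow> g k \<in> C k"
    and f: "\<And>x h. x \<in> carrier \<Gamma> \<Longrightarrow> h \<in> carrier \<Gamma> \<Longrightarrow> f (x \<otimes> h \<otimes> inv x) = f h"
    and y: "y \<in> carrier \<Gamma>"
  shows "(\<Sum>k\<le>n. (\<Sum>h\<in>carrier \<Gamma>. f h * cnj (rep_char (\<rho> k) h)) / of_nat (card (carrier \<Gamma>)) *
            rep_char (\<rho> k) y) = f y"
proof -
  define N :: complex where "N = of_nat (card (carrier \<Gamma>))"
  have N: "N \<noteq> 0" using card_pos by (simp add: N_def)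
  define x where "x i k = rep_char (\<rho> i) (g k)" for i k
  define X where "X = mat (Suc n) (Suc n) (\<lambda>(i, k). x i k)"
  define Y where "Y = mat (Suc n) (Suc n) (\<lambda>(k, j). of_nat (card (C k)) * cnj (x j k) / N)"
  have cls: "rep_char (\<rho> i) (a \<otimes> h \<otimes> inv a) = rep_char (\<rho> i) h"
    if "i \<le> n" "a \<in> carrier \<Gamma>" "h \<in> carrier \<Gamma>" for i a h
    using rep_char_conj[OF complete_irrepsD(2)[OF ci]] that by blast
  have X: "X \<in> carrier_mat (Suc n) (Suc n)" and Y: "Y \<in> carrier_mat (Suc n) (Suc n)"
    by (auto simp: X_def Y_def)
  have "X * Y = 1\<^sub>m (Suc n)"
  proof (rule eq_matI)
    fix i j assume "i < dim_row (1\<^sub>m (Suc n) :: complex mat)" "j < dim_col (1\<^sub>m (Suc n) :: complex mat)"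
    then have i: "i \<le> n" and j: "j \<le> n" by auto
    have "(X * Y) $$ (i, j) = (\<Sum>k\<le>n. of_nat (card (C k)) * (x i k * cnj (x j k))) / N"
      using i j unfolding mat_mult_entry[OF X Y le_imp_less_Suc[OF i] le_imp_less_Suc[OF j]]
      by (simp add: X_def Y_def lessThan_Suc_atMost sum_divide_distrib mult_ac)
    also have "\<dots> = (\<Sum>h\<in>carrier \<Gamma>. rep_char (\<rho> i) h * cnj (rep_char (\<rho> j) h)) / N"
      unfolding x_def using cls[OF i] cls[OF j]
      by (subst sum_over_classes[OF C g]) auto
    also have "\<dots> = 1\<^sub>m (Suc n) $$ (i, j)"
      using i j N by (simp add: char_row_orthogonality[OF ci i j] N_def)
    finally show "(X * Y) $$ (i, j) = 1\<^sub>m (Suc n) $$ (i, j)" .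
  qed (use X Y in auto)
  then have YX: "Y * X = 1\<^sub>m (Suc n)" by (rule mat_mult_left_right_inverse[OF X Y])
  have col: "(\<Sum>i\<le>n. of_nat (card (C k)) * cnj (x i k) / N * x i l) = (if k = l then 1 else 0)"
    if k: "k \<le> n" and l: "l \<le> n" for k l
  proof -
    have "(Y * X) $$ (k, l) = (\<Sum>i\<le>n. of_nat (card (C k)) * cnj (x i k) / N * x i l)"
      using k l unfolding mat_mult_entry[OF Y X le_imp_less_Suc[OF k] le_imp_less_Suc[OF l]]
      by (simp add: X_def Y_def lessThan_Suc_atMost)
    then show ?thesis using k l by (simp add: YX)
  qed
  obtain l a where l: "l \<le> n" and a: "a \<in> carrier \<Gamma>" and ya: "y = a \<otimes> g l \<otimes> inv a"
    by (rule carrier_in_class[OF C g y])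
  have gl: "g l \<in> carrier \<Gamma>" by (rule class_rep_carrier(1)[OF C g l])
  have "(\<Sum>i\<le>n. (\<Sum>h\<in>carrier \<Gamma>. f h * cnj (rep_char (\<rho> i) h)) / N * rep_char (\<rho> i) y)
      = (\<Sum>i\<le>n. (\<Sum>k\<le>n. of_nat (card (C k)) * (f (g k) * cnj (x i k))) / N * x i l)"
    unfolding x_def using cls a gl
    by (intro sum.cong refl) (subst sum_over_classes[OF C g], auto simp: ya f)
  also have "\<dots> = (\<Sum>i\<le>n. \<Sum>k\<le>n. f (g k) * (of_nat (card (C k)) * cnj (x i k) / N * x i l))"
    unfolding sum_distrib_right sum_divide_distrib by (intro sum.cong refl) simp
  also have "\<dots> = (\<Sum>k\<le>n. \<Sum>i\<le>n. f (g k) * (of_nat (card (C k)) * cnj (x i k) / N * x i l))"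
    by (rule sum.swap)
  also have "\<dots> = (\<Sum>k\<le>n. f (g k) * (if k = l then 1 else 0))"
    by (intro sum.cong refl) (simp only: sum_distrib_left[symmetric] col[OF _ l] atMost_iff)
  also have "\<dots> = f (g l)" using l by (simp add: if_distrib[of "\<lambda>x. _ * x"] cong: if_cong)
  also have "\<dots> = f y" using f[OF a gl] ya by simp
  finally show ?thesis by (simp add: N_def)
qed

end

section \<open>The special unitary group\<close>

lemma mat_adjoint_entry:
  assumes "A \<in> carrier_mat p q" "i < q" "j < p"
  shows "mat_adjoint A $$ (i, j) = conjugate (A $$ (j, i))"
  using assms by (simp add: mat_adjoint_def mat_of_rows_index)

text \<open>
  The adjoint of a unitary matrix of determinant \<open>1\<close> is its adjugate, so the second row is
  determined by the first one.
\<close>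
lemma SU2_iff:
  "A \<in> carrier SU2 \<longleftrightarrow> A \<in> carrier_mat 2 2 \<and> A $$ (1, 1) = cnj (A $$ (0, 0)) \<and>
     A $$ (1, 0) = - cnj (A $$ (0, 1)) \<and> A $$ (0, 0) * cnj (A $$ (0, 0)) + A $$ (0, 1) * cnj (A $$ (0, 1)) = 1"
  (is "_ \<longleftrightarrow> ?R")
proof (cases "A \<in> carrier_mat 2 2")
  case A: True
  define a b c d where "a = A $$ (0, 0)" and "b = A $$ (0, 1)" and "c = A $$ (1, 0)" and "d = A $$ (1, 1)"
  note abcd = this
  have A': "mat_adjoint A \<in> carrier_mat 2 2"
    using A mat_of_rows_carrier(1)[of 2 "map conjugate (cols A)"] by (auto simp: mat_adjoint_def)
  have ent: "(A * mat_adjoint A) $$ (i, j) = A $$ (i, 0) * cnj (A $$ (j, 0)) + A $$ (i, 1) * cnj (A $$ (j, 1))"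
    if "i < 2" "j < 2" for i j
    using mat_mult_entry[OF A A' that] that A by (simp add: numeral_2_eq_2 mat_adjoint_entry[OF A])
  have unit: "A * mat_adjoint A = 1\<^sub>m 2 \<longleftrightarrow>
      a * cnj a + b * cnj b = 1 \<and> a * cnj c + b * cnj d = 0 \<and> c * cnj a + d * cnj b = 0 \<and> c * cnj c + d * cnj d = 1"
    (is "?L \<longleftrightarrow> ?R")
  proof
    assume L: ?L
    then show ?R using ent[of 0 0] ent[of 0 1] ent[of 1 0] ent[of 1 1] by (simp add: abcd)
  next
    assume R: ?R
    show ?L
    proof (rule eq_matI)
      fix i j assume "i < dim_row (1\<^sub>m 2 :: complex mat)" "j < dim_col (1\<^sub>m 2 :: complex mat)"
      then have ij: "i < 2" "j < 2" by auto
      then have "(i = 0 \<or> i = 1) \<and> (j = 0 \<or> j = 1)" by auto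
      then show "(A * mat_adjoint A) $$ (i, j) = 1\<^sub>m 2 $$ (i, j)"
        using R unfolding ent[OF ij] by (auto simp: abcd)
    qed (use A A' in auto)
  qed
  have det: "det A = a * d - b * c" using A by (simp add: det_2 abcd)
  have "A * mat_adjoint A = 1\<^sub>m 2 \<and> det A = 1 \<longleftrightarrow>
      d = cnj a \<and> c = - cnj b \<and> a * cnj a + b * cnj b = 1"
    unfolding unit det
  proof (intro iffI conjI; elim conjE)
    assume 1: "a * cnj a + b * cnj b = 1" and 2: "c * cnj a + d * cnj b = 0" and 3: "a * d - b * c = 1"
    have "d = d * (a * cnj a + b * cnj b)" using 1 by simp
    also have "\<dots> = cnj a * (a * d - b * c) + b * (c * cnj a + d * cnj b)" by (simp add: algebra_simps)
    finally show "d = cnj a" using 2 3 by simp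
    have "c = c * (a * cnj a + b * cnj b)" using 1 by simp
    also have "\<dots> = - cnj b * (a * d - b * c) + a * (c * cnj a + d * cnj b)" by (simp add: algebra_simps)
    finally show "c = - cnj b" using 2 3 by simp
  qed (simp_all add: algebra_simps)
  then show ?thesis using A by (simp add: SU2_def abcd)
qed (simp add: SU2_def)

lemma SU2_mult: "x \<otimes>\<^bsub>SU2\<^esub> y = x * y" and SU2_one: "\<one>\<^bsub>SU2\<^esub> = 1\<^sub>m 2"
  by (simp_all add: SU2_def)

lemma mat2_mult_entry:
  fixes A B :: "'a::semiring_0 mat"
  assumes "A \<in> carrier_mat 2 2" "B \<in> carrier_mat 2 2" "i < 2" "j < 2"
  shows "(A * B) $$ (i, j) = A $$ (i, 0) * B $$ (0, j) + A $$ (i, 1) * B $$ (1, j)"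
  using mat_mult_entry[OF assms] by (simp add: numeral_2_eq_2)

lemma mat2_eqI:
  assumes "A \<in> carrier_mat 2 2" "B \<in> carrier_mat 2 2"
    "A $$ (0, 0) = B $$ (0, 0)" "A $$ (0, 1) = B $$ (0, 1)" "A $$ (1, 0) = B $$ (1, 0)" "A $$ (1, 1) = B $$ (1, 1)"
  shows "A = B"
  using assms by (intro eq_matI) (auto simp: numeral_2_eq_2 less_Suc_eq)

lemma group_SU2: "group SU2"
proof (rule groupI, unfold SU2_mult SU2_one)
  fix x y assume x: "x \<in> carrier SU2" and y: "y \<in> carrier SU2"
  have X: "x \<in> carrier_mat 2 2" "y \<in> carrier_mat 2 2" using x y by (auto simp: SU2_iff)
  note m = mat2_mult_entry[OF X]
  define a b c d where "a = x $$ (0, 0)" and "b = x $$ (0, 1)" and "c = y $$ (0, 0)" and "d = y $$ (0, 1)"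
  have 1: "a * cnj a + b * cnj b = 1" "c * cnj c + d * cnj d = 1"
    using x y by (auto simp: SU2_iff a_def b_def c_def d_def)
  have "(a * c + b * (- cnj d)) * cnj (a * c + b * (- cnj d)) + (a * d + b * cnj c) * cnj (a * d + b * cnj c) =
      (a * cnj a + b * cnj b) * (c * cnj c + d * cnj d)" by (simp add: algebra_simps)
  then have "(a * c + b * (- cnj d)) * cnj (a * c + b * (- cnj d)) + (a * d + b * cnj c) * cnj (a * d + b * cnj c) = 1"
    using 1 by simp
  then show "x * y \<in> carrier SU2"
    using x y X by (simp add: SU2_iff m a_def b_def c_def d_def algebra_simps del: index_mult_mat(1))
next
  show "1\<^sub>m 2 \<in> carrier SU2" by (simp add: SU2_iff)
next
  fix x assume x: "x \<in> carrier SU2"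
  define y where "y = mat 2 2 (\<lambda>(i, j). cnj (x $$ (j, i)))"
  have y: "y \<in> carrier SU2" using x by (auto simp: SU2_iff y_def mult.commute)
  have "y * x = 1\<^sub>m 2"
    using x y by (intro mat2_eqI) (auto simp: SU2_iff mat2_mult_entry y_def algebra_simps)
  then show "\<exists>y\<in>carrier SU2. y * x = 1\<^sub>m 2" using y by blast
qed (auto simp: SU2_iff assoc_mult_mat[of _ 2 2 _ 2 _ 2])

text \<open>
  \<open>det(E - A)\<close> is the characteristic polynomial \<open>1 - tr(A) t + t\<^sup>2\<close> at \<open>t = 1\<close>. It vanishes only at
  the identity, because a real part \<open>1\<close> of the first entry exhausts the unit length of the first row.
\<close>
lemma SU2_trace:
  assumes "A \<in> carrier SU2"
  shows "A \<in> carrier_mat 2 2" "det A = 1" "cnj (mat_trace A) = mat_trace A"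
    "det (1\<^sub>m 2 - A) = 2 - mat_trace A"
    "det (1\<^sub>m 2 - A) = 0 \<longleftrightarrow> A = 1\<^sub>m 2"
proof -
  show A: "A \<in> carrier_mat 2 2" using assms by (simp add: SU2_iff)
  define a b where "a = A $$ (0, 0)" and "b = A $$ (0, 1)"
  have e: "A $$ (0, 0) = a" "A $$ (0, 1) = b" "A $$ (1, 0) = - cnj b" "A $$ (1, 1) = cnj a"
    and n: "a * cnj a + b * cnj b = 1"
    using assms by (auto simp: SU2_iff a_def b_def)
  have tr: "mat_trace A = a + cnj a" using A e by (simp add: mat_trace_def numeral_2_eq_2)
  show "cnj (mat_trace A) = mat_trace A" by (simp add: tr)
  show "det A = 1" using assms by (simp add: SU2_def)
  have M: "1\<^sub>m 2 - A \<in> carrier_mat 2 2" using A by (rule minus_carrier_mat)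
  have "det (1\<^sub>m 2 - A) = (1 - a) * (1 - cnj a) - (- b) * cnj b"
    using M A e by (simp add: det_2)
  also have "\<dots> = 1 - a - cnj a + (a * cnj a + b * cnj b)" by (simp add: algebra_simps)
  finally show D: "det (1\<^sub>m 2 - A) = 2 - mat_trace A" by (simp add: tr n)
  show "det (1\<^sub>m 2 - A) = 0 \<longleftrightarrow> A = 1\<^sub>m 2"
  proof
    assume "det (1\<^sub>m 2 - A) = 0"
    then have "(1 - a) * cnj (1 - a) + b * cnj b = 0" using D n by (simp add: tr algebra_simps)
    then have "of_real ((cmod (1 - a))\<^sup>2 + (cmod b)\<^sup>2) = (0::complex)"
      by (simp only: of_real_add complex_norm_square)
    then have "(cmod (1 - a))\<^sup>2 + (cmod b)\<^sup>2 = 0" by (simp only: of_real_eq_0_iff)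
    then have "a = 1" "b = 0" by (auto simp: add_nonneg_eq_0_iff)
    then show "A = 1\<^sub>m 2" using A e by (intro mat2_eqI) auto
  next
    assume "A = 1\<^sub>m 2"
    then show "det (1\<^sub>m 2 - A) = 0" unfolding D by (simp add: mat_trace_def)
  qed
qed

section \<open>Substitution and group action in the symmetric algebra\<close>

lemma scalar_hom: "comm_ring_hom scalar"
  by unfold_locales (auto simp: scalar_def one_pCons)

lemma sym_subst_eval:
  "sym_subst p u v = poly (map_poly (\<lambda>q. poly (map_poly scalar q) u) p) v"
proof -
  interpret scalar: comm_ring_hom scalar by (rule scalar_hom)
  interpret map_scalar: map_poly_comm_ring_hom scalar ..
  have "sym_subst p u v =
      (\<Sum>b\<le>degree p. v ^ b * (\<Sum>a\<le>degree (coeff p b). u ^ a * scalar (coeff (coeff p b) a)))"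
    unfolding sym_subst_def by (simp add: sum_distrib_left mult_ac)
  also have "\<dots> = eval_poly (\<lambda>q. eval_poly scalar q u) p v"
    by (subst (1 2) eval_poly_as_sum) (simp_all add: eval_poly_def)
  finally show ?thesis by (simp add: eval_poly_def)
qed

lemma sym_subst_hom: "comm_ring_hom (\<lambda>p. sym_subst p u v)"
proof -
  interpret scalar: comm_ring_hom scalar by (rule scalar_hom)
  interpret map_scalar: map_poly_comm_ring_hom scalar ..
  interpret h: comm_ring_hom "\<lambda>q. poly (map_poly scalar q) u"
    by unfold_locales (simp_all add: hom_distribs)
  interpret map_h: map_poly_comm_ring_hom "\<lambda>q. poly (map_poly scalar q) u" ..
  show ?thesis
    unfolding sym_subst_eval by unfold_locales (simp_all add: hom_distribs)
qed

interpretation sym_subst: comm_ring_hom "\<lambda>p. sym_subst p u v" for u v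
  by (rule sym_subst_hom)

lemma sym_subst_scalar [simp]: "sym_subst (scalar c) u v = scalar c"
  by (simp add: sym_subst_def scalar_def)

lemma sym_subst_monom: "sym_subst (sym_monom a b) u v = u ^ a * v ^ b"
proof -
  interpret scalar: comm_ring_hom scalar by (rule scalar_hom)
  interpret map_scalar: map_poly_comm_ring_hom scalar ..
  show ?thesis
    unfolding sym_subst_eval sym_monom_def
    by (simp add: poly_monom map_poly_monom)
qed

interpretation sym_act: comm_ring_hom "sym_act g" for g
  unfolding sym_act_def[abs_def] by (rule sym_subst_hom)

lemma sym_act_scalar [simp]: "sym_act g (scalar c) = scalar c"
  by (simp add: sym_act_def)

lemma hom_sym_subst:
  assumes "comm_ring_hom \<phi>" and s: "\<And>c. \<phi> (scalar c) = scalar c"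
  shows "\<phi> (sym_subst p u v) = sym_subst p (\<phi> u) (\<phi> v)"
proof -
  interpret \<phi>: comm_ring_hom \<phi> by fact
  show ?thesis unfolding sym_subst_def by (simp add: hom_distribs s)
qed

definition sym_coeff :: "sym_alg \<Rightarrow> nat \<Rightarrow> nat \<Rightarrow> complex" where
  "sym_coeff p a b = coeff (coeff p b) a"

lemma sym_alg_eqI: "(\<And>a b. sym_coeff p a b = sym_coeff q a b) \<Longrightarrow> p = q"
  by (simp add: sym_coeff_def poly_eq_iff)

lemma sym_coeff_simps [simp]:
  "sym_coeff 0 a b = 0" "sym_coeff (p + q) a b = sym_coeff p a b + sym_coeff q a b"
  "sym_coeff (scalar c * p) a b = c * sym_coeff p a b"
  by (simp_all add: sym_coeff_def scalar_def)

lemma sym_coeff_sum [simp]: "sym_coeff (\<Sum>x\<in>A. f x) a b = (\<Sum>x\<in>A. sym_coeff (f x) a b)"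
  by (simp add: sym_coeff_def coeff_sum)

lemma sym_coeff_monom: "sym_coeff (sym_monom i j) a b = (if a = i \<and> b = j then 1 else 0)"
  by (auto simp: sym_coeff_def sym_monom_def)

lemma sym_homogeneous_coeff:
  "sym_homogeneous m p \<longleftrightarrow> (\<forall>a b. sym_coeff p a b \<noteq> 0 \<longrightarrow> a + b = m)"
  by (simp add: sym_homogeneous_def sym_coeff_def)

lemma sym_coeff_mult:
  "sym_coeff (p * q) a b = (\<Sum>j\<le>b. \<Sum>i\<le>a. sym_coeff p i j * sym_coeff q (a - i) (b - j))"
  by (simp add: sym_coeff_def coeff_mult coeff_sum)

lemma sym_homogeneous_mult:
  assumes "sym_homogeneous m p" "sym_homogeneous n q"
  shows "sym_homogeneous (m + n) (p * q)"
  unfolding sym_homogeneous_coeff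
proof (intro allI impI)
  fix a b assume "sym_coeff (p * q) a b \<noteq> 0"
  then obtain j where j: "j \<le> b" "(\<Sum>i\<le>a. sym_coeff p i j * sym_coeff q (a - i) (b - j)) \<noteq> 0"
    unfolding sym_coeff_mult by (meson atMost_iff sum.not_neutral_contains_not_neutral)
  then obtain i where "i \<le> a" "sym_coeff p i j * sym_coeff q (a - i) (b - j) \<noteq> 0"
    by (meson atMost_iff sum.not_neutral_contains_not_neutral)
  then have "i + j = m" "a - i + (b - j) = n"
    using assms by (auto simp: sym_homogeneous_coeff)
  then show "a + b = m + n" using j \<open>i \<le> a\<close> by simp
qed

lemma sym_homogeneous_one: "sym_homogeneous 0 1"
  by (auto simp: sym_homogeneous_def one_pCons coeff_pCons split: nat.splits)

lemma sym_homogeneous_power: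
  assumes "sym_homogeneous m p" shows "sym_homogeneous (k * m) (p ^ k)"
  by (induction k) (auto simp: sym_homogeneous_one intro: sym_homogeneous_mult assms)

lemma sym_homogeneous_lin: "sym_homogeneous 1 (sym_lin g j)"
  by (auto simp: sym_homogeneous_def sym_lin_def coeff_pCons split: nat.splits)

lemma sym_homogeneous_scalar_mult: "sym_homogeneous m p \<Longrightarrow> sym_homogeneous m (scalar c * p)"
  by (auto simp: sym_homogeneous_coeff)

lemma sym_homogeneous_sum:
  "(\<And>x. x \<in> A \<Longrightarrow> sym_homogeneous m (f x)) \<Longrightarrow> sym_homogeneous m (\<Sum>x\<in>A. f x)"
  unfolding sym_homogeneous_coeff sym_coeff_sum
  by (meson sum.not_neutral_contains_not_neutral)

lemma sym_act_monom: "sym_act g (sym_monom a b) = sym_lin g 0 ^ a * sym_lin g 1 ^ b"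
  by (simp add: sym_act_def sym_subst_monom)

lemma sym_homogeneous_act_monom: "sym_homogeneous (a + b) (sym_act g (sym_monom a b))"
  unfolding sym_act_monom
  using sym_homogeneous_mult[OF sym_homogeneous_power[OF sym_homogeneous_lin] sym_homogeneous_power[OF sym_homogeneous_lin]]
  by simp

lemma sym_homogeneous_expand:
  assumes "sym_homogeneous m p"
  shows "p = (\<Sum>i\<le>m. scalar (sym_coeff p (m - i) i) * sym_monom (m - i) i)"
proof (rule sym_alg_eqI)
  fix a b
  show "sym_coeff p a b = sym_coeff (\<Sum>i\<le>m. scalar (sym_coeff p (m - i) i) * sym_monom (m - i) i) a b"
  proof (cases "a + b = m")
    case True
    have "(\<Sum>i\<le>m. sym_coeff p (m - i) i * (if a = m - i \<and> b = i then 1 else 0)) =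
        (\<Sum>i\<le>m. if i = b then sym_coeff p a b else 0)"
      using True by (intro sum.cong refl) auto
    then show ?thesis using True by (simp add: sym_coeff_monom)
  next
    case False
    then have "sym_coeff p a b = 0" using assms by (auto simp: sym_homogeneous_coeff)
    moreover have "(\<Sum>i\<le>m. sym_coeff p (m - i) i * (if a = m - i \<and> b = i then 1 else 0)) = 0"
      using False by (intro sum.neutral) auto
    ultimately show ?thesis by (simp add: sym_coeff_monom)
  qed
qed

lemma sym_power_carrier [simp]: "sym_power m g \<in> carrier_mat (Suc m) (Suc m)"
  by (simp add: sym_power_def)

lemma sym_power_entry:
  "i \<le> m \<Longrightarrow> j \<le> m \<Longrightarrow>
    sym_power m g $$ (i, j) = sym_coeff (sym_act g (sym_monom (m - j) j)) (m - i) i"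
  by (simp add: sym_power_def sym_coeff_def)

lemma sym_act_coeff:
  assumes "sym_homogeneous m p" "k \<le> m"
  shows "sym_coeff (sym_act g p) (m - k) k = (\<Sum>i\<le>m. sym_power m g $$ (k, i) * sym_coeff p (m - i) i)"
  by (subst sym_homogeneous_expand[OF assms(1)])
     (simp add: hom_distribs sym_power_entry assms(2) mult.commute)

text \<open>
  Both sides are ring homomorphisms in \<open>p\<close> that fix the scalars, so it suffices to compare them on
  the two generators.
\<close>
lemma sym_act_act:
  assumes "g \<in> carrier_mat 2 2" "h \<in> carrier_mat 2 2"
  shows "sym_act g (sym_act h p) = sym_act (g * h) p"
proof -
  have lin: "sym_act g (sym_lin h j) = sym_lin (g * h) j" if "j < 2" for j
  proof -
    have e: "sym_lin A i = scalar (A $$ (0, i)) * sym_monom 1 0 + scalar (A $$ (1, i)) * sym_monom 0 1" for A i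
      by (simp add: sym_lin_def scalar_def sym_monom_def monom_altdef)
    have m: "(g * h) $$ (i, j) = g $$ (i, 0) * h $$ (0, j) + g $$ (i, 1) * h $$ (1, j)" if "i < 2" for i
      using mat_mult_entry[OF assms that \<open>j < 2\<close>] by (simp add: numeral_2_eq_2)
    have s: "scalar (x * y) = scalar x * scalar y" "scalar (x + y) = scalar x + scalar y" for x y
      by (simp_all add: scalar_def)
    show ?thesis
      by (simp add: e[of h] hom_distribs sym_act_monom) (simp add: e m s algebra_simps)
  qed
  have "sym_act g (sym_act h p) = sym_subst p (sym_act g (sym_lin h 0)) (sym_act g (sym_lin h 1))"
    unfolding sym_act_def[of h] by (rule hom_sym_subst) (auto intro: sym_act.comm_ring_hom_axioms)
  also have "\<dots> = sym_act (g * h) p" by (simp add: lin sym_act_def[of "g * h"])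
  finally show ?thesis .
qed

lemma sym_power_mult:
  assumes "g \<in> carrier_mat 2 2" "h \<in> carrier_mat 2 2"
  shows "sym_power m (g * h) = sym_power m g * sym_power m h"
proof (rule eq_matI)
  fix i j assume "i < dim_row (sym_power m g * sym_power m h)" "j < dim_col (sym_power m g * sym_power m h)"
  then have i: "i \<le> m" and j: "j \<le> m" by (auto simp: sym_power_def)
  have hm: "sym_homogeneous m (sym_act h (sym_monom (m - j) j))"
    using sym_homogeneous_act_monom[of "m - j" j h] j by simp
  have "sym_power m (g * h) $$ (i, j) = sym_coeff (sym_act g (sym_act h (sym_monom (m - j) j))) (m - i) i"
    using i j by (simp add: sym_power_entry sym_act_act[OF assms])
  also have "\<dots> = (\<Sum>k\<le>m. sym_power m g $$ (i, k) * sym_power m h $$ (k, j))"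
    using j by (simp add: sym_act_coeff[OF hm i] sym_power_entry)
  also have "\<dots> = (sym_power m g * sym_power m h) $$ (i, j)"
    using mat_mult_entry[OF sym_power_carrier[of m g] sym_power_carrier[of m h] le_imp_less_Suc[OF i] le_imp_less_Suc[OF j]]
    by (simp add: lessThan_Suc_atMost)
  finally show "sym_power m (g * h) $$ (i, j) = (sym_power m g * sym_power m h) $$ (i, j)" .
qed (auto simp: sym_power_def)

section \<open>Molien's formula\<close>

lemma coeff_linear_power_top:
  fixes a b :: "'a::comm_semiring_1"
  shows "coeff ([:a, b:] ^ k) k = b ^ k"
proof -
  have "(\<forall>i>k. coeff ([:a, b:] ^ k) i = 0) \<and> coeff ([:a, b:] ^ k) k = b ^ k"
  proof (induction k)
    case (Suc k)
    have "coeff ([:a, b:] ^ Suc k) (Suc i) = a * coeff ([:a, b:] ^ k) (Suc i) + b * coeff ([:a, b:] ^ k) i" for i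
      by simp
    then show ?case using Suc by (auto simp: gr0_conv_Suc Suc_less_eq2)
  qed (auto simp: one_pCons coeff_pCons split: nat.splits)
  then show ?thesis by blast
qed

text \<open>
  For \<open>T e\<^sub>0 = x e\<^sub>0\<close> and \<open>T e\<^sub>1 = b e\<^sub>0 + y e\<^sub>1\<close> the monomial with exponents \<open>m - j\<close> and \<open>j\<close> goes to
  \<open>(x e\<^sub>0)\<^sup>m\<^sup>-\<^sup>j (b e\<^sub>0 + y e\<^sub>1)\<^sup>j\<close>, whose part of top degree in \<open>e\<^sub>1\<close> is the diagonal entry.
\<close>
lemma sym_power_triangular_diag:
  assumes "T $$ (1, 0) = 0" and j: "j \<le> m"
  shows "sym_power m T $$ (j, j) = (T $$ (0, 0)) ^ (m - j) * (T $$ (1, 1)) ^ j"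
proof -
  have c: "[:p:] ^ k = [:p ^ k:]" for p :: "complex poly" and k by (induction k) (auto simp: one_pCons)
  have c': "[:x:] ^ k = [:x ^ k:]" for x :: complex and k by (induction k) (auto simp: one_pCons)
  have "sym_act T (sym_monom (m - j) j) =
      [:[:0, T $$ (0, 0):] ^ (m - j):] * [:[:0, T $$ (0, 1):], [:T $$ (1, 1):]:] ^ j"
    using assms(1) by (simp add: sym_act_monom sym_lin_def c)
  then have "coeff (sym_act T (sym_monom (m - j) j)) j = [:0, T $$ (0, 0):] ^ (m - j) * [:T $$ (1, 1):] ^ j"
    by (simp add: coeff_linear_power_top)
  also have "\<dots> = Polynomial.smult (T $$ (1, 1) ^ j) ([:0, T $$ (0, 0):] ^ (m - j))"
    by (simp add: c')
  finally show ?thesis using j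
    by (simp add: sym_power_entry sym_coeff_def coeff_linear_power_top mult.commute)
qed

lemma geometric_fps:
  "Abs_fps (\<lambda>n. (c::'a::field) ^ n) * fps_of_poly [:1, -c:] = 1"
proof (rule fps_ext)
  fix n
  have "Abs_fps (\<lambda>n. c ^ n) * fps_of_poly [:1, -c:] =
      Abs_fps (\<lambda>n. c ^ n) - fps_const c * (Abs_fps (\<lambda>n. c ^ n) * fps_X)"
    by (simp add: fps_of_poly_pCons algebra_simps fps_const_neg[symmetric] del: fps_const_neg)
  then show "fps_nth (Abs_fps (\<lambda>n. c ^ n) * fps_of_poly [:1, -c:]) n = fps_nth 1 n"
    by (cases n) simp_all
qed

text \<open>
  Every matrix is similar to a triangular one, and \<open>sym_power\<close> is multiplicative, so the trace is a
  complete homogeneous polynomial in the two eigenvalues; these have the generating function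
  \<open>1 / ((1 - x q) (1 - y q))\<close>.
\<close>
theorem molien_series:
  assumes g: "g \<in> carrier_mat 2 2"
  shows "Abs_fps (\<lambda>m. mat_trace (sym_power m g)) * fps_of_poly [:1, - mat_trace g, det g:] = 1"
proof -
  obtain es where "char_poly g = (\<Prod>a\<leftarrow>es. [:- a, 1:])"
    using char_poly_factorized[OF g] by blast
  then obtain T where T: "T \<in> carrier_mat 2 2" and ut: "upper_triangular T" and sim: "similar_mat g T"
    using schur_decomposition_exists[OF g] by blast
  then obtain P Q where w: "similar_mat_wit g T P Q" by (auto simp: similar_mat_def)
  note w = similar_mat_witD2[OF g w]
  define x y where "x = T $$ (0, 0)" and "y = T $$ (1, 1)"
  have T10: "T $$ (1, 0) = 0" using ut T by (auto simp: upper_triangular_def)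
  have det: "det g = x * y"
    unfolding det_similar[OF sim] det_2[OF T] T10 x_def y_def by simp
  have QPT: "Q * (P * T) = T"
    using assoc_mult_mat[OF w(7,6) T] left_mult_one_mat[OF T] unfolding w(2) by metis
  have "mat_trace g = mat_trace (Q * (P * T))"
    unfolding w(3) by (rule mat_trace_comm) (use w in auto)
  also note QPT
  finally have tr: "mat_trace g = x + y"
    using T by (simp add: mat_trace_def x_def y_def numeral_2_eq_2)
  have trS: "mat_trace (sym_power m g) = (\<Sum>j\<le>m. x ^ (m - j) * y ^ j)" for m
  proof -
    note C = sym_power_carrier[of m P] sym_power_carrier[of m Q] sym_power_carrier[of m T]
    have e: "sym_power m g = sym_power m P * sym_power m T * sym_power m Q"
      unfolding w(3) using w(4-7) by (simp add: sym_power_mult assoc_mult_mat[OF C(1) C(3) C(2)])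
    have "mat_trace (sym_power m g) = mat_trace (sym_power m Q * (sym_power m P * sym_power m T))"
      unfolding e by (rule mat_trace_comm[of _ "Suc m" "Suc m"]) (rule mult_carrier_mat[OF C(1) C(3)], rule C(2))
    also have "sym_power m Q * (sym_power m P * sym_power m T) = sym_power m (Q * (P * T))"
      using w(4-7) by (simp add: sym_power_mult)
    also note QPT
    also have "mat_trace (sym_power m T) = (\<Sum>j\<le>m. x ^ (m - j) * y ^ j)"
      unfolding mat_trace_def carrier_matD(1)[OF C(3)] lessThan_Suc_atMost x_def y_def
      by (intro sum.cong refl sym_power_triangular_diag[OF T10]) simp
    finally show ?thesis .
  qed
  have "Abs_fps (\<lambda>m. mat_trace (sym_power m g)) = Abs_fps (\<lambda>n. y ^ n) * Abs_fps (\<lambda>n. x ^ n)"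
    by (rule fps_ext) (auto simp: trS fps_mult_nth atLeast0AtMost intro!: sum.cong)
  moreover have "fps_of_poly [:1, - mat_trace g, det g:] = fps_of_poly [:1, -y:] * fps_of_poly [:1, -x:]"
    unfolding fps_of_poly_mult[symmetric] tr det by (simp add: algebra_simps)
  ultimately have "Abs_fps (\<lambda>m. mat_trace (sym_power m g)) * fps_of_poly [:1, - mat_trace g, det g:] =
      (Abs_fps (\<lambda>n. y ^ n) * fps_of_poly [:1, -y:]) * (Abs_fps (\<lambda>n. x ^ n) * fps_of_poly [:1, -x:])"
    by (simp add: mult_ac)
  then show ?thesis by (simp add: geometric_fps)
qed

section \<open>The dimension of the covariants of a given degree\<close>

text \<open>
  The rank of a projection is its trace. If \<open>b\<close> is a basis of the image of \<open>p\<close> and the columns of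
  \<open>p\<close> have the coordinates \<open>K\<close>, then \<open>p = b K\<close> and, by uniqueness of coordinates, \<open>K b = 1\<close>; the
  claim is \<open>tr (b K) = tr (K b)\<close>.
\<close>
theorem trace_eq_card_basis:
  fixes p :: "'i \<Rightarrow> 'i \<Rightarrow> complex" and b :: "'s \<Rightarrow> 'i \<Rightarrow> complex"
  assumes fin: "finite I" "finite S"
    and fixed: "\<And>s i. s \<in> S \<Longrightarrow> i \<in> I \<Longrightarrow> (\<Sum>i'\<in>I. p i i' * b s i') = b s i"
    and span: "\<And>i'. i' \<in> I \<Longrightarrow> \<exists>c. \<forall>i\<in>I. p i i' = (\<Sum>s\<in>S. c s * b s i)"
    and indep: "\<And>c s. (\<And>i. i \<in> I \<Longrightarrow> (\<Sum>s\<in>S. c s * b s i) = 0) \<Longrightarrow> s \<in> S \<Longrightarrow> c s = 0"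
  shows "(\<Sum>i\<in>I. p i i) = of_nat (card S)"
proof -
  obtain K where K: "\<And>i i'. i' \<in> I \<Longrightarrow> i \<in> I \<Longrightarrow> p i i' = (\<Sum>s\<in>S. K i' s * b s i)"
    using span by metis
  have one: "(\<Sum>i\<in>I. K i s * b s i) = 1" if s: "s \<in> S" for s
  proof -
    define c where "c t = (\<Sum>i'\<in>I. K i' t * b s i') - (if t = s then 1 else 0)" for t
    have "(\<Sum>t\<in>S. c t * b t i) = 0" if i: "i \<in> I" for i
    proof -
      have "(\<Sum>t\<in>S. (\<Sum>i'\<in>I. K i' t * b s i') * b t i) = (\<Sum>t\<in>S. \<Sum>i'\<in>I. K i' t * b t i * b s i')"
        by (simp add: sum_distrib_right sum_distrib_left mult_ac)
      also have "\<dots> = (\<Sum>i'\<in>I. (\<Sum>t\<in>S. K i' t * b t i) * b s i')"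
        by (subst sum.swap) (simp add: sum_distrib_right)
      also have "\<dots> = b s i" using i s by (simp add: K[symmetric] fixed)
      finally show ?thesis
        using s fin by (simp add: c_def left_diff_distrib sum_subtractf if_distrib[of "\<lambda>x. x * _"] cong: if_cong)
    qed
    then have "c s = 0" using indep s by blast
    then show ?thesis by (simp add: c_def)
  qed
  have "(\<Sum>i\<in>I. p i i) = (\<Sum>i\<in>I. \<Sum>s\<in>S. K i s * b s i)" by (simp add: K)
  also have "\<dots> = (\<Sum>s\<in>S. \<Sum>i\<in>I. K i s * b s i)" by (rule sum.swap)
  also have "\<dots> = of_nat (card S)" by (simp add: one)
  finally show ?thesis .
qed

lemma sym_coeff_bound: "\<exists>D. \<forall>a b. sym_coeff p a b \<noteq> 0 \<longrightarrow> a \<le> D \<and> b \<le> D"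
proof (intro exI allI impI)
  fix a b assume nz: "sym_coeff p a b \<noteq> 0"
  then have b: "b \<le> degree p" and a: "a \<le> degree (coeff p b)"
    by (auto simp: sym_coeff_def intro: le_degree)
  have "degree (coeff p b) \<le> (\<Sum>j\<le>degree p. degree (coeff p j))"
    using b by (intro member_le_sum) auto
  then show "a \<le> degree p + (\<Sum>j\<le>degree p. degree (coeff p j)) \<and> b \<le> degree p + (\<Sum>j\<le>degree p. degree (coeff p j))"
    using a b by simp
qed

lemma sym_subst_bounded:
  assumes "\<And>a b. sym_coeff p a b \<noteq> 0 \<Longrightarrow> a \<le> D \<and> b \<le> D"
  shows "sym_subst p u v = (\<Sum>(a, b)\<in>{..D} \<times> {..D}. scalar (sym_coeff p a b) * (u ^ a * v ^ b))"
proof -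
  have "p = (\<Sum>(i, j)\<in>{..D} \<times> {..D}. scalar (sym_coeff p i j) * sym_monom i j)"
  proof (rule sym_alg_eqI)
    fix a b
    have "(\<Sum>x\<in>{..D} \<times> {..D}. sym_coeff (case x of (i, j) \<Rightarrow> scalar (sym_coeff p i j) * sym_monom i j) a b) =
        (\<Sum>x\<in>{..D} \<times> {..D}. if x = (a, b) then sym_coeff p a b else 0)"
      by (intro sum.cong refl) (auto simp: sym_coeff_monom split: if_splits)
    also have "\<dots> = sym_coeff p a b" using assms[of a b] by auto
    finally show "sym_coeff p a b = sym_coeff (\<Sum>(i, j)\<in>{..D} \<times> {..D}. scalar (sym_coeff p i j) * sym_monom i j) a b"
      by simp
  qed
  then have "sym_subst p u v = sym_subst (\<Sum>(i, j)\<in>{..D} \<times> {..D}. scalar (sym_coeff p i j) * sym_monom i j) u v"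
    by simp
  also have "\<dots> = (\<Sum>(a, b)\<in>{..D} \<times> {..D}. scalar (sym_coeff p a b) * (u ^ a * v ^ b))"
    unfolding sym_subst.hom_sum by (intro sum.cong refl) (auto simp: sym_subst.hom_mult sym_subst_monom)
  finally show ?thesis .
qed

text \<open>
  The triples \<open>(k, a, b)\<close> index the covariants \<open>\<theta>1\<^sup>a \<theta>2\<^sup>b B\<^sub>k\<close> of degree \<open>m\<close>, where \<open>e k\<close> is the degree
  of \<open>B\<^sub>k\<close>.
\<close>
definition basis_indices :: "nat \<Rightarrow> nat \<Rightarrow> nat \<Rightarrow> (nat \<Rightarrow> nat) \<Rightarrow> nat \<Rightarrow> (nat \<times> nat \<times> nat) set" where
  "basis_indices n1 n2 \<mu> e m = {(k, a, b). k \<in> {1..\<mu>} \<and> a * n1 + b * n2 + e k = m}"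

lemma basis_indices_subset:
  assumes "n1 > 0" "n2 > 0" "D \<ge> m"
  shows "basis_indices n1 n2 \<mu> e m \<subseteq> {1..\<mu>} \<times> {..D} \<times> {..D}"
proof -
  have "a \<le> D \<and> b \<le> D" if "a * n1 + b * n2 + c = m" for a b c
  proof -
    have "a \<le> a * n1" "b \<le> b * n2" using assms by auto
    then show ?thesis using that assms(3) by linarith
  qed
  then show ?thesis by (force simp: basis_indices_def)
qed

locale finite_matrix_group = fin_group \<Gamma> for \<Gamma> :: "complex mat monoid" (structure) +
  assumes mult_eq: "x \<otimes> y = x * y" and one_eq: "\<one> = 1\<^sub>m 2" and carrier_sub: "carrier \<Gamma> \<subseteq> carrier_mat 2 2"
begin

lemma covariants_act:
  "b \<in> covariants \<Gamma> \<rho> \<Longrightarrow> g \<in> carrier \<Gamma> \<Longrightarrow> a < rep_dim \<Gamma> \<rho> \<Longrightarrow>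
    sym_act g (b $ a) = (\<Sum>c<rep_dim \<Gamma> \<rho>. scalar (\<rho> g $$ (c, a)) * b $ c)"
  by (simp add: covariants_def)

lemma covariants_mult_invariant:
  assumes b: "b \<in> covariants \<Gamma> \<rho>" and t: "\<And>g. g \<in> carrier \<Gamma> \<Longrightarrow> sym_act g t = t"
  shows "vec (rep_dim \<Gamma> \<rho>) (\<lambda>a. t * b $ a) \<in> covariants \<Gamma> \<rho>"
  unfolding covariants_def
  by (auto simp: sym_act.hom_mult t covariants_act[OF b] sum_distrib_left mult_ac intro!: sum.cong)

text \<open>
  The equivariant projection of the linear map that sends the \<open>c\<close>-th basis vector to \<open>p\<close> and the
  others to \<open>0\<close>, up to the factor \<open>|G|\<close>.
\<close>
lemma covariants_average:
  assumes mr: "matrix_rep \<Gamma> \<rho>" and c: "c < rep_dim \<Gamma> \<rho>"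
  shows "vec (rep_dim \<Gamma> \<rho>) (\<lambda>a. \<Sum>g\<in>carrier \<Gamma>. scalar (\<rho> (inv g) $$ (c, a)) * sym_act g p) \<in> covariants \<Gamma> \<rho>"
    (is "?w \<in> _")
  unfolding covariants_def
proof (intro CollectI conjI ballI allI impI)
  fix h a assume h: "h \<in> carrier \<Gamma>" and a: "a < rep_dim \<Gamma> \<rho>"
  have act: "sym_act h (sym_act g p) = sym_act (h \<otimes> g) p" if "g \<in> carrier \<Gamma>" for g
    using sym_act_act carrier_sub h that by (auto simp: mult_eq)
  have "sym_act h (?w $ a) = (\<Sum>g\<in>carrier \<Gamma>. scalar (\<rho> (inv g) $$ (c, a)) * sym_act (h \<otimes> g) p)"
    using a by (simp add: sym_act.hom_sum sym_act.hom_mult act)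
  also have "\<dots> = (\<Sum>g\<in>carrier \<Gamma>. scalar (\<rho> (inv (h \<otimes> g) \<otimes> h) $$ (c, a)) * sym_act (h \<otimes> g) p)"
    using h by (intro sum.cong refl) (simp add: inv_mult_group m_assoc)
  also have "\<dots> = (\<Sum>g\<in>carrier \<Gamma>. scalar (\<rho> (inv g \<otimes> h) $$ (c, a)) * sym_act g p)"
    by (rule sum_left_translate[OF h, of "\<lambda>g. scalar (\<rho> (inv g \<otimes> h) $$ (c, a)) * sym_act g p"])
  also have "\<dots> = (\<Sum>g\<in>carrier \<Gamma>. \<Sum>e<rep_dim \<Gamma> \<rho>. scalar (\<rho> h $$ (e, a)) * (scalar (\<rho> (inv g) $$ (c, e)) * sym_act g p))"
  proof (intro sum.cong refl)
    fix g assume g: "g \<in> carrier \<Gamma>"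
    interpret s: comm_ring_hom scalar by (rule scalar_hom)
    show "scalar (\<rho> (inv g \<otimes> h) $$ (c, a)) * sym_act g p =
      (\<Sum>e<rep_dim \<Gamma> \<rho>. scalar (\<rho> h $$ (e, a)) * (scalar (\<rho> (inv g) $$ (c, e)) * sym_act g p))"
      unfolding rep_mult_entry[OF mr inv_closed[OF g] h c a]
      by (simp add: s.hom_sum s.hom_mult sum_distrib_left mult_ac)
  qed
  also have "\<dots> = (\<Sum>e<rep_dim \<Gamma> \<rho>. scalar (\<rho> h $$ (e, a)) * ?w $ e)"
    by (subst sum.swap) (simp add: sum_distrib_left)
  finally show "sym_act h (?w $ a) = (\<Sum>e<rep_dim \<Gamma> \<rho>. scalar (\<rho> h $$ (e, a)) * ?w $ e)" .
qed simp

text \<open>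
  A linear map from the representation space to \<open>Sym\<^sup>m V\<close> has coordinates indexed by
  \<open>I = {..<d} \<times> {..m}\<close>, and \<open>p\<close> is the matrix of the averaging projection onto the covariants of degree
  \<open>m\<close>. Its trace is the left-hand side. Its image has the basis \<open>\<theta>1\<^sup>a \<theta>2\<^sup>b B\<^sub>k\<close>: the covariants are free
  over \<open>\<complex>[\<theta>1, \<theta>2]\<close> with basis \<open>B\<close>, and \<open>\<theta>1\<close>, \<open>\<theta>2\<close> are algebraically independent.
\<close>
theorem covariant_dimension:
  assumes mr: "matrix_rep \<Gamma> \<rho>"
    and hs: "hsop (carrier \<Gamma>) \<theta>1 n1 \<theta>2 n2"
    and cb: "covariant_basis \<Gamma> \<rho> \<theta>1 \<theta>2 \<mu> e B"
  shows "(\<Sum>g\<in>carrier \<Gamma>. mat_trace (sym_power m g) * rep_char \<rho> (inv g)) / of_nat (card (carrier \<Gamma>)) =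
    of_nat (card (basis_indices n1 n2 \<mu> e m))"
proof -
  define d where "d = rep_dim \<Gamma> \<rho>"
  define N :: complex where "N = of_nat (card (carrier \<Gamma>))"
  have N: "N \<noteq> 0" using card_pos by (simp add: N_def)
  define S where "S = basis_indices n1 n2 \<mu> e m"
  define I where "I = {..<d} \<times> {..m}"
  define p where "p = (\<lambda>(a, k) (c, i). (\<Sum>g\<in>carrier \<Gamma>. \<rho> (inv g) $$ (c, a) * sym_power m g $$ (k, i)) / N)"
  define v where "v = (\<lambda>(k, a', b') a. \<theta>1 ^ a' * \<theta>2 ^ b' * B k $ a)"
  define b where "b s = (\<lambda>(a, k). sym_coeff (v s a) (m - k) k)" for s
  have n: "n1 > 0" "n2 > 0" using hs by (auto simp: hsop_def)
  have \<theta>: "sym_act g \<theta>1 = \<theta>1" "sym_act g \<theta>2 = \<theta>2" if "g \<in> carrier \<Gamma>" for g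
    using hs that by (auto simp: hsop_def sym_invariants_def)
  have \<theta>h: "sym_homogeneous n1 \<theta>1" "sym_homogeneous n2 \<theta>2"
    and \<theta>i: "\<And>f. sym_subst f \<theta>1 \<theta>2 = 0 \<Longrightarrow> f = 0" using hs by (auto simp: hsop_def)
  have B: "B k \<in> covariants \<Gamma> \<rho>" "\<And>a. a < d \<Longrightarrow> sym_homogeneous (e k) (B k $ a)" if "k \<in> {1..\<mu>}" for k
    using cb that by (auto simp: covariant_basis_def d_def)
  have expand: "\<exists>!c. c \<in> {1..\<mu>} \<rightarrow>\<^sub>E param_alg \<theta>1 \<theta>2 \<and> (\<forall>a<d. w $ a = (\<Sum>k=1..\<mu>. c k * B k $ a))"
    if "w \<in> covariants \<Gamma> \<rho>" for w
    using cb that by (auto simp: covariant_basis_def d_def)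
  have finS: "finite S" unfolding S_def
    by (rule finite_subset[OF basis_indices_subset[OF n order_refl]]) auto
  have finI: "finite I" by (simp add: I_def)
  have vh: "sym_homogeneous (a' * n1 + b' * n2 + e k) (v (k, a', b') a)" if "k \<in> {1..\<mu>}" "a < d" for k a' b' a
    unfolding v_def using B(2)[OF that]
    by (auto intro!: sym_homogeneous_mult sym_homogeneous_power \<theta>h)
  have vhS: "sym_homogeneous m (v s a)" if "s \<in> S" "a < d" for s a
  proof -
    obtain k a' b' where s: "s = (k, a', b')" by (cases s)
    show ?thesis using that vh[of k a a' b'] by (simp add: s S_def basis_indices_def)
  qed
  have vc: "vec d (v s) \<in> covariants \<Gamma> \<rho>" if "s \<in> S" for s
  proof -
    obtain k a' b' where s: "s = (k, a', b')" by (cases s)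
    show ?thesis
      using covariants_mult_invariant[OF B(1), of k "\<theta>1 ^ a' * \<theta>2 ^ b'"] that
      by (simp add: s S_def basis_indices_def v_def d_def sym_act.hom_mult sym_act.hom_power \<theta>)
  qed
  have fixed: "(\<Sum>i'\<in>I. p i i' * b s i') = b s i" if s: "s \<in> S" and i: "i \<in> I" for s i
  proof -
    obtain a k where ak: "i = (a, k)" "a < d" "k \<le> m" using i by (auto simp: I_def)
    have g: "(\<Sum>c<d. \<Sum>j\<le>m. \<rho> (inv g) $$ (c, a) * sym_power m g $$ (k, j) * b s (c, j)) = b s i"
      if g: "g \<in> carrier \<Gamma>" for g
    proof -
      have "(\<Sum>c<d. \<Sum>j\<le>m. \<rho> (inv g) $$ (c, a) * sym_power m g $$ (k, j) * b s (c, j)) =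
          (\<Sum>c<d. \<rho> (inv g) $$ (c, a) * sym_coeff (sym_act g (v s c)) (m - k) k)"
        by (intro sum.cong refl)
           (simp add: sym_act_coeff[OF vhS[OF s] ak(3)] sum_distrib_left mult.assoc b_def)
      also have "\<dots> = (\<Sum>c<d. \<rho> (inv g) $$ (c, a) * (\<Sum>x<d. \<rho> g $$ (x, c) * sym_coeff (v s x) (m - k) k))"
        using covariants_act[OF vc[OF s] g] by (intro sum.cong refl) (simp add: d_def[symmetric])
      also have "\<dots> = (\<Sum>c<d. \<Sum>x<d. \<rho> g $$ (x, c) * \<rho> (inv g) $$ (c, a) * sym_coeff (v s x) (m - k) k)"
        by (simp add: sum_distrib_left mult_ac)
      also have "\<dots> = (\<Sum>x<d. (\<Sum>c<d. \<rho> g $$ (x, c) * \<rho> (inv g) $$ (c, a)) * sym_coeff (v s x) (m - k) k)"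
        by (subst sum.swap) (simp add: sum_distrib_right)
      also have "\<dots> = (\<Sum>x<d. if x = a then sym_coeff (v s x) (m - k) k else 0)"
      proof (intro sum.cong refl)
        fix x assume "x \<in> {..<d}"
        then have x: "x < d" by simp
        have "(\<Sum>c<d. \<rho> g $$ (x, c) * \<rho> (inv g) $$ (c, a)) = \<rho> (g \<otimes> inv g) $$ (x, a)"
          unfolding d_def by (rule rep_mult_entry[symmetric]) (use mr g x ak in \<open>auto simp: d_def\<close>)
        also have "\<dots> = (if x = a then 1 else 0)" using g x ak by (simp add: rep_one[OF mr] d_def)
        finally show "(\<Sum>c<d. \<rho> g $$ (x, c) * \<rho> (inv g) $$ (c, a)) * sym_coeff (v s x) (m - k) k =
          (if x = a then sym_coeff (v s x) (m - k) k else 0)" by simp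
      qed
      also have "\<dots> = b s i" using ak by (simp add: b_def)
      finally show ?thesis .
    qed
    have "(\<Sum>i'\<in>I. p i i' * b s i') =
        (\<Sum>c<d. \<Sum>j\<le>m. \<Sum>g\<in>carrier \<Gamma>. \<rho> (inv g) $$ (c, a) * sym_power m g $$ (k, j) * b s (c, j) / N)"
      by (simp add: I_def sum.cartesian_product' p_def ak sum_distrib_right sum_divide_distrib)
    also have "\<dots> = (\<Sum>c<d. \<Sum>g\<in>carrier \<Gamma>. \<Sum>j\<le>m. \<rho> (inv g) $$ (c, a) * sym_power m g $$ (k, j) * b s (c, j) / N)"
      by (rule sum.cong[OF refl], rule sum.swap)
    also have "\<dots> = (\<Sum>g\<in>carrier \<Gamma>. \<Sum>c<d. \<Sum>j\<le>m. \<rho> (inv g) $$ (c, a) * sym_power m g $$ (k, j) * b s (c, j) / N)"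
      by (rule sum.swap)
    also have "\<dots> = (\<Sum>g\<in>carrier \<Gamma>. b s i / N)"
      by (intro sum.cong refl) (simp only: sum_divide_distrib[symmetric] g)
    also have "\<dots> = b s i" using N by (simp add: N_def)
    finally show ?thesis .
  qed
  have span_cov: "\<exists>c. \<forall>i\<in>I. (case i of (a, k) \<Rightarrow> sym_coeff (w $ a) (m - k) k) = (\<Sum>s\<in>S. c s * b s i)"
    if w: "w \<in> covariants \<Gamma> \<rho>" for w
  proof -
    obtain cc where cc: "cc \<in> {1..\<mu>} \<rightarrow>\<^sub>E param_alg \<theta>1 \<theta>2" "\<And>a. a < d \<Longrightarrow> w $ a = (\<Sum>k=1..\<mu>. cc k * B k $ a)"
      using expand[OF w] by blast
    have "\<forall>k. \<exists>f. k \<in> {1..\<mu>} \<longrightarrow> cc k = sym_subst f \<theta>1 \<theta>2"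
      using cc(1) by (auto simp: param_alg_def PiE_iff)
    then obtain f where f: "\<And>k. k \<in> {1..\<mu>} \<Longrightarrow> cc k = sym_subst (f k) \<theta>1 \<theta>2" by metis
    obtain D0 where D0: "\<And>k a b. sym_coeff (f k) a b \<noteq> 0 \<Longrightarrow> a \<le> D0 k \<and> b \<le> D0 k"
      using sym_coeff_bound[of "f _"] by metis
    \<comment> \<open>\<open>D\<close> bounds the exponents in all coefficients \<open>f k\<close>; the summand \<open>m\<close> makes it bound those in \<open>S\<close> too.\<close>
    define D where "D = m + (\<Sum>k=1..\<mu>. D0 k)"
    have Dm: "D \<ge> m" by (simp add: D_def)
    have D: "a \<le> D \<and> b \<le> D" if "sym_coeff (f k) a b \<noteq> 0" "k \<in> {1..\<mu>}" for k a b
    proof -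
      have "D0 k \<le> (\<Sum>k=1..\<mu>. D0 k)" using that(2) by (intro member_le_sum) auto
      then show ?thesis using D0[OF that(1)] by (simp add: D_def)
    qed
    define c where "c = (\<lambda>(k, a', b'). sym_coeff (f k) a' b')"
    define U where "U = {1..\<mu>} \<times> {..D} \<times> {..D}"
    have wU: "w $ a = (\<Sum>s\<in>U. scalar (c s) * v s a)" if a: "a < d" for a
    proof -
      have "w $ a = (\<Sum>k=1..\<mu>. \<Sum>x\<in>{..D} \<times> {..D}. scalar (c (k, x)) * v (k, x) a)"
        unfolding cc(2)[OF a]
        by (intro sum.cong refl)
           (simp add: f sym_subst_bounded[OF D] sum_distrib_right c_def v_def split_def mult.assoc)
      also have "\<dots> = (\<Sum>s\<in>U. scalar (c s) * v s a)"
        unfolding U_def by (subst sum.cartesian_product) (simp add: split_def)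
      finally show ?thesis .
    qed
    have "sym_coeff (w $ a) (m - k) k = (\<Sum>s\<in>S. c s * b s (a, k))" if "a < d" "k \<le> m" for a k
    proof -
      have "sym_coeff (w $ a) (m - k) k = (\<Sum>s\<in>U. c s * b s (a, k))"
        by (simp add: wU[OF that(1)] b_def)
      also have "\<dots> = (\<Sum>s\<in>S. c s * b s (a, k))"
      proof (rule sum.mono_neutral_right)
        show "finite U" by (simp add: U_def)
        show "S \<subseteq> U" unfolding S_def U_def by (rule basis_indices_subset[OF n Dm])
        show "\<forall>s\<in>U - S. c s * b s (a, k) = 0"
        proof
          fix s assume s: "s \<in> U - S"
          obtain l a' b' where sl: "s = (l, a', b')" by (cases s)
          have l: "l \<in> {1..\<mu>}" and ne: "a' * n1 + b' * n2 + e l \<noteq> m"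
            using s by (auto simp: sl U_def S_def basis_indices_def)
          have "sym_coeff (v s a) (m - k) k = 0"
            using vh[OF l that(1), of a' b'] ne that(2) unfolding sl sym_homogeneous_coeff by force
          then show "c s * b s (a, k) = 0" by (simp add: b_def)
        qed
      qed
      finally show ?thesis .
    qed
    then show ?thesis by (intro exI[of _ c]) (auto simp: I_def)
  qed
  have span: "\<exists>c. \<forall>i\<in>I. p i i' = (\<Sum>s\<in>S. c s * b s i)" if i': "i' \<in> I" for i'
  proof -
    obtain c j where cj: "i' = (c, j)" "c < d" "j \<le> m" using i' by (auto simp: I_def)
    define w where "w = vec d (\<lambda>a. \<Sum>g\<in>carrier \<Gamma>. scalar (\<rho> (inv g) $$ (c, a)) * sym_act g (sym_monom (m - j) j))"
    have "w \<in> covariants \<Gamma> \<rho>"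
      unfolding w_def d_def by (rule covariants_average[OF mr]) (use cj in \<open>simp add: d_def\<close>)
    from span_cov[OF this] obtain x where
      x: "\<And>i. i \<in> I \<Longrightarrow> (case i of (a, k) \<Rightarrow> sym_coeff (w $ a) (m - k) k) = (\<Sum>s\<in>S. x s * b s i)" by blast
    have "p i i' = (\<Sum>s\<in>S. x s / N * b s i)" if "i \<in> I" for i
    proof -
      have "p i i' = (case i of (a, k) \<Rightarrow> sym_coeff (w $ a) (m - k) k) / N"
        using that cj by (auto simp: I_def p_def w_def sym_power_entry)
      then show ?thesis by (simp add: x[OF that] sum_divide_distrib)
    qed
    then show ?thesis by (intro exI[of _ "\<lambda>s. x s / N"]) blast
  qed
  have indep: "c s = 0" if z: "\<And>i. i \<in> I \<Longrightarrow> (\<Sum>s\<in>S. c s * b s i) = 0" and s: "s \<in> S" for c s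
  proof -
    \<comment> \<open>Collected by \<open>k\<close>, the relation is an expansion of the zero covariant in the basis \<open>B\<close>.\<close>
    define f where "f k = (\<Sum>x\<in>{x. (k, x) \<in> S}. scalar (c (k, x)) * (case x of (a', b') \<Rightarrow> sym_monom a' b'))" for k
    have finx: "finite {x. (k, x) \<in> S}" for k
      by (rule finite_subset[of _ "snd ` S"]) (use finS in \<open>force+\<close>)
    define cc where "cc = restrict (\<lambda>k. sym_subst (f k) \<theta>1 \<theta>2) {1..\<mu>}"
    have ccB: "(\<Sum>k=1..\<mu>. cc k * B k $ a) = 0" if a: "a < d" for a
    proof -
      have "(\<Sum>k=1..\<mu>. cc k * B k $ a) = (\<Sum>k=1..\<mu>. \<Sum>x\<in>{x. (k, x) \<in> S}. scalar (c (k, x)) * v (k, x) a)"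
        by (intro sum.cong refl)
           (simp add: cc_def f_def sym_subst.hom_sum sym_subst.hom_mult sum_distrib_right v_def split_def sym_subst_monom mult.assoc)
      also have "\<dots> = (\<Sum>s\<in>(SIGMA k:{1..\<mu>}. {x. (k, x) \<in> S}). scalar (c s) * v s a)"
        by (subst sum.Sigma) (auto simp: finx split_def)
      also have "(SIGMA k:{1..\<mu>}. {x. (k, x) \<in> S}) = S"
        by (auto simp: S_def basis_indices_def)
      finally have eq: "(\<Sum>k=1..\<mu>. cc k * B k $ a) = (\<Sum>s\<in>S. scalar (c s) * v s a)" .
      have hom: "sym_homogeneous m (\<Sum>s\<in>S. scalar (c s) * v s a)"
        by (intro sym_homogeneous_sum sym_homogeneous_scalar_mult vhS a)
      have "sym_coeff (\<Sum>s\<in>S. scalar (c s) * v s a) (m - k) k = 0" if "k \<le> m" for k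
        using z[of "(a, k)"] that a by (simp add: I_def b_def)
      then have "(\<Sum>s\<in>S. scalar (c s) * v s a) = 0"
        by (subst sym_homogeneous_expand[OF hom]) (simp add: scalar_def)
      then show ?thesis using eq by simp
    qed
    have z0: "0\<^sub>v d \<in> covariants \<Gamma> \<rho>"
      by (auto simp: covariants_def d_def)
    have "cc \<in> {1..\<mu>} \<rightarrow>\<^sub>E param_alg \<theta>1 \<theta>2" by (auto simp: cc_def param_alg_def)
    moreover have "restrict (\<lambda>k. 0) {1..\<mu>} \<in> {1..\<mu>} \<rightarrow>\<^sub>E param_alg \<theta>1 \<theta>2"
      using sym_subst.hom_zero[of \<theta>1 \<theta>2] by (auto simp: param_alg_def intro!: range_eqI[of _ _ 0])
    ultimately have "cc \<in> {1..\<mu>} \<rightarrow>\<^sub>E param_alg \<theta>1 \<theta>2 \<and> (\<forall>a<d. 0\<^sub>v d $ a = (\<Sum>k=1..\<mu>. cc k * B k $ a))"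
      "restrict (\<lambda>k. 0) {1..\<mu>} \<in> {1..\<mu>} \<rightarrow>\<^sub>E param_alg \<theta>1 \<theta>2 \<and>
        (\<forall>a<d. 0\<^sub>v d $ a = (\<Sum>k=1..\<mu>. restrict (\<lambda>k. 0) {1..\<mu>} k * B k $ a))"
      using ccB by simp_all
    then have "cc = restrict (\<lambda>k. 0) {1..\<mu>}"
      using expand[OF z0] by blast
    moreover obtain k a' b' where sk: "s = (k, a', b')" by (cases s)
    moreover have k: "k \<in> {1..\<mu>}" using s sk by (auto simp: S_def basis_indices_def)
    ultimately have "sym_subst (f k) \<theta>1 \<theta>2 = 0" by (metis cc_def restrict_apply')
    then have "sym_coeff (f k) a' b' = 0" using \<theta>i[of "f k"] by simp
    moreover have "sym_coeff (f k) a' b' = (\<Sum>x\<in>{x. (k, x) \<in> S}. if x = (a', b') then c (k, x) else 0)"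
      unfolding f_def sym_coeff_sum by (intro sum.cong refl) (auto simp: sym_coeff_monom split_def)
    ultimately show ?thesis using s finx[of k] by (simp add: sk)
  qed
  have "(\<Sum>i\<in>I. p i i) = of_nat (card S)"
  proof (rule trace_eq_card_basis[of I S p b, OF finI finS fixed span])
    fix c s assume "\<And>i. i \<in> I \<Longrightarrow> (\<Sum>s\<in>S. c s * b s i) = 0" "s \<in> S"
    then show "c s = 0" by (rule indep)
  qed
  moreover have "(\<Sum>i\<in>I. p i i) = (\<Sum>a<d. \<Sum>k\<le>m. \<Sum>g\<in>carrier \<Gamma>. \<rho> (inv g) $$ (a, a) * sym_power m g $$ (k, k) / N)"
    unfolding I_def sum.cartesian_product' by (simp add: p_def sum_divide_distrib)
  moreover have "\<dots> = (\<Sum>a<d. \<Sum>g\<in>carrier \<Gamma>. \<Sum>k\<le>m. \<rho> (inv g) $$ (a, a) * sym_power m g $$ (k, k) / N)"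
    by (rule sum.cong[OF refl], rule sum.swap)
  moreover have "\<dots> = (\<Sum>g\<in>carrier \<Gamma>. \<Sum>a<d. \<Sum>k\<le>m. \<rho> (inv g) $$ (a, a) * sym_power m g $$ (k, k) / N)"
    by (rule sum.swap)
  moreover have "\<dots> = (\<Sum>g\<in>carrier \<Gamma>. mat_trace (sym_power m g) * rep_char \<rho> (inv g)) / N"
    unfolding sum_divide_distrib
    by (intro sum.cong refl)
       (simp add: rep_char_sum[OF mr] mat_trace_def d_def sum_product sum_divide_distrib
         lessThan_Suc_atMost carrier_matD[OF sym_power_carrier[of m]] mult.commute
         sum.swap[of _ "{..m}"])
  ultimately show ?thesis by (simp add: S_def N_def)
qed

end

section \<open>Rational functions near \<open>q = 1\<close>\<close>

text \<open>
  \<open>F\<close> is the expansion at \<open>q = 0\<close> of a rational function that is regular at \<open>q = 1\<close> with value \<open>v\<close>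
  there.
\<close>
definition value_at_one :: "complex fps \<Rightarrow> complex \<Rightarrow> bool" where
  "value_at_one F v \<longleftrightarrow> (\<exists>P Q. F * fps_of_poly Q = fps_of_poly P \<and> poly Q 1 \<noteq> 0 \<and> v = poly P 1 / poly Q 1)"

lemma value_at_oneI:
  "F * fps_of_poly Q = fps_of_poly P \<Longrightarrow> poly Q 1 \<noteq> 0 \<Longrightarrow> v = poly P 1 / poly Q 1 \<Longrightarrow> value_at_one F v"
  unfolding value_at_one_def by blast

lemma value_at_one_0: "value_at_one 0 0"
  by (rule value_at_oneI[of _ 1 0]) auto

lemma value_at_one_const_mult: "value_at_one F v \<Longrightarrow> value_at_one (fps_const c * F) (c * v)"
proof -
  assume "value_at_one F v"
  then obtain P Q where *: "F * fps_of_poly Q = fps_of_poly P" "poly Q 1 \<noteq> 0" "v = poly P 1 / poly Q 1"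
    by (auto simp: value_at_one_def)
  show ?thesis
    by (rule value_at_oneI[of _ Q "Polynomial.smult c P"])
       (use * in \<open>auto simp: fps_of_poly_smult mult.assoc\<close>)
qed

lemma value_at_one_add:
  assumes "value_at_one F v" "value_at_one F' v'"
  shows "value_at_one (F + F') (v + v')"
proof -
  from assms obtain P Q P' Q' where *: "F * fps_of_poly Q = fps_of_poly P" "poly Q 1 \<noteq> 0" "v = poly P 1 / poly Q 1"
     "F' * fps_of_poly Q' = fps_of_poly P'" "poly Q' 1 \<noteq> 0" "v' = poly P' 1 / poly Q' 1"
    by (auto simp: value_at_one_def)
  have "(F + F') * fps_of_poly (Q * Q') = (F * fps_of_poly Q) * fps_of_poly Q' + (F' * fps_of_poly Q') * fps_of_poly Q"
    by (simp add: fps_of_poly_mult algebra_simps)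
  also have "\<dots> = fps_of_poly (P * Q' + P' * Q)"
    by (simp add: * fps_of_poly_mult fps_of_poly_add)
  finally show ?thesis
    by (rule value_at_oneI) (simp_all add: *(2,5) *(3,6) add_frac_eq mult.commute)
qed

lemma value_at_one_sum:
  assumes "finite A" "\<And>x. x \<in> A \<Longrightarrow> value_at_one (F x) (v x)"
  shows "value_at_one (\<Sum>x\<in>A. F x) (\<Sum>x\<in>A. v x)"
  using assms by (induction A rule: finite_induct) (auto intro: value_at_one_0 value_at_one_add)

lemma fps_to_fls_poly_mult:
  "fps_to_fls (fps_of_poly (P * Q)) = fps_to_fls (fps_of_poly P) * fps_to_fls (fps_of_poly Q)"
  by (simp add: fps_of_poly_mult fls_times_fps_to_fls)

lemma pcompose_swap_nonzero:
  assumes "Q \<noteq> (0::complex poly)"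
  shows "Q \<circ>\<^sub>p [:1, -1:] \<noteq> 0"
  using assms pcompose_eq_0[of Q "[:1, -1:]"] by auto

lemma laurent_at_one_eq:
  assumes "Q \<noteq> 0" and "F * fps_of_poly Q = fps_of_poly P"
  shows "laurent_at_one F =
    fps_to_fls (fps_of_poly (P \<circ>\<^sub>p [:1, -1:])) / fps_to_fls (fps_of_poly (Q \<circ>\<^sub>p [:1, -1:]))"
proof -
  define L where "L P Q = fps_to_fls (fps_of_poly (P \<circ>\<^sub>p [:1, -1:])) / fps_to_fls (fps_of_poly (Q \<circ>\<^sub>p [:1, -1:]))"
    for P Q :: "complex poly"
  have "L P' Q' = L P Q" if "Q' \<noteq> 0" "F * fps_of_poly Q' = fps_of_poly P'" for P' Q'
  proof -
    have "fps_of_poly (P' * Q) = F * fps_of_poly Q' * fps_of_poly Q"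
      by (simp add: fps_of_poly_mult that)
    also have "\<dots> = fps_of_poly (P * Q')"
      by (simp add: fps_of_poly_mult assms(2)[symmetric] mult_ac)
    finally have "P' * Q = P * Q'" by (simp only: fps_of_poly_eq_iff)
    then have "(P' \<circ>\<^sub>p [:1, -1:]) * (Q \<circ>\<^sub>p [:1, -1:]) = (P \<circ>\<^sub>p [:1, -1:]) * (Q' \<circ>\<^sub>p [:1, -1:])"
      by (simp only: pcompose_mult[symmetric])
    then have "fps_to_fls (fps_of_poly (P' \<circ>\<^sub>p [:1, -1:])) * fps_to_fls (fps_of_poly (Q \<circ>\<^sub>p [:1, -1:]))
        = fps_to_fls (fps_of_poly (P \<circ>\<^sub>p [:1, -1:])) * fps_to_fls (fps_of_poly (Q' \<circ>\<^sub>p [:1, -1:]))"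
      by (simp only: fps_to_fls_poly_mult[symmetric])
    then show ?thesis
      using pcompose_swap_nonzero[OF that(1)] pcompose_swap_nonzero[OF assms(1)]
      unfolding L_def by (simp add: field_simps)
  qed
  then show ?thesis
    unfolding laurent_at_one_def L_def[symmetric] using assms by (intro the_equality) blast+
qed

text \<open>
  In the variable \<open>t = 1 - q\<close> the Laurent series is \<open>t\<^sup>-\<^sup>1\<close> times a power series with constant term
  \<open>v\<close>.
\<close>
theorem res_one_simple_pole:
  assumes "value_at_one F v"
  shows "res_one (F / (1 - fps_X)) = v"
proof -
  from assms obtain P Q where *: "F * fps_of_poly Q = fps_of_poly P" "poly Q 1 \<noteq> 0" "v = poly P 1 / poly Q 1"
    by (auto simp: value_at_one_def)
  define p q where "p = fps_of_poly (P \<circ>\<^sub>p [:1, -1:])" and "q = fps_of_poly (Q \<circ>\<^sub>p [:1, -1:])"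
  have nth: "fps_nth p 0 = poly P 1" "fps_nth q 0 = poly Q 1"
    by (simp_all add: p_def q_def fps_of_poly_nth poly_0_coeff_0[symmetric] poly_pcompose)
  have X: "fps_of_poly [:1, -1:] = (1 - fps_X :: complex fps)"
    by (simp add: fps_of_poly_pCons)
  have "F / (1 - fps_X) * (1 - fps_X) = F"
    by (simp add: fps_divide_unit mult.assoc inverse_mult_eq_1)
  then have "F / (1 - fps_X) * fps_of_poly ([:1, -1:] * Q) = fps_of_poly P"
    by (simp add: fps_of_poly_mult X mult.assoc[symmetric] * del: mult_pCons_left)
  moreover have "[:1, -1:] * Q \<noteq> 0" using *(2) by (auto simp del: mult_pCons_left)
  ultimately have "laurent_at_one (F / (1 - fps_X)) =
      fps_to_fls p / fps_to_fls (fps_of_poly (([:1, -1:] * Q) \<circ>\<^sub>p [:1, -1:]))"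
    unfolding p_def by (intro laurent_at_one_eq)
  also have "([:1, -1:] * Q) \<circ>\<^sub>p [:1, -1:] = [:0, 1:] * (Q \<circ>\<^sub>p [:1, -1:])"
    by (simp add: pcompose_mult pcompose_pCons del: mult_pCons_left)
  also have "fps_to_fls p / fps_to_fls (fps_of_poly ([:0, 1:] * (Q \<circ>\<^sub>p [:1, -1:]))) = fls_X_inv * fps_to_fls (p * inverse q)"
  proof -
    have "fps_nth q 0 \<noteq> 0" using nth *(2) by simp
    then have q: "fps_to_fls q \<noteq> 0" and "p * inverse q * q = p"
      by (auto simp: mult.assoc inverse_mult_eq_1)
    then have p: "fps_to_fls p = fps_to_fls (p * inverse q) * fps_to_fls q"
      by (simp add: fls_times_fps_to_fls[symmetric])
    have "fps_to_fls (fps_of_poly ([:0, 1:] * (Q \<circ>\<^sub>p [:1, -1:]))) = fls_X * fps_to_fls q"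
      unfolding fps_to_fls_poly_mult q_def by (simp add: fps_of_poly_pCons)
    moreover have "fls_X_inv * fls_X = (1 :: complex fls)"
      by (metis fls_inverse_X fls_X_nonzero left_inverse)
    ultimately show ?thesis using q
      by (subst p, intro nonzero_divide_eq_eq[THEN iffD2]) (auto simp: mult.left_commute mult.commute[of fls_X_inv] mult.assoc)
  qed
  finally have "res_one (F / (1 - fps_X)) = fps_nth (p * inverse q) 0"
    unfolding res_one_def by (simp add: fls_X_inv_times_conv_shift)
  also have "\<dots> = v" using * nth by (simp add: fps_inverse_def field_simps)
  finally show ?thesis .
qed

text \<open>
  \<open>1 - q\<^sup>n = (1 - q) (1 + q + \<dots> + q\<^sup>n\<^sup>-\<^sup>1)\<close>, so \<open>E\<close> is \<open>(1 - q)\<^sup>2\<close> times a function with value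
  \<open>n1 n2 v\<close> at \<open>q = 1\<close>.
\<close>
theorem second_derivative_at_one:
  assumes v: "value_at_one F v"
    and E: "fps_of_poly E = (1 - fps_X ^ n1) * (1 - fps_X ^ n2) * F"
  shows "poly ((pderiv ^^ 2) E) 1 = 2 * (of_nat n1 * of_nat n2 * v)"
proof -
  from assms obtain P Q where *: "F * fps_of_poly Q = fps_of_poly P" "poly Q 1 \<noteq> 0" "v = poly P 1 / poly Q 1"
    by (auto simp: value_at_one_def)
  define s :: "nat \<Rightarrow> complex poly" where "s n = (\<Sum>i<n. monom 1 i)" for n
  have sX: "fps_of_poly (s n) = (\<Sum>i<n. fps_X ^ i)" for n
    by (simp add: s_def fps_of_poly_sum fps_of_poly_monom')
  have s1: "fps_of_poly ([:1, -1:] * s n) = 1 - fps_X ^ n" for n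
    by (simp add: fps_of_poly_mult sX fps_of_poly_pCons one_diff_power_eq del: mult_pCons_left)
  have s2: "poly (s n) 1 = of_nat n" for n by (simp add: s_def poly_sum poly_monom)
  have "fps_of_poly (E * Q) = fps_of_poly (([:1, -1:] * s n1) * ([:1, -1:] * s n2) * P)"
  proof -
    have "fps_of_poly (E * Q) = (1 - fps_X ^ n1) * (1 - fps_X ^ n2) * (F * fps_of_poly Q)"
      by (simp only: fps_of_poly_mult E mult.assoc)
    also have "\<dots> = fps_of_poly (([:1, -1:] * s n1) * ([:1, -1:] * s n2) * P)"
      by (simp only: *(1) s1[symmetric] fps_of_poly_mult)
    finally show ?thesis .
  qed
  then have EQ: "E * Q = ([:1, -1:] ^ 2) * (s n1 * s n2 * P)"
    by (simp add: power2_eq_square mult_ac del: mult_pCons_left mult_pCons_right)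
  define H where "H = s n1 * s n2 * P"
  define Z :: "complex poly" where "Z = [:1, -1:]"
  have Z: "poly Z 1 = 0" "pderiv Z = -1" by (simp_all add: Z_def pderiv_pCons one_pCons)
  have two: "pderiv (2 :: complex poly) = 0" by (metis of_nat_numeral pderiv_of_nat)
  have EQ: "E * Q = Z * Z * H" using EQ by (simp only: Z_def H_def power2_eq_square)
  have "poly (E * Q) 1 = poly (Z * Z * H) 1" by (simp only: EQ)
  then have E0: "poly E 1 = 0" using *(2) Z by simp
  have "poly (pderiv (E * Q)) 1 = poly (pderiv (Z * Z * H)) 1" by (simp only: EQ)
  then have E1: "poly (pderiv E) 1 = 0" using *(2) Z E0 by (simp add: pderiv_mult)
  have "poly (pderiv (pderiv (E * Q))) 1 = poly (pderiv (pderiv (Z * Z * H))) 1" by (simp only: EQ)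
  then have "poly (pderiv (pderiv E)) 1 * poly Q 1 = 2 * poly H 1"
    using Z E0 E1 by (simp add: pderiv_mult pderiv_add pderiv_diff pderiv_minus two mult.commute)
  then have "poly (pderiv (pderiv E)) 1 = 2 * (of_nat n1 * of_nat n2 * v)"
  proof -
    assume eq: "poly (pderiv (pderiv E)) 1 * poly Q 1 = 2 * poly H 1"
    have "poly P 1 = v * poly Q 1" using *(2,3) by simp
    then have "poly (pderiv (pderiv E)) 1 * poly Q 1 = 2 * (of_nat n1 * of_nat n2 * v) * poly Q 1"
      unfolding eq by (simp add: H_def s2)
    then show ?thesis using *(2) mult_cancel_right by blast
  qed
  then show ?thesis by (simp add: numeral_2_eq_2)
qed

text \<open>
  The companion of \<open>second_derivative_at_one\<close> for a double pole: the zero of the first two factors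
  cancels it and leaves \<open>n1 n2 c\<close>, while the regular part is killed.
\<close>
theorem value_double_pole:
  assumes v: "value_at_one F v" and H: "H * (1 - fps_X) ^ 2 = 1"
    and E: "fps_of_poly E = (1 - fps_X ^ n1) * (1 - fps_X ^ n2) * (fps_const c * H + F)"
  shows "poly E 1 = of_nat n1 * of_nat n2 * c"
proof -
  from v obtain P Q where *: "F * fps_of_poly Q = fps_of_poly P" "poly Q 1 \<noteq> 0"
    by (auto simp: value_at_one_def)
  define s :: "nat \<Rightarrow> complex poly" where "s n = (\<Sum>i<n. monom 1 i)" for n
  have sX: "fps_of_poly (s n) = (\<Sum>i<n. fps_X ^ i)" for n
    by (simp add: s_def fps_of_poly_sum fps_of_poly_monom')
  have s1: "1 - fps_X ^ n = (1 - fps_X) * fps_of_poly (s n)" for n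
    by (simp add: sX one_diff_power_eq)
  have s2: "poly (s n) 1 = of_nat n" for n by (simp add: s_def poly_sum poly_monom)
  have X: "fps_of_poly [:1, -1:] = (1 - fps_X :: complex fps)"
    by (simp add: fps_of_poly_pCons)
  define R where "R = Polynomial.smult c (s n1 * s n2) * Q + ([:1, -1:] * [:1, -1:]) * (s n1 * s n2 * P)"
  have "fps_of_poly (E * Q) =
      fps_const c * (fps_of_poly (s n1) * fps_of_poly (s n2)) * (H * (1 - fps_X) ^ 2) * fps_of_poly Q
      + (1 - fps_X) * (1 - fps_X) * (fps_of_poly (s n1) * fps_of_poly (s n2) * (F * fps_of_poly Q))"
    unfolding fps_of_poly_mult E s1 by (simp add: algebra_simps power2_eq_square)
  also have "\<dots> = fps_of_poly R"
    unfolding R_def by (simp only: H *(1) fps_of_poly_mult fps_of_poly_add fps_of_poly_smult X) (simp add: mult_ac)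
  finally have "E * Q = R" by (simp only: fps_of_poly_eq_iff)
  then have "poly E 1 * poly Q 1 = poly R 1" by (metis poly_mult)
  also have "\<dots> = of_nat n1 * of_nat n2 * c * poly Q 1" by (simp add: R_def s2)
  finally show ?thesis using *(2) mult_cancel_right by blast
qed

section \<open>The Hilbert series of the covariants\<close>

lemma fps_dvd_series:
  assumes "n > 0"
  shows "Abs_fps (\<lambda>m. if n dvd m then 1 else 0) * (1 - fps_X ^ n) = (1 :: 'a::comm_ring_1 fps)"
proof (rule fps_ext)
  fix m
  have "n dvd m - n \<longleftrightarrow> n dvd m" if "n \<le> m" using that by (simp add: dvd_minus_self)
  then show "fps_nth (Abs_fps (\<lambda>m. if n dvd m then 1 else 0) * (1 - fps_X ^ n)) m = fps_nth (1 :: 'a fps) m"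
    using assms by (auto simp: right_diff_distrib fps_X_power_mult_right_nth dvd_imp_le nat_dvd_not_less)
qed

text \<open>
  The generator of degree \<open>e k\<close> contributes \<open>q\<close> to the power \<open>e k\<close>, times one geometric series in
  \<open>q^n1\<close> and one in \<open>q^n2\<close>.
\<close>
theorem basis_series:
  assumes n: "n1 > 0" "n2 > 0"
  shows "Abs_fps (\<lambda>m. of_nat (card (basis_indices n1 n2 \<mu> e m))) * ((1 - fps_X ^ n1) * (1 - fps_X ^ n2)) =
    fps_of_poly (\<Sum>k=1..\<mu>. monom (1::complex) (e k))"
proof -
  define G where "G n = Abs_fps (\<lambda>m. if n dvd m then 1 else 0 :: complex)" for n
  define T where "T m = {(a, b). a * n1 + b * n2 = m}" for m
  have finT: "finite (T m)" for m
  proof (rule finite_subset)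
    show "T m \<subseteq> {..m} \<times> {..m}"
    proof
      fix x assume "x \<in> T m"
      then obtain a b where x: "x = (a, b)" "a * n1 + b * n2 = m" by (auto simp: T_def)
      have "a \<le> a * n1" "b \<le> b * n2" using n by auto
      then have "a \<le> m" "b \<le> m" using x(2) by linarith+
      then show "x \<in> {..m} \<times> {..m}" using x by auto
    qed
  qed auto
  have GT: "fps_nth (G n1 * G n2) m = of_nat (card (T m))" for m
  proof -
    have "fps_nth (G n1 * G n2) m = (\<Sum>i=0..m. if n1 dvd i \<and> n2 dvd (m - i) then 1 else 0)"
      by (auto simp: G_def fps_mult_nth intro!: sum.cong)
    also have "\<dots> = of_nat (card {i\<in>{0..m}. n1 dvd i \<and> n2 dvd (m - i)})"
      by (subst sum.inter_filter[symmetric]) auto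
    also have "card {i\<in>{0..m}. n1 dvd i \<and> n2 dvd (m - i)} = card (T m)"
    proof (rule bij_betw_same_card[of "\<lambda>i. (i div n1, (m - i) div n2)"], rule bij_betwI[where g = "\<lambda>(a, b). a * n1"])
      show "(\<lambda>i. (i div n1, (m - i) div n2)) \<in> {i\<in>{0..m}. n1 dvd i \<and> n2 dvd (m - i)} \<rightarrow> T m"
        by (auto simp: T_def)
      show "(\<lambda>(a, b). a * n1) \<in> T m \<rightarrow> {i\<in>{0..m}. n1 dvd i \<and> n2 dvd (m - i)}"
        by (auto simp: T_def)
    qed (use n in \<open>auto simp: T_def\<close>)
    finally show ?thesis .
  qed
  have series: "Abs_fps (\<lambda>m. of_nat (card (basis_indices n1 n2 \<mu> e m))) = (\<Sum>k=1..\<mu>. fps_X ^ e k * (G n1 * G n2))"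
  proof (rule fps_ext)
    fix m
    have "basis_indices n1 n2 \<mu> e m = (SIGMA k:{1..\<mu>}. if m < e k then {} else T (m - e k))"
      by (auto simp: basis_indices_def T_def split: if_splits)
    then have "(of_nat (card (basis_indices n1 n2 \<mu> e m)) :: complex) =
        (\<Sum>k=1..\<mu>. if m < e k then 0 else of_nat (card (T (m - e k))))"
      by (simp add: card_SigmaI finT if_distrib[of card] if_distrib[of of_nat] cong: if_cong)
    also have "\<dots> = fps_nth (\<Sum>k=1..\<mu>. fps_X ^ e k * (G n1 * G n2)) m"
      unfolding fps_sum_nth by (intro sum.cong refl) (simp only: fps_X_power_mult_nth GT)
    finally show "fps_nth (Abs_fps (\<lambda>m. of_nat (card (basis_indices n1 n2 \<mu> e m)))) m =
      fps_nth (\<Sum>k=1..\<mu>. fps_X ^ e k * (G n1 * G n2)) m" by simp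
  qed
  have GG: "G n1 * G n2 * ((1 - fps_X ^ n1) * (1 - fps_X ^ n2)) = 1"
    using fps_dvd_series[OF n(1), where 'a = complex] fps_dvd_series[OF n(2), where 'a = complex]
    by (simp add: G_def mult_ac)
  have "Abs_fps (\<lambda>m. of_nat (card (basis_indices n1 n2 \<mu> e m))) * ((1 - fps_X ^ n1) * (1 - fps_X ^ n2)) =
    (\<Sum>k=1..\<mu>. fps_X ^ e k * (G n1 * G n2 * ((1 - fps_X ^ n1) * (1 - fps_X ^ n2))))"
    unfolding series by (simp only: sum_distrib_right mult.assoc)
  also have "\<dots> = fps_of_poly (\<Sum>k=1..\<mu>. monom 1 (e k))"
    by (simp add: GG fps_of_poly_sum fps_of_poly_monom')
  finally show ?thesis .
qed

section \<open>The sum of the positive roots\<close>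

definition reflect :: "'v::real_inner \<Rightarrow> 'v \<Rightarrow> 'v" where
  "reflect a b = b - (2 * inner b a / inner a a) *\<^sub>R a"

lemma reflect_reflect: "a \<noteq> 0 \<Longrightarrow> reflect a (reflect a b) = b"
  by (simp add: reflect_def inner_diff_left algebra_simps)

lemma reflect_self: "a \<noteq> 0 \<Longrightarrow> reflect a a = - a"
  by (simp add: reflect_def scaleR_2)

lemma reflect_sum: "reflect a (\<Sum>b\<in>P. f b) = (\<Sum>b\<in>P. reflect a (f b))"
  by (simp add: reflect_def inner_sum_left sum_subtractf sum_distrib_left sum_divide_distrib scaleR_sum_left)

lemma independent_family_eq:
  fixes \<alpha> :: "nat \<Rightarrow> 'v::real_vector"
  assumes "inj_on \<alpha> {1..n}" "Real_Vector_Spaces.independent (\<alpha> ` {1..n})"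
    and eq: "(\<Sum>i=1..n. x i *\<^sub>R \<alpha> i) = (\<Sum>i=1..n. y i *\<^sub>R \<alpha> i)" and i: "i \<in> {1..n}"
  shows "x i = y i"
proof -
  define u where "u v = x (the_inv_into {1..n} \<alpha> v) - y (the_inv_into {1..n} \<alpha> v)" for v
  have u: "u (\<alpha> j) = x j - y j" if "j \<in> {1..n}" for j
    using that assms(1) by (simp add: u_def the_inv_into_f_f)
  have "(\<Sum>v\<in>\<alpha> ` {1..n}. u v *\<^sub>R v) = (\<Sum>j=1..n. u (\<alpha> j) *\<^sub>R \<alpha> j)"
    by (subst sum.reindex[OF assms(1)]) simp
  also have "\<dots> = (\<Sum>j=1..n. (x j - y j) *\<^sub>R \<alpha> j)" using u by simp
  also have "\<dots> = 0" using eq by (simp add: scaleR_diff_left sum_subtractf)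
  finally have "u (\<alpha> i) = 0"
    using Real_Vector_Spaces.independentD[OF assms(2) _ subset_refl] i by blast
  then show ?thesis using u[OF i] by simp
qed

lemma positive_not_negative:
  assumes "root_system \<Phi>" "simple_roots \<Phi> n \<alpha>" and b: "b \<in> positive_roots \<Phi> n \<alpha>"
  shows "- b \<notin> positive_roots \<Phi> n \<alpha>"
proof
  assume "- b \<in> positive_roots \<Phi> n \<alpha>"
  with b obtain k l :: "nat \<Rightarrow> nat" where k: "b = (\<Sum>i=1..n. of_nat (k i) *\<^sub>R \<alpha> i)"
    and l: "- b = (\<Sum>i=1..n. of_nat (l i) *\<^sub>R \<alpha> i)" by (auto simp: positive_roots_def)
  have "(\<Sum>i=1..n. of_nat (k i) *\<^sub>R \<alpha> i) = (\<Sum>i=1..n. (- of_nat (l i)) *\<^sub>R \<alpha> i)"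
    using k l by (simp add: sum_negf) (metis add.inverse_inverse)
  then have "(of_nat (k i) :: real) = - of_nat (l i)" if "i \<in> {1..n}" for i
    using independent_family_eq[of \<alpha> n "\<lambda>i. of_nat (k i)" "\<lambda>i. - of_nat (l i)" i] assms(2) that
    by (simp add: simple_roots_def)
  then have "k i = 0" if "i \<in> {1..n}" for i using that by fastforce
  then have "b = 0" by (simp add: k)
  then show False using b assms(1) by (auto simp: positive_roots_def root_system_def)
qed

text \<open>
  The reflection changes only the coefficient of \<open>\<alpha> j\<close>. The root system is reduced, so a positive
  root other than \<open>\<alpha> j\<close> has a positive coefficient somewhere else; this coefficient survives and
  decides the sign of the image.
\<close>
lemma reflect_positive:
  assumes rs: "root_system \<Phi>" and sr: "simple_roots \<Phi> n \<alpha>" and j: "j \<in> {1..n}"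
    and b: "b \<in> positive_roots \<Phi> n \<alpha>" "b \<noteq> \<alpha> j"
  shows "reflect (\<alpha> j) b \<in> positive_roots \<Phi> n \<alpha> - {\<alpha> j}"
proof -
  note ind = independent_family_eq[of \<alpha> n]
  have inj: "inj_on \<alpha> {1..n}" and li: "Real_Vector_Spaces.independent (\<alpha> ` {1..n})"
    and sub: "\<alpha> ` {1..n} \<subseteq> \<Phi>" and pn: "\<And>b. b \<in> \<Phi> \<Longrightarrow> b \<in> positive_roots \<Phi> n \<alpha> \<or> - b \<in> positive_roots \<Phi> n \<alpha>"
    using sr by (auto simp: simple_roots_def)
  have b\<Phi>: "b \<in> \<Phi>" and a\<Phi>: "\<alpha> j \<in> \<Phi>" using b sub j by (auto simp: positive_roots_def)
  have a0: "\<alpha> j \<noteq> 0" using a\<Phi> rs by (auto simp: root_system_def)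
  define c where "c = 2 * inner b (\<alpha> j) / inner (\<alpha> j) (\<alpha> j)"
  obtain k :: "nat \<Rightarrow> nat" where k: "b = (\<Sum>i=1..n. of_nat (k i) *\<^sub>R \<alpha> i)"
    using b by (auto simp: positive_roots_def)
  have s: "(\<Sum>i=1..n. (if i = j then t else 0) *\<^sub>R \<alpha> i) = t *\<^sub>R \<alpha> j" for t
    using j by (simp add: if_distrib[of "\<lambda>x. x *\<^sub>R _"] cong: if_cong)
  have rb: "reflect (\<alpha> j) b = (\<Sum>i=1..n. (of_nat (k i) - (if i = j then c else 0)) *\<^sub>R \<alpha> i)"
    by (simp only: scaleR_diff_left sum_subtractf s) (simp add: reflect_def k c_def)
  have r\<Phi>: "reflect (\<alpha> j) b \<in> \<Phi>"
    using rs b\<Phi> a\<Phi> by (auto simp: root_system_def reflect_def)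
  have "\<exists>i\<in>{1..n}. i \<noteq> j \<and> k i > 0"
  proof (rule ccontr)
    assume "\<not> ?thesis"
    then have "b = (\<Sum>i=1..n. (if i = j then of_nat (k j) else 0) *\<^sub>R \<alpha> i)"
      unfolding k by (intro sum.cong refl) auto
    then have bj: "b = of_nat (k j) *\<^sub>R \<alpha> j" by (simp only: s)
    then have "of_nat (k j) = (1::real) \<or> of_nat (k j) = (-1::real)"
      using rs a\<Phi> b\<Phi> unfolding root_system_def by blast
    moreover have "of_nat (k j) \<noteq> (-1::real)" by (smt (verit) of_nat_0_le_iff)
    ultimately have "b = \<alpha> j" using bj by simp
    with b(2) show False by simp
  qed
  then obtain i where i: "i \<in> {1..n}" "i \<noteq> j" "k i > 0" by blast
  have "- reflect (\<alpha> j) b \<notin> positive_roots \<Phi> n \<alpha>"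
  proof
    assume "- reflect (\<alpha> j) b \<in> positive_roots \<Phi> n \<alpha>"
    then obtain l :: "nat \<Rightarrow> nat" where l: "- reflect (\<alpha> j) b = (\<Sum>i=1..n. of_nat (l i) *\<^sub>R \<alpha> i)"
      by (auto simp: positive_roots_def)
    have "(\<Sum>i=1..n. (of_nat (k i) - (if i = j then c else 0)) *\<^sub>R \<alpha> i) = (\<Sum>i=1..n. (- of_nat (l i)) *\<^sub>R \<alpha> i)"
      using l rb by (simp add: sum_negf) (metis add.inverse_inverse)
    from ind[OF inj li this i(1)] i show False by (smt (verit) of_nat_0_le_iff of_nat_0_less_iff)
  qed
  then have "reflect (\<alpha> j) b \<in> positive_roots \<Phi> n \<alpha>" using pn[OF r\<Phi>] by blast
  moreover have "reflect (\<alpha> j) b \<noteq> \<alpha> j"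
  proof
    assume "reflect (\<alpha> j) b = \<alpha> j"
    then have "b = - \<alpha> j" using reflect_reflect[OF a0, of b] reflect_self[OF a0] by simp
    moreover have "\<alpha> j \<in> positive_roots \<Phi> n \<alpha>"
      unfolding positive_roots_def using a\<Phi> s[of 1]
      by (auto intro!: exI[of _ "\<lambda>i. if i = j then 1 else 0"] simp: if_distrib[of of_nat] cong: if_cong)
    ultimately show False using positive_not_negative[OF rs sr] b(1) by blast
  qed
  ultimately show ?thesis by blast
qed

text \<open>
  The reflection in \<open>\<alpha> j\<close> sends \<open>\<alpha> j\<close> to its negative and permutes the other positive roots, so it
  subtracts \<open>2 \<alpha> j\<close> from the sum of all of them; by definition it subtracts the Cartan integer times \<open>\<alpha> j\<close>.
\<close>
theorem sum_positive_roots_cartan: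
  assumes rs: "root_system \<Phi>" and sr: "simple_roots \<Phi> n \<alpha>"
    and r: "(\<Sum>b\<in>positive_roots \<Phi> n \<alpha>. b) = (\<Sum>i=1..n. r i *\<^sub>R \<alpha> i)"
    and j: "j \<in> {1..n}"
  shows "(\<Sum>i=1..n. r i * cartan_entry \<alpha> i j) = 2"
proof -
  define P where "P = positive_roots \<Phi> n \<alpha>"
  define S where "S = (\<Sum>b\<in>P. b)"
  have a\<Phi>: "\<alpha> j \<in> \<Phi>" using sr j by (auto simp: simple_roots_def)
  have a0: "\<alpha> j \<noteq> 0" using a\<Phi> rs by (auto simp: root_system_def)
  have fin: "finite P" using rs by (auto simp: P_def positive_roots_def root_system_def)
  have s: "(\<Sum>i=1..n. (if i = j then 1 else 0) *\<^sub>R \<alpha> i) = \<alpha> j"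
    using j by (simp add: if_distrib[of "\<lambda>x. x *\<^sub>R _"] cong: if_cong)
  have aP: "\<alpha> j \<in> P"
    unfolding P_def positive_roots_def using a\<Phi> s
    by (auto intro!: exI[of _ "\<lambda>i. if i = j then 1 else 0"] simp: if_distrib[of of_nat] cong: if_cong)
  have rem: "(\<Sum>b\<in>P - {\<alpha> j}. reflect (\<alpha> j) b) = (\<Sum>b\<in>P - {\<alpha> j}. b)"
    by (rule sum.reindex_bij_witness[of _ "reflect (\<alpha> j)" "reflect (\<alpha> j)"])
       (use reflect_positive[OF rs sr j] reflect_reflect[OF a0] in \<open>auto simp: P_def\<close>)
  have "reflect (\<alpha> j) S = reflect (\<alpha> j) (\<alpha> j) + (\<Sum>b\<in>P - {\<alpha> j}. reflect (\<alpha> j) b)"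
    unfolding S_def reflect_sum by (rule sum.remove[OF fin aP])
  also have "\<dots> = S - 2 *\<^sub>R \<alpha> j"
    unfolding rem reflect_self[OF a0] S_def sum.remove[OF fin aP] by (simp add: scaleR_2)
  finally have "(2 * inner S (\<alpha> j) / inner (\<alpha> j) (\<alpha> j)) *\<^sub>R \<alpha> j = 2 *\<^sub>R \<alpha> j"
    by (simp add: reflect_def)
  then have "2 * inner S (\<alpha> j) / inner (\<alpha> j) (\<alpha> j) = 2" using a0 by simp
  moreover have "2 * inner S (\<alpha> j) / inner (\<alpha> j) (\<alpha> j) = (\<Sum>i=1..n. r i * cartan_entry \<alpha> i j)"
    unfolding S_def P_def r
    by (simp add: inner_sum_left cartan_entry_def sum_distrib_left sum_divide_distrib mult_ac)
  ultimately show ?thesis by simp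
qed

section \<open>The inverse Cartan matrix\<close>

lemma mat_trace_kronecker:
  fixes A B :: "'a::semiring_0 mat"
  assumes A: "A \<in> carrier_mat p p" and B: "B \<in> carrier_mat q q"
  shows "mat_trace (kronecker A B) = mat_trace A * mat_trace B"
proof (cases "q = 0")
  case False
  then have q: "q > 0" by simp
  have "mat_trace (kronecker A B) = (\<Sum>i<p * q. A $$ (i div q, i div q) * B $$ (i mod q, i mod q))"
    using A B by (simp add: mat_trace_def kronecker_def)
  also have "\<dots> = (\<Sum>(a, b)\<in>{..<p} \<times> {..<q}. A $$ (a, a) * B $$ (b, b))"
  proof (rule sum.reindex_bij_witness[of _ "\<lambda>(a, b). a * q + b" "\<lambda>i. (i div q, i mod q)"])
    fix x assume "x \<in> {..<p} \<times> {..<q}"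
    then obtain a b where x: "x = (a, b)" "a < p" "b < q" by auto
    have "a * q + b < Suc a * q" using x by simp
    also have "\<dots> \<le> p * q" using x by (intro mult_right_mono) auto
    finally show "(case x of (a, b) \<Rightarrow> a * q + b) \<in> {..<p * q}" by (simp add: x)
  qed (use q in \<open>auto simp: less_mult_imp_div_less\<close>)
  also have "\<dots> = mat_trace A * mat_trace B"
    using A B by (simp add: mat_trace_def sum_product sum.cartesian_product)
  finally show ?thesis .
qed (use A B in \<open>simp add: mat_trace_def kronecker_def\<close>)

lemma rep_char_tensor:
  assumes "\<rho> g \<in> carrier_mat p p" "\<sigma> g \<in> carrier_mat q q"
  shows "rep_char (tensor_rep \<rho> \<sigma>) g = rep_char \<rho> g * rep_char \<sigma> g"
  unfolding rep_char_trace tensor_rep_def by (rule mat_trace_kronecker[OF assms])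

locale mckay = finite_matrix_group \<Gamma> for \<Gamma> :: "complex mat monoid" (structure) +
  fixes n :: nat and \<rho> :: "nat \<Rightarrow> complex mat \<Rightarrow> complex mat"
    and C :: "nat \<Rightarrow> complex mat set" and gr :: "nat \<Rightarrow> complex mat"
  assumes SU2: "carrier \<Gamma> \<subseteq> carrier SU2"
    and ci: "complete_irreps \<Gamma> n \<rho>"
    and C: "bij_betw C {0..n} (conj_classes \<Gamma>)"
    and gr: "\<And>k. k \<le> n \<Longrightarrow> gr k \<in> C k"
begin

abbreviation \<chi> where "\<chi> i \<equiv> rep_char (\<rho> i)"
abbreviation dm :: "nat \<Rightarrow> complex" where "dm i \<equiv> of_nat (rep_dim \<Gamma> (\<rho> i))"
definition N :: complex where "N = of_nat (card (carrier \<Gamma>))"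
definition delta :: "complex mat \<Rightarrow> complex" where "delta g = det (1\<^sub>m 2 - g)"

lemma N_nonzero: "N \<noteq> 0" using card_pos by (simp add: N_def)

lemma dm_nonzero: "i \<le> n \<Longrightarrow> dm i \<noteq> 0" using complete_irrepsD(3)[OF ci] by fastforce

lemma chi_conj: "i \<le> n \<Longrightarrow> x \<in> carrier \<Gamma> \<Longrightarrow> h \<in> carrier \<Gamma> \<Longrightarrow> \<chi> i (x \<otimes> h \<otimes> inv x) = \<chi> i h"
  by (rule rep_char_conj[OF complete_irrepsD(2)[OF ci]])

lemma chi_one: "i \<le> n \<Longrightarrow> \<chi> i \<one> = dm i"
  by (rule rep_char_one[OF complete_irrepsD(2)[OF ci]])

lemma chi_0: "g \<in> carrier \<Gamma> \<Longrightarrow> \<chi> 0 g = 1"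
  using ci by (simp add: complete_irreps_def rep_char_def)

lemma dm_0: "dm 0 = 1" using chi_one[of 0] chi_0[OF one_closed] by simp

lemma tensor_inner:
  assumes "\<And>g. g \<in> carrier \<Gamma> \<Longrightarrow> \<sigma> g \<in> carrier_mat p p" "i \<le> n"
  shows "rep_inner \<Gamma> (tensor_rep \<sigma> (\<rho> i)) (\<rho> j) =
    (\<Sum>g\<in>carrier \<Gamma>. rep_char \<sigma> g * \<chi> i g * cnj (\<chi> j g)) / N"
proof -
  have "rep_char (tensor_rep \<sigma> (\<rho> i)) g = rep_char \<sigma> g * \<chi> i g" if "g \<in> carrier \<Gamma>" for g
    by (rule rep_char_tensor[of \<sigma> g p "\<rho> i", OF assms(1)[OF that] rep_carrier[OF complete_irrepsD(2)[OF ci assms(2)] that]])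
  then show ?thesis by (simp add: rep_inner_def N_def)
qed

lemma fusion:
  assumes i: "i \<le> n" and k: "k \<le> n"
  shows "rep_inner \<Gamma> (tensor_rep (\<rho> i) (\<rho> k)) (\<rho> j) = (\<Sum>g\<in>carrier \<Gamma>. \<chi> i g * \<chi> k g * cnj (\<chi> j g)) / N"
  by (rule tensor_inner[OF rep_carrier[OF complete_irrepsD(2)[OF ci i]] k])

text \<open>
  The character expansion of the class function \<open>cnj \<chi>\<^sub>i \<chi>\<^sub>j\<close>, conjugated. It turns the quantities
  that are defined through the multiplicities \<open>(R\<^sub>i \<otimes> R\<^sub>k, R\<^sub>j)\<close> into sums over the group.
\<close>
lemma fusion_cnj:
  assumes i: "i \<le> n" and j: "j \<le> n" and y: "y \<in> carrier \<Gamma>"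
  shows "(\<Sum>k=0..n. rep_inner \<Gamma> (tensor_rep (\<rho> i) (\<rho> k)) (\<rho> j) * cnj (\<chi> k y)) = \<chi> i y * cnj (\<chi> j y)"
proof -
  define f where "f h = cnj (\<chi> i h) * \<chi> j h" for h
  have "(\<Sum>k\<le>n. (\<Sum>h\<in>carrier \<Gamma>. f h * cnj (\<chi> k h)) / of_nat (card (carrier \<Gamma>)) * \<chi> k y) = f y"
    by (rule class_function_expansion[OF ci C gr _ y]) (use i j in \<open>auto simp: f_def chi_conj\<close>)
  then have "cnj (\<Sum>k\<le>n. (\<Sum>h\<in>carrier \<Gamma>. f h * cnj (\<chi> k h)) / of_nat (card (carrier \<Gamma>)) * \<chi> k y) = cnj (f y)"
    by (rule arg_cong)
  moreover have "(\<Sum>k=0..n. rep_inner \<Gamma> (tensor_rep (\<rho> i) (\<rho> k)) (\<rho> j) * cnj (\<chi> k y)) =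
      cnj (\<Sum>k\<le>n. (\<Sum>h\<in>carrier \<Gamma>. f h * cnj (\<chi> k h)) / of_nat (card (carrier \<Gamma>)) * \<chi> k y)"
    unfolding cnj_sum atMost_atLeast0
    by (intro sum.cong refl) (simp add: fusion[OF i] f_def N_def mult_ac)
  ultimately show ?thesis by (simp add: f_def)
qed

lemma group_elem:
  assumes "g \<in> carrier \<Gamma>"
  shows "g \<in> carrier_mat 2 2" "cnj (mat_trace g) = mat_trace g" "delta g = 2 - mat_trace g"
    "delta g = 0 \<longleftrightarrow> g = \<one>" "det g = 1"
  using SU2_trace[of g] assms SU2 by (auto simp: delta_def one_eq)

definition inv_cartan :: "nat \<Rightarrow> nat \<Rightarrow> complex" where
  "inv_cartan i j = (\<Sum>g\<in>carrier \<Gamma> - {\<one>}. (\<chi> i g - dm i) * (cnj (\<chi> j g) - dm j) / delta g) / N"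

lemma cg_def_rep:
  assumes l: "l \<le> n"
  shows "clebsch_gordan \<Gamma> \<rho> (\<lambda>x. x) l j = (\<Sum>g\<in>carrier \<Gamma>. mat_trace g * \<chi> l g * cnj (\<chi> j g)) / N"
  unfolding clebsch_gordan_def
  by (subst tensor_inner[OF _ l, where p = 2]) (auto simp: group_elem(1) rep_char_trace)

lemma trace_conj:
  assumes "x \<in> carrier \<Gamma>" "h \<in> carrier \<Gamma>"
  shows "mat_trace (x \<otimes> h \<otimes> inv x) = mat_trace h"
proof -
  have x: "x \<in> carrier_mat 2 2" "h \<in> carrier_mat 2 2" "inv x \<in> carrier_mat 2 2"
    using assms group_elem(1) by auto
  have "mat_trace (x \<otimes> h \<otimes> inv x) = mat_trace (inv x * (x * h))"
    unfolding mult_eq by (rule mat_trace_comm[of _ 2 2]) (use x in auto)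
  also have "inv x * (x * h) = inv x \<otimes> (x \<otimes> h)" by (simp add: mult_eq)
  also have "\<dots> = h" using assms by (simp add: m_assoc[symmetric])
  finally show ?thesis .
qed

lemma delta_conj:
  "x \<in> carrier \<Gamma> \<Longrightarrow> h \<in> carrier \<Gamma> \<Longrightarrow> delta (x \<otimes> h \<otimes> inv x) = delta h"
  using group_elem(3) by (simp add: trace_conj)

lemma cg_expansion:
  assumes l: "l \<le> n" and y: "y \<in> carrier \<Gamma>"
  shows "(\<Sum>j=0..n. clebsch_gordan \<Gamma> \<rho> (\<lambda>x. x) l j * \<chi> j y) = mat_trace y * \<chi> l y"
proof -
  have "(\<Sum>k\<le>n. (\<Sum>h\<in>carrier \<Gamma>. (mat_trace h * \<chi> l h) * cnj (\<chi> k h)) / of_nat (card (carrier \<Gamma>)) * \<chi> k y)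
    = mat_trace y * \<chi> l y"
    by (rule class_function_expansion[OF ci C gr _ y]) (use l in \<open>auto simp: chi_conj trace_conj\<close>)
  then show ?thesis by (simp add: cg_def_rep[OF l] N_def atMost_atLeast0)
qed

text \<open>
  The real multiplicities make the row of the Cartan matrix act on conjugated characters as it acts
  on characters, where it is multiplication by \<open>2 - tr g = det(E - g)\<close>. The denominators cancel,
  and \<open>(\<chi>\<^sub>i - d\<^sub>i \<chi>\<^sub>0, \<chi>\<^sub>l)\<close> remains.
\<close>
theorem inv_cartan_inverse:
  assumes i: "i \<in> {1..n}" and l: "l \<in> {1..n}"
    and real: "\<And>j. j \<in> {1..n} \<Longrightarrow> cnj (clebsch_gordan \<Gamma> \<rho> (\<lambda>x. x) l j) = clebsch_gordan \<Gamma> \<rho> (\<lambda>x. x) l j"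
  shows "(\<Sum>j=1..n. (2 * (if l = j then 1 else 0) - clebsch_gordan \<Gamma> \<rho> (\<lambda>x. x) l j) * inv_cartan i j) =
    (if i = l then 1 else 0)"
proof -
  define c where "c j = clebsch_gordan \<Gamma> \<rho> (\<lambda>x. x) l j" for j
  have il: "i \<le> n" "l \<le> n" using i l by auto
  have col: "(\<Sum>j=1..n. (2 * (if l = j then 1 else 0) - c j) * (cnj (\<chi> j g) - dm j)) = delta g * cnj (\<chi> l g)"
    if g: "g \<in> carrier \<Gamma>" for g
  proof -
    have "(\<Sum>j=1..n. c j * (cnj (\<chi> j g) - dm j)) = cnj (\<Sum>j=1..n. c j * (\<chi> j g - dm j))"
      unfolding cnj_sum using real by (intro sum.cong refl) (simp add: c_def)
    \<comment> \<open>The trivial representation contributes \<open>c 0 * (1 - 1)\<close>.\<close>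
    also have "(\<Sum>j=1..n. c j * (\<chi> j g - dm j)) = (\<Sum>j=0..n. c j * (\<chi> j g - dm j))"
      using chi_0[OF g] dm_0 by (simp add: sum.atLeast_Suc_atMost[of 0 n])
    also have "\<dots> = (\<Sum>j=0..n. c j * \<chi> j g) - (\<Sum>j=0..n. c j * \<chi> j \<one>)"
      unfolding sum_subtractf[symmetric] by (intro sum.cong refl) (simp add: chi_one algebra_simps)
    also have "\<dots> = mat_trace g * \<chi> l g - 2 * dm l"
      unfolding c_def cg_expansion[OF il(2) g] cg_expansion[OF il(2) one_closed] chi_one[OF il(2)]
      by (simp add: one_eq mat_trace_def)
    finally have 1: "(\<Sum>j=1..n. c j * (cnj (\<chi> j g) - dm j)) = mat_trace g * cnj (\<chi> l g) - 2 * dm l"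
      by (simp add: group_elem(2)[OF g])
    have "(\<Sum>j=1..n. 2 * (if l = j then 1 else 0) * (cnj (\<chi> j g) - dm j)) =
        (\<Sum>j=1..n. if l = j then 2 * (cnj (\<chi> j g) - dm j) else 0)"
      by (intro sum.cong refl) auto
    also have "\<dots> = 2 * (cnj (\<chi> l g) - dm l)" using l by simp
    finally show ?thesis
      by (simp only: left_diff_distrib sum_subtractf 1 group_elem(3)[OF g]) (simp add: algebra_simps)
  qed
  have "(\<Sum>j=1..n. (2 * (if l = j then 1 else 0) - c j) * inv_cartan i j) =
      (\<Sum>j=1..n. \<Sum>g\<in>carrier \<Gamma> - {\<one>}. (2 * (if l = j then 1 else 0) - c j) * ((\<chi> i g - dm i) * (cnj (\<chi> j g) - dm j) / delta g / N))"
    unfolding inv_cartan_def by (simp only: sum_distrib_left sum_divide_distrib)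
  also have "\<dots> = (\<Sum>g\<in>carrier \<Gamma> - {\<one>}. \<Sum>j=1..n. (2 * (if l = j then 1 else 0) - c j) * ((\<chi> i g - dm i) * (cnj (\<chi> j g) - dm j) / delta g / N))"
    by (rule sum.swap)
  also have "\<dots> = (\<Sum>g\<in>carrier \<Gamma> - {\<one>}. (\<chi> i g - dm i) * cnj (\<chi> l g) / N)"
  proof (intro sum.cong refl)
    fix g assume g: "g \<in> carrier \<Gamma> - {\<one>}"
    then have gc: "g \<in> carrier \<Gamma>" and nz: "delta g \<noteq> 0" using group_elem(4)[of g] by auto
    have "(\<Sum>j=1..n. (2 * (if l = j then 1 else 0) - c j) * ((\<chi> i g - dm i) * (cnj (\<chi> j g) - dm j) / delta g / N)) =
      (\<Sum>j=1..n. (2 * (if l = j then 1 else 0) - c j) * (cnj (\<chi> j g) - dm j)) * ((\<chi> i g - dm i) / delta g / N)"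
      unfolding sum_distrib_right by (intro sum.cong refl) (simp only: times_divide_eq_left times_divide_eq_right mult_ac)
    also have "\<dots> = (\<chi> i g - dm i) * cnj (\<chi> l g) / N" unfolding col[OF gc] using nz by simp
    finally show "(\<Sum>j=1..n. (2 * (if l = j then 1 else 0) - c j) * ((\<chi> i g - dm i) * (cnj (\<chi> j g) - dm j) / delta g / N)) =
      (\<chi> i g - dm i) * cnj (\<chi> l g) / N" .
  qed
  also have "\<dots> = (\<Sum>g\<in>carrier \<Gamma>. (\<chi> i g - dm i) * cnj (\<chi> l g) / N)"
    by (rule sum.mono_neutral_left) (use fin chi_one[OF il(1)] in auto)
  also have "\<dots> = ((\<Sum>g\<in>carrier \<Gamma>. \<chi> i g * cnj (\<chi> l g)) - dm i * (\<Sum>g\<in>carrier \<Gamma>. \<chi> 0 g * cnj (\<chi> l g))) / N"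
    unfolding sum_divide_distrib[symmetric] sum_distrib_left sum_subtractf[symmetric]
    by (intro arg_cong[of _ _ "\<lambda>x. x / N"] sum.cong refl) (simp add: chi_0 algebra_simps)
  also have "\<dots> = (if i = l then 1 else 0)"
    using l N_nonzero by (simp add: char_row_orthogonality[OF ci _ il(2)] il N_def)
  finally show ?thesis by (simp add: c_def)
qed

end

section \<open>The four formulas\<close>

lemma fps_const_sum: "fps_const (\<Sum>x\<in>A. f x) = (\<Sum>x\<in>A. fps_const (f x))"
  by (induction A rule: infinite_finite_induct) (simp_all flip: fps_const_add)

context mckay
begin

abbreviation M where "M \<equiv> cg_sym_series \<Gamma> \<rho>"

definition molien :: "complex mat \<Rightarrow> complex fps" where
  "molien g = Abs_fps (\<lambda>m. mat_trace (sym_power m g))"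

lemma M_eq:
  assumes i: "i \<le> n"
  shows "M i j = (\<Sum>g\<in>carrier \<Gamma>. fps_const (\<chi> i g * cnj (\<chi> j g) / N) * molien g)"
proof (rule fps_ext)
  fix m
  have "fps_nth (M i j) m = (\<Sum>g\<in>carrier \<Gamma>. rep_char (sym_power m) g * \<chi> i g * cnj (\<chi> j g)) / N"
    unfolding cg_sym_series_def clebsch_gordan_def
    using tensor_inner[OF _ i, of "sym_power m" "Suc m"] by simp
  then show "fps_nth (M i j) m = fps_nth (\<Sum>g\<in>carrier \<Gamma>. fps_const (\<chi> i g * cnj (\<chi> j g) / N) * molien g) m"
    by (simp add: fps_sum_nth molien_def rep_char_trace sum_divide_distrib mult_ac)
qed

lemma value_molien:
  assumes "g \<in> carrier \<Gamma>" "g \<noteq> \<one>"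
  shows "value_at_one (molien g) (1 / delta g)"
proof (rule value_at_oneI)
  show "molien g * fps_of_poly [:1, - mat_trace g, det g:] = fps_of_poly 1"
    unfolding molien_def using molien_series[OF group_elem(1)[OF assms(1)]] by simp
  have d: "poly [:1, - mat_trace g, det g:] 1 = delta g"
    using group_elem(3,5)[OF assms(1)] by simp
  show "poly [:1, - mat_trace g, det g:] 1 \<noteq> 0"
    unfolding d using group_elem(4) assms by blast
  show "1 / delta g = poly 1 1 / poly [:1, - mat_trace g, det g:] 1"
    unfolding d by simp
qed

lemma molien_one: "molien \<one> * (1 - fps_X) ^ 2 = 1"
proof -
  have e: "fps_of_poly [:1, - mat_trace \<one>, det \<one>:] = (1 - fps_X) ^ 2"
    using group_elem(5)[OF one_closed]
    by (simp add: one_eq mat_trace_def fps_of_poly_pCons power2_eq_square algebra_simps)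
  show ?thesis
    unfolding molien_def e[symmetric] by (rule molien_series[OF group_elem(1)[OF one_closed]])
qed

definition M_reduced :: "nat \<Rightarrow> nat \<Rightarrow> complex fps" where
  "M_reduced i j = M 0 0 - fps_const (1 / dm i) * M i 0 - fps_const (1 / dm j) * M 0 j
     + fps_const (1 / (dm i * dm j)) * M i j"

text \<open>
  By Molien's formula the reduced series is a combination of \<open>1 / det(E - q g)\<close> with coefficients
  proportional to \<open>(\<chi>\<^sub>i(g) - d\<^sub>i) (cnj \<chi>\<^sub>j(g) - d\<^sub>j)\<close>. These vanish at \<open>g = 1\<close>, and only this term has a
  pole at \<open>q = 1\<close>.
\<close>
theorem value_M_reduced:
  assumes i: "i \<le> n" and j: "j \<le> n"
  shows "value_at_one (M_reduced i j) (inv_cartan i j / (dm i * dm j))"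
proof -
  define w where "w g = (\<chi> i g - dm i) * (cnj (\<chi> j g) - dm j) / N / (dm i * dm j)" for g
  have nz: "dm i \<noteq> 0" "dm j \<noteq> 0" using dm_nonzero i j by auto
  have "M_reduced i j = (\<Sum>g\<in>carrier \<Gamma>. fps_const (\<chi> 0 g * cnj (\<chi> 0 g) / N) * molien g
      - fps_const (1 / dm i) * (fps_const (\<chi> i g * cnj (\<chi> 0 g) / N) * molien g)
      - fps_const (1 / dm j) * (fps_const (\<chi> 0 g * cnj (\<chi> j g) / N) * molien g)
      + fps_const (1 / (dm i * dm j)) * (fps_const (\<chi> i g * cnj (\<chi> j g) / N) * molien g))"
    unfolding M_reduced_def M_eq[OF i] M_eq[OF le0]
    by (simp only: sum_distrib_left sum_subtractf sum.distrib)
  also have "\<dots> = (\<Sum>g\<in>carrier \<Gamma>. fps_const (w g) * molien g)"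
  proof (intro sum.cong refl)
    fix g assume g: "g \<in> carrier \<Gamma>"
    have "w g = \<chi> 0 g * cnj (\<chi> 0 g) / N - 1 / dm i * (\<chi> i g * cnj (\<chi> 0 g) / N)
      - 1 / dm j * (\<chi> 0 g * cnj (\<chi> j g) / N) + 1 / (dm i * dm j) * (\<chi> i g * cnj (\<chi> j g) / N)"
      using nz N_nonzero by (simp add: w_def chi_0[OF g] field_simps)
    then have "fps_const (w g) = fps_const (\<chi> 0 g * cnj (\<chi> 0 g) / N) - fps_const (1 / dm i) * fps_const (\<chi> i g * cnj (\<chi> 0 g) / N)
      - fps_const (1 / dm j) * fps_const (\<chi> 0 g * cnj (\<chi> j g) / N) + fps_const (1 / (dm i * dm j)) * fps_const (\<chi> i g * cnj (\<chi> j g) / N)"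
      by (simp only: fps_const_mult fps_const_sub fps_const_add)
    then show "fps_const (\<chi> 0 g * cnj (\<chi> 0 g) / N) * molien g
      - fps_const (1 / dm i) * (fps_const (\<chi> i g * cnj (\<chi> 0 g) / N) * molien g)
      - fps_const (1 / dm j) * (fps_const (\<chi> 0 g * cnj (\<chi> j g) / N) * molien g)
      + fps_const (1 / (dm i * dm j)) * (fps_const (\<chi> i g * cnj (\<chi> j g) / N) * molien g) = fps_const (w g) * molien g"
      by (simp only: left_diff_distrib distrib_right mult.assoc)
  qed
  also have "\<dots> = (\<Sum>g\<in>carrier \<Gamma> - {\<one>}. fps_const (w g) * molien g)"
    by (rule sum.mono_neutral_right) (use fin chi_one[OF i] in \<open>auto simp: w_def\<close>)
  finally have e: "M_reduced i j = (\<Sum>g\<in>carrier \<Gamma> - {\<one>}. fps_const (w g) * molien g)" .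
  have e': "inv_cartan i j / (dm i * dm j) = (\<Sum>g\<in>carrier \<Gamma> - {\<one>}. w g * (1 / delta g))"
    unfolding inv_cartan_def sum_divide_distrib by (intro sum.cong refl) (simp add: w_def)
  show ?thesis
    unfolding e e' by (intro value_at_one_sum value_at_one_const_mult value_molien) (use fin in auto)
qed

text \<open>
  The identity class drops out on the left because \<open>delta \<one> = 0\<close> and division by zero yields zero.
\<close>
lemma class_sum:
  fixes f :: "complex mat \<Rightarrow> complex"
  assumes f: "\<And>x h. x \<in> carrier \<Gamma> \<Longrightarrow> h \<in> carrier \<Gamma> \<Longrightarrow> f (x \<otimes> h \<otimes> inv x) = f h"
  shows "(\<Sum>k\<le>n. of_nat (card (C k)) * (f (gr k) / delta (gr k))) = (\<Sum>g\<in>carrier \<Gamma> - {\<one>}. f g / delta g)"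
proof -
  have "(\<Sum>k\<le>n. of_nat (card (C k)) * (f (gr k) / delta (gr k))) = (\<Sum>g\<in>carrier \<Gamma>. f g / delta g)"
    by (rule sum_over_classes[OF C gr, symmetric]) (auto simp: f delta_conj)
  also have "\<dots> = (\<Sum>g\<in>carrier \<Gamma> - {\<one>}. f g / delta g)"
    by (rule sum.mono_neutral_right) (use fin group_elem(4)[OF one_closed] in auto)
  finally show ?thesis .
qed

theorem character_formula:
  assumes i: "i \<le> n" and j: "j \<le> n" and g0: "gr 0 = \<one>"
  shows "(\<Sum>k=1..n. of_nat (card (C k)) * (\<chi> i (gr k) - dm i) * (cnj (\<chi> j (gr k)) - dm j)
            / det (1\<^sub>m 2 - gr k)) = N * inv_cartan i j"
proof -
  define f where "f h = (\<chi> i h - dm i) * (cnj (\<chi> j h) - dm j)" for h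
  have "(\<Sum>k=1..n. of_nat (card (C k)) * (\<chi> i (gr k) - dm i) * (cnj (\<chi> j (gr k)) - dm j)
            / det (1\<^sub>m 2 - gr k)) = (\<Sum>k=1..n. of_nat (card (C k)) * (f (gr k) / delta (gr k)))"
    by (simp add: f_def delta_def mult.assoc)
  also have "\<dots> = (\<Sum>k\<le>n. of_nat (card (C k)) * (f (gr k) / delta (gr k)))"
    by (simp add: atMost_atLeast0 sum.atLeast_Suc_atMost[of 0 n] g0 f_def chi_one[OF i])
  also have "\<dots> = (\<Sum>g\<in>carrier \<Gamma> - {\<one>}. f g / delta g)"
    by (rule class_sum) (use i j in \<open>simp add: f_def chi_conj\<close>)
  also have "\<dots> = N * inv_cartan i j" using N_nonzero by (simp add: inv_cartan_def f_def)
  finally show ?thesis .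
qed

lemma eta0_eq:
  assumes j: "j \<le> n"
  shows "eta0 2 \<Gamma> n \<rho> C gr j = 2 / N * (\<Sum>g\<in>carrier \<Gamma> - {\<one>}. cnj (\<chi> j g) / delta g)"
proof -
  \<comment> \<open>The excluded terms are zero anyway, because division by zero yields zero.\<close>
  have "(\<Sum>k | k \<le> n \<and> det (1\<^sub>m 2 - gr k) \<noteq> 0.
        of_nat (card (C k)) * cnj (\<chi> j (gr k)) / det (1\<^sub>m 2 - gr k)) =
      (\<Sum>k\<le>n. of_nat (card (C k)) * (cnj (\<chi> j (gr k)) / delta (gr k)))"
    by (rule sum.mono_neutral_cong_left) (auto simp: delta_def)
  also have "\<dots> = (\<Sum>g\<in>carrier \<Gamma> - {\<one>}. cnj (\<chi> j g) / delta g)"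
    by (rule class_sum) (use j in \<open>simp add: chi_conj\<close>)
  finally show ?thesis by (simp add: eta0_def N_def)
qed

lemma eta_eq:
  assumes i: "i \<le> n" and j: "j \<le> n"
  shows "eta 2 \<Gamma> n \<rho> C gr i j = 2 / N * (\<Sum>g\<in>carrier \<Gamma> - {\<one>}. \<chi> i g * cnj (\<chi> j g) / delta g)"
proof -
  define c where "c k = rep_inner \<Gamma> (tensor_rep (\<rho> i) (\<rho> k)) (\<rho> j)" for k
  have "eta 2 \<Gamma> n \<rho> C gr i j = (\<Sum>k=0..n. \<Sum>g\<in>carrier \<Gamma> - {\<one>}. 2 / N * (c k * cnj (\<chi> k g) / delta g))"
    unfolding eta_def c_def[symmetric] by (intro sum.cong refl) (simp add: eta0_eq sum_distrib_left mult_ac)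
  also have "\<dots> = (\<Sum>g\<in>carrier \<Gamma> - {\<one>}. \<Sum>k=0..n. 2 / N * (c k * cnj (\<chi> k g) / delta g))"
    by (rule sum.swap)
  also have "\<dots> = (\<Sum>g\<in>carrier \<Gamma> - {\<one>}. 2 / N * ((\<Sum>k=0..n. c k * cnj (\<chi> k g)) / delta g))"
    by (simp only: sum_distrib_left sum_divide_distrib)
  also have "\<dots> = (\<Sum>g\<in>carrier \<Gamma> - {\<one>}. 2 / N * (\<chi> i g * cnj (\<chi> j g) / delta g))"
    unfolding c_def by (intro sum.cong refl) (simp only: fusion_cnj[OF i j] Diff_iff)
  finally show ?thesis by (simp only: sum_distrib_left)
qed

theorem eta_formula:
  assumes i: "i \<le> n" and j: "j \<le> n"
  defines "\<eta> \<equiv> eta 2 \<Gamma> n \<rho> C gr"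
  shows "dm i * dm j * (\<eta> 0 0 - \<eta> i 0 / dm i - \<eta> 0 j / dm j + \<eta> i j / (dm i * dm j)) = 2 * inv_cartan i j"
proof -
  have alg: "x * y * (k * a - k * b / x - k * c / y + k * d / (x * y)) = k * (x * y * a - y * b - x * c + d)"
    if "x \<noteq> 0" "y \<noteq> 0" for x y k a b c d :: complex
    using that by (simp add: field_simps)
  define W where "W a b = (\<Sum>g\<in>carrier \<Gamma> - {\<one>}. \<chi> a g * cnj (\<chi> b g) / delta g)" for a b
  have nz: "dm i \<noteq> 0" "dm j \<noteq> 0" using dm_nonzero i j by auto
  have \<eta>: "\<eta> a b = 2 / N * W a b" if "a \<le> n" "b \<le> n" for a b
    unfolding \<eta>_def W_def by (rule eta_eq[OF that])
  have "dm i * dm j * W 0 0 - dm j * W i 0 - dm i * W 0 j + W i j =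
      (\<Sum>g\<in>carrier \<Gamma> - {\<one>}. (\<chi> i g - dm i) * (cnj (\<chi> j g) - dm j) / delta g)"
    unfolding W_def sum_distrib_left sum_subtractf[symmetric] sum.distrib[symmetric]
    by (intro sum.cong refl) (simp add: chi_0 diff_divide_distrib add_divide_distrib algebra_simps)
  also have "\<dots> = N * inv_cartan i j" using N_nonzero by (simp add: inv_cartan_def)
  finally have e: "dm i * dm j * W 0 0 - dm j * W i 0 - dm i * W 0 j + W i j = N * inv_cartan i j" .
  have "dm i * dm j * (\<eta> 0 0 - \<eta> i 0 / dm i - \<eta> 0 j / dm j + \<eta> i j / (dm i * dm j)) =
      2 / N * (dm i * dm j * W 0 0 - dm j * W i 0 - dm i * W 0 j + W i j)"
    unfolding \<eta>[OF le0 le0] \<eta>[OF i le0] \<eta>[OF le0 j] \<eta>[OF i j] by (rule alg[OF nz])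
  then show ?thesis using N_nonzero by (simp add: e)
qed

theorem residue_formula:
  assumes i: "i \<le> n" and j: "j \<le> n"
  shows "dm i * dm j * res_one (M_reduced i j / (1 - fps_X)) = inv_cartan i j"
  using res_one_simple_pole[OF value_M_reduced[OF i j]] dm_nonzero i j by simp

context
  fixes \<theta>1 \<theta>2 :: sym_alg and n1 n2 :: nat and \<mu> :: "nat \<Rightarrow> nat" and m :: "nat \<Rightarrow> nat \<Rightarrow> nat"
    and B :: "nat \<Rightarrow> nat \<Rightarrow> sym_alg vec"
  assumes hs: "hsop (carrier \<Gamma>) \<theta>1 n1 \<theta>2 n2"
    and cb: "\<And>j. j \<le> n \<Longrightarrow> covariant_basis \<Gamma> (\<rho> j) \<theta>1 \<theta>2 (\<mu> j) (\<lambda>k. m k j) (\<lambda>k. B k j)"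
begin

abbreviation D where "D \<equiv> covariant_poly \<Gamma> n \<rho> \<mu> m"

text \<open>
  The formula \<open>M[R\<^sub>S(q)]\<^sup>0\<^sub>k = D[R]\<^sup>0\<^sub>k / ((1 - q^n1) (1 - q^n2))\<close>: the coefficients of the left-hand side
  are the dimensions of the spaces of covariants of each degree.
\<close>
lemma covariant_series:
  assumes k: "k \<le> n"
  shows "fps_of_poly (\<Sum>l=1..\<mu> k. monom 1 (m l k)) = (1 - fps_X ^ n1) * (1 - fps_X ^ n2) * M 0 k"
proof -
  have n: "n1 > 0" "n2 > 0" using hs by (auto simp: hsop_def)
  have "M 0 k = Abs_fps (\<lambda>e. of_nat (card (basis_indices n1 n2 (\<mu> k) (\<lambda>l. m l k) e)))"
  proof (rule fps_ext)
    fix e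
    have "fps_nth (M 0 k) e = (\<Sum>g\<in>carrier \<Gamma>. mat_trace (sym_power e g) * \<chi> k (inv g)) / N"
      unfolding M_eq[OF le0] fps_sum_nth sum_divide_distrib
      by (intro sum.cong refl) (simp add: chi_0 molien_def rep_char_inv[OF complete_irrepsD(2)[OF ci k]])
    then show "fps_nth (M 0 k) e = fps_nth (Abs_fps (\<lambda>e. of_nat (card (basis_indices n1 n2 (\<mu> k) (\<lambda>l. m l k) e)))) e"
      using covariant_dimension[OF complete_irrepsD(2)[OF ci k] hs cb[OF k], of e] by (simp add: N_def)
  qed
  then show ?thesis using basis_series[OF n, of "\<mu> k" "\<lambda>l. m l k"] by (simp add: mult_ac)
qed

lemma covariant_poly_series:
  assumes i: "i \<le> n" and j: "j \<le> n"
  shows "fps_of_poly (D i j) = (1 - fps_X ^ n1) * (1 - fps_X ^ n2) * M i j"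
proof -
  define c where "c k = rep_inner \<Gamma> (tensor_rep (\<rho> i) (\<rho> k)) (\<rho> j)" for k
  have "(\<Sum>k=0..n. fps_const (c k) * M 0 k) =
      (\<Sum>k=0..n. \<Sum>g\<in>carrier \<Gamma>. fps_const (c k * cnj (\<chi> k g) / N) * molien g)"
    unfolding M_eq[OF le0] sum_distrib_left
    by (intro sum.cong refl) (simp add: chi_0 mult.assoc[symmetric])
  also have "\<dots> = (\<Sum>g\<in>carrier \<Gamma>. \<Sum>k=0..n. fps_const (c k * cnj (\<chi> k g) / N) * molien g)"
    by (rule sum.swap)
  also have "\<dots> = (\<Sum>g\<in>carrier \<Gamma>. fps_const ((\<Sum>k=0..n. c k * cnj (\<chi> k g)) / N) * molien g)"
    by (simp only: sum_distrib_right[symmetric] fps_const_sum sum_divide_distrib)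
  also have "\<dots> = M i j"
    unfolding M_eq[OF i] c_def by (intro sum.cong refl) (simp only: fusion_cnj[OF i j])
  finally have e: "(\<Sum>k=0..n. fps_const (c k) * M 0 k) = M i j" .
  have "fps_of_poly (D i j) = (\<Sum>k=0..n. fps_const (c k) * ((1 - fps_X ^ n1) * (1 - fps_X ^ n2) * M 0 k))"
    unfolding covariant_poly_def c_def[symmetric] fps_of_poly_sum fps_of_poly_smult
    by (intro sum.cong refl) (simp add: covariant_series[symmetric] fps_of_poly_sum)
  also have "\<dots> = (1 - fps_X ^ n1) * (1 - fps_X ^ n2) * (\<Sum>k=0..n. fps_const (c k) * M 0 k)"
    by (simp add: sum_distrib_left mult_ac)
  finally show ?thesis by (simp only: e)
qed

text \<open>
  Comparison of the double poles at \<open>q = 1\<close>: in \<open>M[R\<^sub>S(q)]\<^sup>0\<^sub>0\<close> only \<open>g = 1\<close> contributes, with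
  coefficient \<open>|G|\<^sup>-\<^sup>1\<close>.
\<close>
theorem rank_formula: "of_nat (\<mu> 0) * N = of_nat n1 * of_nat n2"
proof -
  define F where "F = (\<Sum>g\<in>carrier \<Gamma> - {\<one>}. fps_const (1 / N) * molien g)"
  have F: "value_at_one F (\<Sum>g\<in>carrier \<Gamma> - {\<one>}. 1 / N * (1 / delta g))"
    unfolding F_def by (intro value_at_one_sum value_at_one_const_mult value_molien) (use fin in auto)
  have "M 0 0 = fps_const (1 / N) * molien \<one> + F"
    unfolding M_eq[OF le0] F_def sum.remove[OF fin one_closed] by (simp add: chi_0)
  then have "poly (\<Sum>l=1..\<mu> 0. monom 1 (m l 0)) 1 = of_nat n1 * of_nat n2 * (1 / N)"
    using covariant_series[OF le0] by (intro value_double_pole[OF F molien_one]) simp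
  then show ?thesis using N_nonzero by (simp add: poly_sum poly_monom field_simps)
qed

theorem derivative_formula:
  assumes i: "i \<le> n" and j: "j \<le> n"
  shows "dm i * dm j * (poly ((pderiv ^^ 2)
      (D 0 0 - Polynomial.smult (1 / dm i) (D i 0) - Polynomial.smult (1 / dm j) (D 0 j)
        + Polynomial.smult (1 / (dm i * dm j)) (D i j))) 1 / fact 2) = of_nat (\<mu> 0) * N * inv_cartan i j"
proof -
  define E where "E = D 0 0 - Polynomial.smult (1 / dm i) (D i 0) - Polynomial.smult (1 / dm j) (D 0 j)
        + Polynomial.smult (1 / (dm i * dm j)) (D i j)"
  have "fps_of_poly E = (1 - fps_X ^ n1) * (1 - fps_X ^ n2) * M_reduced i j"
    unfolding E_def M_reduced_def
    by (simp only: fps_of_poly_add fps_of_poly_diff fps_of_poly_smult covariant_poly_series i j le0)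
       (simp add: algebra_simps)
  from second_derivative_at_one[OF value_M_reduced[OF i j] this]
  show ?thesis using dm_nonzero i j by (simp add: E_def rank_formula)
qed

end

text \<open>
  The coefficients \<open>r\<close> satisfy \<open>\<Sum>\<^sub>l r\<^sub>l C\<^sub>l\<^sub>j = 2\<close> for the Cartan matrix \<open>C\<close>; multiply by \<open>inv_cartan i j\<close>
  and sum over \<open>j\<close>. The reality that \<open>inv_cartan_inverse\<close> asks for holds because the Cartan integers
  are real.
\<close>
theorem sum_positive_roots_coeff:
  fixes \<alpha> :: "nat \<Rightarrow> 'v::euclidean_space" and r :: "nat \<Rightarrow> real"
  assumes rs: "root_system \<Phi>" and sr: "simple_roots \<Phi> n \<alpha>"
    and cartan: "\<And>i j. i \<in> {1..n} \<Longrightarrow> j \<in> {1..n} \<Longrightarrow>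
           of_real (cartan_entry \<alpha> i j) = 2 * (if i = j then 1 else 0) - clebsch_gordan \<Gamma> \<rho> (\<lambda>x. x) i j"
    and r: "(\<Sum>b\<in>positive_roots \<Phi> n \<alpha>. b) = (\<Sum>i=1..n. r i *\<^sub>R \<alpha> i)"
    and i: "i \<in> {1..n}"
  shows "of_real (r i) = 2 * (\<Sum>j=1..n. inv_cartan i j)"
proof -
  have real: "cnj (clebsch_gordan \<Gamma> \<rho> (\<lambda>x. x) l j) = clebsch_gordan \<Gamma> \<rho> (\<lambda>x. x) l j"
    if "l \<in> {1..n}" "j \<in> {1..n}" for l j
  proof -
    have e: "clebsch_gordan \<Gamma> \<rho> (\<lambda>x. x) l j = of_real (2 * (if l = j then 1 else 0) - cartan_entry \<alpha> l j)"
      using cartan[OF that] by (simp add: algebra_simps)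
    show ?thesis unfolding e by simp
  qed
  have "of_real (r i) = (\<Sum>l=1..n. of_real (r l) * (if i = l then 1 else 0))"
    using i by (simp add: if_distrib[of "\<lambda>x. _ * x"] cong: if_cong)
  also have "\<dots> = (\<Sum>l=1..n. of_real (r l) * (\<Sum>j=1..n. of_real (cartan_entry \<alpha> l j) * inv_cartan i j))"
    by (intro sum.cong refl arg_cong2[of _ _ _ _ "(*)"])
       (simp only: cartan inv_cartan_inverse[OF i _ real, symmetric] cong: sum.cong)
  also have "\<dots> = (\<Sum>l=1..n. \<Sum>j=1..n. of_real (r l * cartan_entry \<alpha> l j) * inv_cartan i j)"
    by (simp add: sum_distrib_left mult.assoc)
  also have "\<dots> = (\<Sum>j=1..n. \<Sum>l=1..n. of_real (r l * cartan_entry \<alpha> l j) * inv_cartan i j)"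
    by (rule sum.swap)
  also have "\<dots> = (\<Sum>j=1..n. of_real (\<Sum>l=1..n. r l * cartan_entry \<alpha> l j) * inv_cartan i j)"
    by (simp only: of_real_sum sum_distrib_right)
  also have "\<dots> = 2 * (\<Sum>j=1..n. inv_cartan i j)"
    unfolding sum_distrib_left by (intro sum.cong refl) (simp only: sum_positive_roots_cartan[OF rs sr r], simp)
  finally show ?thesis .
qed

end

theorem mainTheorem11:
  fixes G :: "complex mat set" and \<Gamma> :: "complex mat monoid"
    and n d n1 n2 :: nat
    and \<rho> :: "nat \<Rightarrow> complex mat \<Rightarrow> complex mat"
    and C :: "nat \<Rightarrow> complex mat set" and g :: "nat \<Rightarrow> complex mat"
    and \<theta>1 \<theta>2 :: sym_alg and \<mu> :: "nat \<Rightarrow> nat" and m :: "nat \<Rightarrow> nat \<Rightarrow> nat"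
    and B :: "nat \<Rightarrow> nat \<Rightarrow> sym_alg vec"
    and \<Phi> :: "'v::euclidean_space set" and \<alpha> :: "nat \<Rightarrow> 'v" and r :: "nat \<Rightarrow> real"
    and N :: complex and dm :: "nat \<Rightarrow> complex" and \<chi> :: "nat \<Rightarrow> complex mat \<Rightarrow> complex"
    and \<eta> :: "nat \<Rightarrow> nat \<Rightarrow> complex" and D :: "nat \<Rightarrow> nat \<Rightarrow> complex poly"
    and M :: "nat \<Rightarrow> nat \<Rightarrow> complex fps"
  defines "\<Gamma> \<equiv> SU2\<lparr>carrier := G\<rparr>"
    and "d \<equiv> 2"
    and "N \<equiv> of_nat (card G)"
    and "dm \<equiv> \<lambda>i. of_nat (rep_dim \<Gamma> (\<rho> i))"
    and "\<chi> \<equiv> \<lambda>i. rep_char (\<rho> i)"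
    and "\<eta> \<equiv> eta d \<Gamma> n \<rho> C g"
    and "D \<equiv> covariant_poly \<Gamma> n \<rho> \<mu> m"
    and "M \<equiv> cg_sym_series \<Gamma> \<rho>"
  assumes "subgroup G SU2" and "finite G" and "G \<noteq> {1\<^sub>m 2}"
    and "complete_irreps \<Gamma> n \<rho>"
    and "bij_betw C {0..n} (conj_classes \<Gamma>)"
    and "\<And>k. k \<le> n \<Longrightarrow> g k \<in> C k" and "g 0 = 1\<^sub>m 2"
    and "hsop G \<theta>1 n1 \<theta>2 n2"
    and "\<And>j. j \<le> n \<Longrightarrow>
           covariant_basis \<Gamma> (\<rho> j) \<theta>1 \<theta>2 (\<mu> j) (\<lambda>k. m k j) (\<lambda>k. B k j)"
    and "irreducible_root_system \<Phi>" and "simple_roots \<Phi> n \<alpha>"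
    and "\<And>i j. i \<in> {1..n} \<Longrightarrow> j \<in> {1..n} \<Longrightarrow>
           of_real (cartan_entry \<alpha> i j) =
             2 * (if i = j then 1 else 0) - clebsch_gordan \<Gamma> \<rho> (\<lambda>x. x) i j"
    and "(\<Sum>b\<in>positive_roots \<Phi> n \<alpha>. b) = (\<Sum>i=1..n. r i *\<^sub>R \<alpha> i)"
  shows "\<forall>i\<in>{1..n}.
     of_real (r i) =
       (-1) ^ d * (\<Sum>j=1..n. dm i * dm j *
          (\<eta> 0 0 - \<eta> i 0 / dm i - \<eta> 0 j / dm j + \<eta> i j / (dm i * dm j))) \<and>
     of_real (r i) =
       2 / (of_nat (\<mu> 0) * N) * (\<Sum>j=1..n. dm i * dm j *
          (poly ((pderiv ^^ d)
             (D 0 0 - Polynomial.smult (1 / dm i) (D i 0) - Polynomial.smult (1 / dm j) (D 0 j)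
              + Polynomial.smult (1 / (dm i * dm j)) (D i j))) 1 / fact d)) \<and>
     of_real (r i) =
       2 * (\<Sum>j=1..n. dm i * dm j * res_one
          ((M 0 0 - fps_const (1 / dm i) * M i 0 - fps_const (1 / dm j) * M 0 j
            + fps_const (1 / (dm i * dm j)) * M i j) / (1 - fps_X))) \<and>
     of_real (r i) =
       2 / N * (\<Sum>j=1..n. \<Sum>k=1..n.
          of_nat (card (C k)) * (\<chi> i (g k) - dm i) * (cnj (\<chi> j (g k)) - dm j)
            / det (1\<^sub>m 2 - g k))"
proof -
  have \<Gamma>: "\<And>x y. x \<otimes>\<^bsub>\<Gamma>\<^esub> y = x * y" "\<one>\<^bsub>\<Gamma>\<^esub> = 1\<^sub>m 2" "carrier \<Gamma> = G"
    by (simp_all add: \<Gamma>_def SU2_def)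
  have G: "G \<subseteq> carrier SU2" using \<open>subgroup G SU2\<close> by (rule subgroup.subset)
  interpret K: group \<Gamma>
    unfolding \<Gamma>_def using \<open>subgroup G SU2\<close> group_SU2 by (rule subgroup.subgroup_is_group)
  interpret K: mckay \<Gamma> n \<rho> C g
    by unfold_locales
       (use \<Gamma> G SU2_trace(1) \<open>finite G\<close> \<open>complete_irreps \<Gamma> n \<rho>\<close> \<open>bij_betw C {0..n} (conj_classes \<Gamma>)\<close>
         \<open>\<And>k. k \<le> n \<Longrightarrow> g k \<in> C k\<close> in auto)
  have N: "N = K.N" by (simp add: N_def K.N_def \<Gamma>)
  have hs: "hsop (carrier \<Gamma>) \<theta>1 n1 \<theta>2 n2" using \<open>hsop G \<theta>1 n1 \<theta>2 n2\<close> by (simp add: \<Gamma>)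
  note cb = \<open>\<And>j. j \<le> n \<Longrightarrow> covariant_basis \<Gamma> (\<rho> j) \<theta>1 \<theta>2 (\<mu> j) (\<lambda>k. m k j) (\<lambda>k. B k j)\<close>
  have n12: "n1 > 0" "n2 > 0" using hs by (auto simp: hsop_def)
  have rank: "of_nat (\<mu> 0) * N = of_nat n1 * of_nat n2"
    unfolding N by (rule K.rank_formula[OF hs cb])
  then have rank0: "of_nat (\<mu> 0) * N \<noteq> 0" using n12 by simp
  show ?thesis
  proof (intro ballI conjI)
    fix i assume i: "i \<in> {1..n}"
    then have i': "i \<le> n" by simp
    have r: "of_real (r i) = 2 * (\<Sum>j=1..n. K.inv_cartan i j)"
      using K.sum_positive_roots_coeff[OF _ \<open>simple_roots \<Phi> n \<alpha>\<close> _ _ i, of r] assms(20,21)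
        \<open>irreducible_root_system \<Phi>\<close> by (auto simp: irreducible_root_system_def)
    show "of_real (r i) = (-1) ^ d * (\<Sum>j=1..n. dm i * dm j *
          (\<eta> 0 0 - \<eta> i 0 / dm i - \<eta> 0 j / dm j + \<eta> i j / (dm i * dm j)))"
      unfolding r sum_distrib_left dm_def \<eta>_def d_def
      by (intro sum.cong refl) (use K.eta_formula[OF i'] in simp)
    show "of_real (r i) = 2 / (of_nat (\<mu> 0) * N) * (\<Sum>j=1..n. dm i * dm j *
          (poly ((pderiv ^^ d)
             (D 0 0 - Polynomial.smult (1 / dm i) (D i 0) - Polynomial.smult (1 / dm j) (D 0 j)
              + Polynomial.smult (1 / (dm i * dm j)) (D i j))) 1 / fact d))"
      unfolding r sum_distrib_left
    proof (intro sum.cong refl)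
      fix j assume "j \<in> {1..n}"
      then have j: "j \<le> n" by simp
      have "dm i * dm j *
          (poly ((pderiv ^^ d)
             (D 0 0 - Polynomial.smult (1 / dm i) (D i 0) - Polynomial.smult (1 / dm j) (D 0 j)
              + Polynomial.smult (1 / (dm i * dm j)) (D i j))) 1 / fact d) = of_nat (\<mu> 0) * N * K.inv_cartan i j"
        unfolding dm_def D_def d_def N by (rule K.derivative_formula[OF hs cb i' j])
      then show "2 * K.inv_cartan i j = 2 / (of_nat (\<mu> 0) * N) * (dm i * dm j *
          (poly ((pderiv ^^ d)
             (D 0 0 - Polynomial.smult (1 / dm i) (D i 0) - Polynomial.smult (1 / dm j) (D 0 j)
              + Polynomial.smult (1 / (dm i * dm j)) (D i j))) 1 / fact d))"
        using rank0 by (simp only:) simp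
    qed
    show "of_real (r i) = 2 * (\<Sum>j=1..n. dm i * dm j * res_one
          ((M 0 0 - fps_const (1 / dm i) * M i 0 - fps_const (1 / dm j) * M 0 j
            + fps_const (1 / (dm i * dm j)) * M i j) / (1 - fps_X)))"
      unfolding r dm_def M_def K.M_reduced_def[symmetric]
      by (intro arg_cong[of _ _ "(*) 2"] sum.cong refl) (use K.residue_formula[OF i'] in simp)
    show "of_real (r i) = 2 / N * (\<Sum>j=1..n. \<Sum>k=1..n.
          of_nat (card (C k)) * (\<chi> i (g k) - dm i) * (cnj (\<chi> j (g k)) - dm j)
            / det (1\<^sub>m 2 - g k))"
    proof -
      have "(\<Sum>j=1..n. \<Sum>k=1..n.
          of_nat (card (C k)) * (\<chi> i (g k) - dm i) * (cnj (\<chi> j (g k)) - dm j)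
            / det (1\<^sub>m 2 - g k)) = (\<Sum>j=1..n. N * K.inv_cartan i j)"
        unfolding dm_def \<chi>_def N
        by (intro sum.cong refl K.character_formula[OF i']) (use \<open>g 0 = 1\<^sub>m 2\<close> in \<open>auto simp: \<Gamma>\<close>)
      then show ?thesis
        using K.N_nonzero unfolding r N by (simp flip: sum_distrib_left)
    qed
  qed
qed

end
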